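(* Let $M$ be a finite factor admitting an outer action by a finite-dimensional Hopf $C^*$-algebra $H$. Then $\mathrm{QGal}(M\subset M\rtimes H)=H^*$; that is, the dual Hopf $*$-algebra $H^*$, acting on $M\rtimes H$ by $u\cdot(x\rtimes h)=x\rtimes h_1\,u(h_2)$ for $u\in H^*$, $x\in M$, $h\in H$, is a terminal object of the category $\mathrm{C}(M\subset M\rtimes H)$.
   Context: A Hopf $*$-algebra is a complex Hopf algebra $Q$ (with $\Delta q=q_1\otimes q_2$, counit $\varepsilon$, antipode $S$) that is a $*$-algebra such that $\Delta$ is a $*$-algebra morphism and $q\mapsto S(q)^*$ is an involution. A finite-dimensional Hopf $C^*$-algebra is a finite-dimensional Hopf $*$-algebra whose underlying $*$-algebra is a $C^*$-algebra; its linear dual $H^*$ is again a Hopf $*$-algebra, with involution $u^*(h)=\overline{u(S(h)^* )}$. An action of $Q$ on a $*$-algebra $A$ (making $A$ a module $*$-algebra) is a left module structure with $q\cdot(xy)=(q_1\cdot x)(q_2\cdot y)$, $q\cdot 1=\varepsilon(q)1$, $(q\cdot x)^*=S(q)^*\cdot x^*$; $A^Q=\{x: q\cdot x=\varepsilon(q)x\ \forall q\in Q\}$. For an action of $H$ on $M$, $M\rtimes H$ is the crossed (smash) product: $M\otimes H$ with elementary tensors written $x\rtimes h$ and product $(x\rtimes h)(y\rtimes g)=x(h_1\cdot y)\rtimes h_2g$, with the involution determined by those of $M$ and $H$. $M$ is identified with $M\rtimes 1$. The action is outer if the commutant of $M$ in $M\rtimes H$ is $\mathbb{C}1$. For a unital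 inclusion $N\subset R$, $\mathrm{C}(N\subset R)$ is the category whose objects are Hopf $*$-algebras $Q$ equipped with an action on $R$ making it a module $*$-algebra with $N\subset R^Q$, and whose morphisms are Hopf $*$-algebra morphisms $\phi:Q\to Q'$ with $\phi(q)\cdot x=q\cdot x$ for all $q\in Q$, $x\in R$. $\mathrm{QGal}(N\subset R)$ denotes a terminal object of this category. *)

theory Defs
  imports Complex_Main "HOL-Library.Function_Algebras" "HOL-Algebra.Group"
begin

section \<open>Complex vector spaces and complex Hilbert spaces\<close>

class complex_vector = ab_group_add +
  fixes scaleC :: "complex \<Rightarrow> 'a \<Rightarrow> 'a"  (infixr \<open>*\<^sub>C\<close> 75)
  assumes scaleC_add_right: "c *\<^sub>C (x + y) = c *\<^sub>C x + c *\<^sub>C y"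
    and scaleC_add_left: "(c + d) *\<^sub>C x = c *\<^sub>C x + d *\<^sub>C x"
    and scaleC_scaleC: "c *\<^sub>C d *\<^sub>C x = (c * d) *\<^sub>C x"
    and scaleC_one: "1 *\<^sub>C x = x"

global_interpretation complex_vector: vector_space "scaleC :: complex \<Rightarrow> 'a \<Rightarrow> 'a::complex_vector"
  by unfold_locales (fact scaleC_add_right scaleC_add_left scaleC_scaleC scaleC_one)+

instantiation complex :: complex_vector
begin
definition scaleC_complex_def: "(c::complex) *\<^sub>C x = c * x"
instance by standard (auto simp: scaleC_complex_def algebra_simps)
end

instantiation "fun" :: (type, complex_vector) complex_vector
begin
definition scaleC_fun_def: "c *\<^sub>C f = (\<lambda>x. c *\<^sub>C f x)"
instance
  by standard
    (auto simp: scaleC_fun_def fun_eq_iff scaleC_add_right scaleC_add_left scaleC_scaleC scaleC_one)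
end

class complex_hilbert_space = complex_vector + banach +
  fixes cinner :: "'a \<Rightarrow> 'a \<Rightarrow> complex"
  assumes scaleR_scaleC: "r *\<^sub>R x = complex_of_real r *\<^sub>C x"
    and cinner_add_left: "cinner (x + y) z = cinner x z + cinner y z"
    and cinner_scaleC_left: "cinner (c *\<^sub>C x) y = c * cinner x y"
    and cinner_commute: "cinner x y = cnj (cinner y x)"
    and cinner_self: "cinner x x = complex_of_real ((norm x)\<^sup>2)"

definition clinear_on :: "'a::complex_vector set \<Rightarrow> ('a \<Rightarrow> 'b::complex_vector) \<Rightarrow> bool" where
  "clinear_on A f \<longleftrightarrow>
     (\<forall>x\<in>A. \<forall>y\<in>A. f (x + y) = f x + f y) \<and> (\<forall>c. \<forall>x\<in>A. f (c *\<^sub>C x) = c *\<^sub>C f x)"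

definition cbilinear_on ::
  "'a::complex_vector set \<Rightarrow> 'b::complex_vector set \<Rightarrow> ('a \<Rightarrow> 'b \<Rightarrow> 'c::complex_vector) \<Rightarrow> bool" where
  "cbilinear_on A B f \<longleftrightarrow>
     (\<forall>y\<in>B. clinear_on A (\<lambda>x. f x y)) \<and> (\<forall>x\<in>A. clinear_on B (f x))"


section \<open>Algebraic tensor products\<close>

text \<open>
  The algebraic tensor product of two complex vector spaces is realised inside the linear dual
  of the space of bilinear forms: the elementary tensor of \<open>x\<close> and \<open>y\<close> is evaluation at
  \<open>(x, y)\<close>. Over a field the subspace spanned by the elementary tensors is the usual tensor
  product, since bilinear forms on subspaces extend and separate tensors; the lemmas
  \<open>tensor_lift_pure\<close> and \<open>clinear_on_tensor_lift\<close> below are its universal property.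
\<close>

type_synonym ('a, 'b) tensor = "('a \<Rightarrow> 'b \<Rightarrow> complex) \<Rightarrow> complex"

definition pure_tensor :: "'a::complex_vector \<Rightarrow> 'b::complex_vector \<Rightarrow> ('a, 'b) tensor"
    (infixr \<open>\<boxtimes>\<close> 75) where
  "x \<boxtimes> y = (\<lambda>\<beta>. if cbilinear_on UNIV UNIV \<beta> then \<beta> x y else 0)"

definition tensor_space ::
  "'a::complex_vector set \<Rightarrow> 'b::complex_vector set \<Rightarrow> ('a, 'b) tensor set" where
  "tensor_space A B = complex_vector.span {x \<boxtimes> y | x y. x \<in> A \<and> y \<in> B}"

text \<open>
  For \<open>t = x\<^sub>1 \<boxtimes> y\<^sub>1 + \<dots> + x\<^sub>n \<boxtimes> y\<^sub>n\<close> with \<open>x\<^sub>i \<in> A\<close> and \<open>y\<^sub>i \<in> B\<close>, the value of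
  \<open>tensor_lift A B f t\<close> is \<open>f x\<^sub>1 y\<^sub>1 + \<dots> + f x\<^sub>n y\<^sub>n\<close>. It does not depend on the
  decomposition of \<open>t\<close> if \<open>f\<close> is bilinear, or conjugate-linear in both arguments (the latter
  is needed for involutions).
\<close>

definition tensor_lift ::
  "'a::complex_vector set \<Rightarrow> 'b::complex_vector set \<Rightarrow> ('a \<Rightarrow> 'b \<Rightarrow> 'c::complex_vector)
     \<Rightarrow> ('a, 'b) tensor \<Rightarrow> 'c" where
  "tensor_lift A B f t =
     (let xys = (SOME xys. set xys \<subseteq> A \<times> B \<and> t = (\<Sum>(x, y)\<leftarrow>xys. x \<boxtimes> y))
      in \<Sum>(x, y)\<leftarrow>xys. f x y)"

lemma exists_separating_functional:
  fixes d :: "'c::complex_vector"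
  assumes "d \<noteq> 0"
  obtains g :: "'c \<Rightarrow> complex" where "clinear_on UNIV g" "g d \<noteq> 0"
proof -
  interpret P: vector_space_pair "scaleC :: complex \<Rightarrow> 'c \<Rightarrow> 'c"
    "scaleC :: complex \<Rightarrow> complex \<Rightarrow> complex" ..
  have ind: "complex_vector.independent {d}"
    using assms by simp
  define g where "g = P.construct {d} (\<lambda>_. 1)"
  have "Vector_Spaces.linear scaleC scaleC g"
    unfolding g_def by (rule P.linear_construct[OF ind])
  then have "clinear_on UNIV g"
    by (simp add: clinear_on_def Vector_Spaces.linear_iff_module_hom module_hom_iff)
  moreover have "g d = 1"
    unfolding g_def by (simp add: P.construct_basis[OF ind])
  ultimately show ?thesis
    using that by simp
qed

lemma exists_projection:
  fixes A :: "'a::complex_vector set"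
  assumes "complex_vector.subspace A"
  obtains p :: "'a \<Rightarrow> 'a" where "clinear_on UNIV p" "range p \<subseteq> A" "\<And>x. x \<in> A \<Longrightarrow> p x = x"
proof -
  interpret P: vector_space_pair "scaleC :: complex \<Rightarrow> 'a \<Rightarrow> 'a" "scaleC :: complex \<Rightarrow> 'a \<Rightarrow> 'a" ..
  have lin: "Vector_Spaces.linear scaleC scaleC (\<lambda>x::'a. x)"
    by (simp add: Vector_Spaces.linear_iff_module_hom module_hom_iff complex_vector.module_axioms)
  obtain p where p: "p ` UNIV \<subseteq> A" "Vector_Spaces.linear scaleC scaleC p" "\<forall>v\<in>A. p v = v"
    using P.linear_exists_left_inverse_on[OF lin assms] by (auto simp: inj_on_def)
  then have "clinear_on UNIV p"
    by (simp add: clinear_on_def Vector_Spaces.linear_iff_module_hom module_hom_iff)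
  then show ?thesis
    using p that by simp
qed

lemma pure_tensor_sum_apply:
  "cbilinear_on UNIV UNIV \<beta> \<Longrightarrow>
   (\<Sum>(x, y)\<leftarrow>xys. x \<boxtimes> y) \<beta> = (\<Sum>(x, y)\<leftarrow>xys. \<beta> x y)"
  by (induction xys) (auto simp: pure_tensor_def)

lemma clinear_on_sum_list:
  assumes "clinear_on UNIV g"
  shows "g (sum_list zs) = (\<Sum>z\<leftarrow>zs. g z)"
proof (induction zs)
  case Nil
  have "g (0 *\<^sub>C 0) = 0 *\<^sub>C g 0"
    using assms unfolding clinear_on_def by blast
  then show ?case by simp
qed (use assms in \<open>auto simp: clinear_on_def\<close>)

lemma tensor_sum_eq:
  fixes f :: "'a::complex_vector \<Rightarrow> 'b::complex_vector \<Rightarrow> 'c::complex_vector"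
  assumes A: "complex_vector.subspace A" and B: "complex_vector.subspace B"
    and f: "cbilinear_on A B f"
    and xys: "set xys \<subseteq> A \<times> B" and uvs: "set uvs \<subseteq> A \<times> B"
    and eq: "(\<Sum>(x, y)\<leftarrow>xys. x \<boxtimes> y) = (\<Sum>(x, y)\<leftarrow>uvs. x \<boxtimes> y)"
  shows "(\<Sum>(x, y)\<leftarrow>xys. f x y) = (\<Sum>(x, y)\<leftarrow>uvs. f x y)"
proof (rule ccontr)
  assume neq: "\<not> ?thesis"
  obtain p where p: "clinear_on UNIV p" "range p \<subseteq> A" "\<And>x. x \<in> A \<Longrightarrow> p x = x"
    using exists_projection[OF A] by blast
  obtain q where q: "clinear_on UNIV q" "range q \<subseteq> B" "\<And>x. x \<in> B \<Longrightarrow> q x = x"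
    using exists_projection[OF B] by blast
  obtain g :: "'c \<Rightarrow> complex" where g: "clinear_on UNIV g"
    "g ((\<Sum>(x, y)\<leftarrow>xys. f x y) - (\<Sum>(x, y)\<leftarrow>uvs. f x y)) \<noteq> 0"
    using exists_separating_functional neq by (metis right_minus_eq)
  define \<beta> where "\<beta> x y = g (f (p x) (q y))" for x y
  have pq: "p x \<in> A" "q y \<in> B" for x y
    using p(2) q(2) by auto
  have bil: "cbilinear_on UNIV UNIV \<beta>"
    using p(1) q(1) g(1) f pq unfolding cbilinear_on_def clinear_on_def \<beta>_def by simp
  have val: "(\<Sum>(x, y)\<leftarrow>zs. \<beta> x y) = g (\<Sum>(x, y)\<leftarrow>zs. f x y)" if "set zs \<subseteq> A \<times> B" for zs
  proof -
    have "map (\<lambda>(x, y). \<beta> x y) zs = map g (map (\<lambda>(x, y). f x y) zs)"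
      using that p(3) q(3) by (auto simp: \<beta>_def)
    then show ?thesis
      by (simp only: clinear_on_sum_list[OF g(1)])
  qed
  have "g (\<Sum>(x, y)\<leftarrow>xys. f x y) = g (\<Sum>(x, y)\<leftarrow>uvs. f x y)"
    using pure_tensor_sum_apply[OF bil, of xys] pure_tensor_sum_apply[OF bil, of uvs]
    by (simp add: val[OF xys] val[OF uvs] eq)
  moreover have "g (a - b) = g a - g b" for a b
  proof -
    have "g a = g ((a - b) + b)" by simp
    also have "\<dots> = g (a - b) + g b"
      using g(1) unfolding clinear_on_def by blast
    finally show ?thesis by simp
  qed
  ultimately show False
    using g(2) by simp
qed

lemma scaleC_pure_tensor: "c *\<^sub>C (x \<boxtimes> y) = (c *\<^sub>C x) \<boxtimes> y"
  by (auto simp: pure_tensor_def scaleC_fun_def cbilinear_on_def clinear_on_def fun_eq_iff)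

lemma scaleC_tensor_sum:
  "c *\<^sub>C (\<Sum>(x, y)\<leftarrow>xys. x \<boxtimes> y) = (\<Sum>(x, y)\<leftarrow>map (\<lambda>(x, y). (c *\<^sub>C x, y)) xys. x \<boxtimes> y)"
proof (induction xys)
  case (Cons z zs)
  obtain x y where "z = (x, y)" by (cases z)
  then show ?case
    using Cons
    by (simp only: list.map sum_list.Cons prod.case complex_vector.scale_right_distrib
        scaleC_pure_tensor)
qed (simp only: list.map sum_list.Nil complex_vector.scale_zero_right)

lemma tensor_space_decomposition:
  assumes "complex_vector.subspace A" "t \<in> tensor_space A B"
  obtains xys where "set xys \<subseteq> A \<times> B" "t = (\<Sum>(x, y)\<leftarrow>xys. x \<boxtimes> y)"
proof -
  have "\<exists>xys. set xys \<subseteq> A \<times> B \<and> t = (\<Sum>(x, y)\<leftarrow>xys. x \<boxtimes> y)"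
    using assms(2) unfolding tensor_space_def
  proof (induction rule: complex_vector.span_induct_alt)
    case base
    show ?case by (rule exI[of _ "[]"]) simp
  next
    case (step c s t)
    then obtain x y xys where "s = x \<boxtimes> y" "x \<in> A" "y \<in> B" "set xys \<subseteq> A \<times> B"
      "t = (\<Sum>(x, y)\<leftarrow>xys. x \<boxtimes> y)"
      by blast
    then have "set ((c *\<^sub>C x, y) # xys) \<subseteq> A \<times> B"
      "c *\<^sub>C s + t = (\<Sum>(x, y)\<leftarrow>(c *\<^sub>C x, y) # xys. x \<boxtimes> y)"
      using assms(1) by (auto simp: scaleC_pure_tensor complex_vector.subspace_scale)
    then show ?case by blast
  qed
  then show ?thesis using that by blast
qed

lemma tensor_lift_sum:
  assumes "complex_vector.subspace A" "complex_vector.subspace B" "cbilinear_on A B f"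
    and "set xys \<subseteq> A \<times> B"
  shows "tensor_lift A B f (\<Sum>(x, y)\<leftarrow>xys. x \<boxtimes> y) = (\<Sum>(x, y)\<leftarrow>xys. f x y)"
proof -
  let ?P = "\<lambda>uvs. set uvs \<subseteq> A \<times> B \<and> (\<Sum>(x, y)\<leftarrow>xys. x \<boxtimes> y) = (\<Sum>(x, y)\<leftarrow>uvs. x \<boxtimes> y)"
  have "?P (SOME uvs. ?P uvs)"
    using assms(4) by (intro someI[of ?P xys]) simp
  then show ?thesis
    unfolding tensor_lift_def Let_def
    using tensor_sum_eq[OF assms(1-3), of "SOME uvs. ?P uvs" xys] assms(4) by simp
qed

lemma tensor_lift_pure:
  assumes "complex_vector.subspace A" "complex_vector.subspace B" "cbilinear_on A B f"
    and "x \<in> A" "y \<in> B"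
  shows "tensor_lift A B f (x \<boxtimes> y) = f x y"
  using tensor_lift_sum[OF assms(1-3), of "[(x, y)]"] assms(4,5) by simp

lemma clinear_on_tensor_lift:
  assumes A: "complex_vector.subspace A" and B: "complex_vector.subspace B"
    and f: "cbilinear_on A B f"
  shows "clinear_on (tensor_space A B) (tensor_lift A B f)"
  unfolding clinear_on_def
proof (intro conjI ballI allI)
  fix s t assume "s \<in> tensor_space A B" "t \<in> tensor_space A B"
  then obtain xys uvs where *: "set xys \<subseteq> A \<times> B" "s = (\<Sum>(x, y)\<leftarrow>xys. x \<boxtimes> y)"
    "set uvs \<subseteq> A \<times> B" "t = (\<Sum>(x, y)\<leftarrow>uvs. x \<boxtimes> y)"
    using tensor_space_decomposition[OF A] by metis
  have "s + t = (\<Sum>(x, y)\<leftarrow>xys @ uvs. x \<boxtimes> y)"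
    by (simp add: *)
  then show "tensor_lift A B f (s + t) = tensor_lift A B f s + tensor_lift A B f t"
    using tensor_lift_sum[OF A B f, of xys] tensor_lift_sum[OF A B f, of uvs]
      tensor_lift_sum[OF A B f, of "xys @ uvs"] * by simp
next
  fix c s assume "s \<in> tensor_space A B"
  then obtain xys where *: "set xys \<subseteq> A \<times> B" "s = (\<Sum>(x, y)\<leftarrow>xys. x \<boxtimes> y)"
    using tensor_space_decomposition[OF A] by metis
  let ?m = "map (\<lambda>(x, y). (c *\<^sub>C x, y)) xys"
  have "set ?m \<subseteq> A \<times> B"
    using * A by (auto simp: complex_vector.subspace_scale)
  moreover have "(\<Sum>(x, y)\<leftarrow>?m. f x y) = c *\<^sub>C (\<Sum>(x, y)\<leftarrow>xys. f x y)"
    using *(1)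
  proof (induction xys)
    case (Cons z zs)
    then show ?case
      using f by (auto simp: cbilinear_on_def clinear_on_def complex_vector.scale_right_distrib)
  qed simp
  ultimately show "tensor_lift A B f (c *\<^sub>C s) = c *\<^sub>C tensor_lift A B f s"
    using tensor_lift_sum[OF A B f, of xys] tensor_lift_sum[OF A B f, of ?m] *
    by (simp only: scaleC_tensor_sum)
qed


section \<open>Unital *-algebras\<close>

text \<open>
  Carriers are linear subspaces of a type in class \<^class>\<open>complex_vector\<close>; the vector space
  structure is that of the type. Algebras are unital, and operations are only specified on carriers.
\<close>

record 'a star_alg = "'a monoid" +
  star :: "'a \<Rightarrow> 'a"

locale star_algebra = monoid A for A :: "('a::complex_vector, 'b) star_alg_scheme" (structure) +
  assumes subspace_carrier: "complex_vector.subspace (carrier A)"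
    and mult_bilinear: "cbilinear_on (carrier A) (carrier A) (mult A)"
    and star_closed: "x \<in> carrier A \<Longrightarrow> star A x \<in> carrier A"
    and star_add: "x \<in> carrier A \<Longrightarrow> y \<in> carrier A \<Longrightarrow> star A (x + y) = star A x + star A y"
    and star_scaleC: "x \<in> carrier A \<Longrightarrow> star A (c *\<^sub>C x) = cnj c *\<^sub>C star A x"
    and star_mult: "x \<in> carrier A \<Longrightarrow> y \<in> carrier A \<Longrightarrow> star A (x \<otimes> y) = star A y \<otimes> star A x"
    and star_star: "x \<in> carrier A \<Longrightarrow> star A (star A x) = x"

definition star_hom ::
  "('a::complex_vector, 'c) star_alg_scheme \<Rightarrow> ('b::complex_vector, 'd) star_alg_scheme
     \<Rightarrow> ('a \<Rightarrow> 'b) set" where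
  "star_hom A B = {f \<in> carrier A \<rightarrow> carrier B.
     clinear_on (carrier A) f \<and>
     (\<forall>x\<in>carrier A. \<forall>y\<in>carrier A. f (x \<otimes>\<^bsub>A\<^esub> y) = f x \<otimes>\<^bsub>B\<^esub> f y) \<and>
     f \<one>\<^bsub>A\<^esub> = \<one>\<^bsub>B\<^esub> \<and>
     (\<forall>x\<in>carrier A. f (star A x) = star B (f x))}"

definition unital_star_subalgebra ::
  "'a set \<Rightarrow> ('a::complex_vector, 'b) star_alg_scheme \<Rightarrow> bool" where
  "unital_star_subalgebra N A \<longleftrightarrow>
     complex_vector.subspace N \<and> N \<subseteq> carrier A \<and> \<one>\<^bsub>A\<^esub> \<in> N \<and>
     (\<forall>x\<in>N. \<forall>y\<in>N. x \<otimes>\<^bsub>A\<^esub> y \<in> N) \<and> (\<forall>x\<in>N. star A x \<in> N)"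

definition tensor_alg ::
  "('a::complex_vector, 'c) star_alg_scheme \<Rightarrow> ('b::complex_vector, 'd) star_alg_scheme
     \<Rightarrow> ('a, 'b) tensor star_alg" where
  "tensor_alg A B = \<lparr>
     carrier = tensor_space (carrier A) (carrier B),
     mult = (\<lambda>s t. tensor_lift (carrier A) (carrier B) (\<lambda>a b.
       tensor_lift (carrier A) (carrier B) (\<lambda>c d. (a \<otimes>\<^bsub>A\<^esub> c) \<boxtimes> (b \<otimes>\<^bsub>B\<^esub> d)) t) s),
     one = \<one>\<^bsub>A\<^esub> \<boxtimes> \<one>\<^bsub>B\<^esub>,
     star = tensor_lift (carrier A) (carrier B) (\<lambda>a b. star A a \<boxtimes> star B b)\<rparr>"

definition cstar_algebra :: "('a::complex_vector, 'b) star_alg_scheme \<Rightarrow> bool" where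
  "cstar_algebra A \<longleftrightarrow> star_algebra A \<and>
     (\<exists>n::'a \<Rightarrow> real.
        (\<forall>x\<in>carrier A. 0 \<le> n x \<and> (n x = 0 \<longleftrightarrow> x = 0)) \<and>
        (\<forall>c. \<forall>x\<in>carrier A. n (c *\<^sub>C x) = cmod c * n x) \<and>
        (\<forall>x\<in>carrier A. \<forall>y\<in>carrier A. n (x + y) \<le> n x + n y) \<and>
        (\<forall>x\<in>carrier A. \<forall>y\<in>carrier A. n (x \<otimes>\<^bsub>A\<^esub> y) \<le> n x * n y) \<and>
        (\<forall>x\<in>carrier A. n (star A x \<otimes>\<^bsub>A\<^esub> x) = (n x)\<^sup>2) \<and>
        (\<forall>X::nat \<Rightarrow> 'a. range X \<subseteq> carrier A \<longrightarrow>
           (\<forall>e>0. \<exists>K. \<forall>i\<ge>K. \<forall>j\<ge>K. n (X i - X j) < e) \<longrightarrow>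
           (\<exists>x\<in>carrier A. (\<lambda>i. n (X i - x)) \<longlonglongrightarrow> 0)))"


section \<open>Finite factors\<close>

definition bounded_operators :: "('v::complex_hilbert_space \<Rightarrow> 'v) set" where
  "bounded_operators = {T. clinear_on UNIV T \<and> bounded_linear T}"

definition operator_commutant ::
  "('v::complex_hilbert_space \<Rightarrow> 'v) set \<Rightarrow> ('v \<Rightarrow> 'v) set" where
  "operator_commutant X = {T \<in> bounded_operators. \<forall>S\<in>X. T \<circ> S = S \<circ> T}"

definition is_adjoint ::
  "('v::complex_hilbert_space \<Rightarrow> 'v) \<Rightarrow> ('v \<Rightarrow> 'v) \<Rightarrow> bool" where
  "is_adjoint S T \<longleftrightarrow> (\<forall>x y. cinner (T x) y = cinner x (S y))"

definition adjoint_operator ::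
  "('v::complex_hilbert_space \<Rightarrow> 'v) \<Rightarrow> 'v \<Rightarrow> 'v" where
  "adjoint_operator T = (THE S. is_adjoint S T)"

definition von_neumann_algebra :: "('v::complex_hilbert_space \<Rightarrow> 'v) set \<Rightarrow> bool" where
  "von_neumann_algebra M \<longleftrightarrow>
     M \<subseteq> bounded_operators \<and>
     (\<forall>T\<in>M. \<exists>S\<in>M. is_adjoint S T) \<and>
     operator_commutant (operator_commutant M) = M"

text \<open>The zero algebra (on the zero Hilbert space) is not a factor.\<close>

definition factor :: "('v::complex_hilbert_space \<Rightarrow> 'v) set \<Rightarrow> bool" where
  "factor M \<longleftrightarrow> von_neumann_algebra M \<and> (id :: 'v \<Rightarrow> 'v) \<noteq> 0 \<and>
     M \<inter> operator_commutant M = range (\<lambda>c. c *\<^sub>C id)"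

definition finite_factor :: "('v::complex_hilbert_space \<Rightarrow> 'v) set \<Rightarrow> bool" where
  "finite_factor M \<longleftrightarrow> factor M \<and>
     (\<forall>V\<in>M. adjoint_operator V \<circ> V = id \<longrightarrow> V \<circ> adjoint_operator V = id)"

definition operator_algebra ::
  "('v::complex_hilbert_space \<Rightarrow> 'v) set \<Rightarrow> ('v \<Rightarrow> 'v) star_alg" where
  "operator_algebra M = \<lparr>carrier = M, mult = (\<circ>), one = id, star = adjoint_operator\<rparr>"


section \<open>Hopf *-algebras\<close>

record 'a hopf_alg = "'a star_alg" +
  comult :: "'a \<Rightarrow> ('a, 'a) tensor"
  counit :: "'a \<Rightarrow> complex"
  antipode :: "'a \<Rightarrow> 'a"

text \<open>\<open>sweedler Q f q\<close> is the Sweedler expression \<open>f q\<^sub>1 q\<^sub>2\<close>.\<close>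

definition sweedler ::
  "('a::complex_vector, 'b) hopf_alg_scheme \<Rightarrow> ('a \<Rightarrow> 'a \<Rightarrow> 'c::complex_vector) \<Rightarrow> 'a \<Rightarrow> 'c" where
  "sweedler Q f q = tensor_lift (carrier Q) (carrier Q) f (comult Q q)"

locale hopf_star_algebra = star_algebra Q
  for Q :: "('a::complex_vector, 'b) hopf_alg_scheme" (structure) +
  assumes comult_hom: "comult Q \<in> star_hom Q (tensor_alg Q Q)"
    and coassoc: "q \<in> carrier Q \<Longrightarrow>
      sweedler Q (\<lambda>a b. sweedler Q (\<lambda>a\<^sub>1 a\<^sub>2. a\<^sub>1 \<boxtimes> (a\<^sub>2 \<boxtimes> b)) a) q = sweedler Q (\<lambda>a b. a \<boxtimes> comult Q b) q"
    and counit_linear: "clinear_on (carrier Q) (counit Q)"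
    and counit_mult:
      "p \<in> carrier Q \<Longrightarrow> q \<in> carrier Q \<Longrightarrow> counit Q (p \<otimes> q) = counit Q p * counit Q q"
    and counit_one: "counit Q \<one> = 1"
    and counit_left: "q \<in> carrier Q \<Longrightarrow> sweedler Q (\<lambda>a b. counit Q a *\<^sub>C b) q = q"
    and counit_right: "q \<in> carrier Q \<Longrightarrow> sweedler Q (\<lambda>a b. counit Q b *\<^sub>C a) q = q"
    and antipode_closed: "q \<in> carrier Q \<Longrightarrow> antipode Q q \<in> carrier Q"
    and antipode_linear: "clinear_on (carrier Q) (antipode Q)"
    and antipode_left:
      "q \<in> carrier Q \<Longrightarrow> sweedler Q (\<lambda>a b. antipode Q a \<otimes> b) q = counit Q q *\<^sub>C \<one>"
    and antipode_right:
      "q \<in> carrier Q \<Longrightarrow> sweedler Q (\<lambda>a b. a \<otimes> antipode Q b) q = counit Q q *\<^sub>C \<one>"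
    and antipode_star_involution:
      "q \<in> carrier Q \<Longrightarrow> star Q (antipode Q (star Q (antipode Q q))) = q"

definition finite_dim_hopf_cstar_algebra ::
  "('a::complex_vector, 'b) hopf_alg_scheme \<Rightarrow> bool" where
  "finite_dim_hopf_cstar_algebra H \<longleftrightarrow>
     hopf_star_algebra H \<and> cstar_algebra H \<and>
     (\<exists>B. finite B \<and> complex_vector.span B = carrier H)"

text \<open>
  Morphisms are extensional functions (they take the value \<open>undefined\<close> outside the carrier), so that
  equality of morphisms is equality of functions.
\<close>

definition hopf_star_hom ::
  "('a::complex_vector, 'c) hopf_alg_scheme \<Rightarrow> ('b::complex_vector, 'd) hopf_alg_scheme
     \<Rightarrow> ('a \<Rightarrow> 'b) set" where
  "hopf_star_hom Q Q' = {\<phi> \<in> star_hom Q Q' \<inter> extensional (carrier Q).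
     (\<forall>q\<in>carrier Q. comult Q' (\<phi> q) = sweedler Q (\<lambda>a b. \<phi> a \<boxtimes> \<phi> b) q) \<and>
     (\<forall>q\<in>carrier Q. counit Q' (\<phi> q) = counit Q q) \<and>
     (\<forall>q\<in>carrier Q. antipode Q' (\<phi> q) = \<phi> (antipode Q q))}"

text \<open>
  The linear dual: linear functionals on the carrier, extended by 0 to the whole type. The
  product is convolution, \<open>(u v)(h) = u(h\<^sub>1) v(h\<^sub>2)\<close>, and the coproduct is the transpose of the
  product, \<open>u\<^sub>1(h) u\<^sub>2(g) = u(h g)\<close>.
\<close>

definition dual_space :: "'a::complex_vector set \<Rightarrow> ('a \<Rightarrow> complex) set" where
  "dual_space A = {u. clinear_on A u \<and> (\<forall>x. x \<notin> A \<longrightarrow> u x = 0)}"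

definition restrict_zero :: "'a set \<Rightarrow> ('a \<Rightarrow> complex) \<Rightarrow> 'a \<Rightarrow> complex" where
  "restrict_zero A u = (\<lambda>x. if x \<in> A then u x else 0)"

definition dual_hopf ::
  "('a::complex_vector, 'b) hopf_alg_scheme \<Rightarrow> ('a \<Rightarrow> complex) hopf_alg" where
  "dual_hopf H = \<lparr>
     carrier = dual_space (carrier H),
     mult = (\<lambda>u v. restrict_zero (carrier H) (sweedler H (\<lambda>a b. u a * v b))),
     one = restrict_zero (carrier H) (counit H),
     star = (\<lambda>u. restrict_zero (carrier H) (\<lambda>h. cnj (u (star H (antipode H h))))),
     comult = (\<lambda>u. THE t. t \<in> tensor_space (dual_space (carrier H)) (dual_space (carrier H)) \<and>
       (\<forall>h\<in>carrier H. \<forall>g\<in>carrier H.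
          tensor_lift (dual_space (carrier H)) (dual_space (carrier H)) (\<lambda>v w. v h * w g) t
            = u (h \<otimes>\<^bsub>H\<^esub> g))),
     counit = (\<lambda>u. u \<one>\<^bsub>H\<^esub>),
     antipode = (\<lambda>u. restrict_zero (carrier H) (\<lambda>h. u (antipode H h)))\<rparr>"


section \<open>Actions and crossed products\<close>

locale module_star_algebra = hopf_star_algebra Q + alg: star_algebra A
  for Q :: "('q::complex_vector, 'b) hopf_alg_scheme" (structure)
    and A :: "('a::complex_vector, 'c) star_alg_scheme"
    and act :: "'q \<Rightarrow> 'a \<Rightarrow> 'a" +
  assumes act_closed: "q \<in> carrier Q \<Longrightarrow> x \<in> carrier A \<Longrightarrow> act q x \<in> carrier A"
    and act_bilinear: "cbilinear_on (carrier Q) (carrier A) act"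
    and act_mult: "p \<in> carrier Q \<Longrightarrow> q \<in> carrier Q \<Longrightarrow> x \<in> carrier A \<Longrightarrow>
      act (p \<otimes> q) x = act p (act q x)"
    and act_unit: "x \<in> carrier A \<Longrightarrow> act \<one> x = x"
    and act_on_mult: "q \<in> carrier Q \<Longrightarrow> x \<in> carrier A \<Longrightarrow> y \<in> carrier A \<Longrightarrow>
      act q (x \<otimes>\<^bsub>A\<^esub> y) = sweedler Q (\<lambda>a b. act a x \<otimes>\<^bsub>A\<^esub> act b y) q"
    and act_on_one: "q \<in> carrier Q \<Longrightarrow> act q \<one>\<^bsub>A\<^esub> = counit Q q *\<^sub>C \<one>\<^bsub>A\<^esub>"
    and act_star: "q \<in> carrier Q \<Longrightarrow> x \<in> carrier A \<Longrightarrow>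
      star A (act q x) = act (star Q (antipode Q q)) (star A x)"

definition fixed_points ::
  "('q::complex_vector, 'b) hopf_alg_scheme \<Rightarrow> ('a::complex_vector, 'c) star_alg_scheme
     \<Rightarrow> ('q \<Rightarrow> 'a \<Rightarrow> 'a) \<Rightarrow> 'a set" where
  "fixed_points Q A act = {x \<in> carrier A. \<forall>q\<in>carrier Q. act q x = counit Q q *\<^sub>C x}"

text \<open>
  The involution is \<open>(x \<rtimes> h)\<^sup>* = (1 \<rtimes> h\<^sup>*)(x\<^sup>* \<rtimes> 1) = (h\<^sup>*)\<^sub>1 \<cdot> x\<^sup>* \<rtimes> (h\<^sup>*)\<^sub>2\<close>, the only one
  extending those of \<open>M\<close> and \<open>H\<close>.
\<close>

definition crossed_product ::
  "('m::complex_vector, 'b) star_alg_scheme \<Rightarrow> ('h::complex_vector, 'c) hopf_alg_scheme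
     \<Rightarrow> ('h \<Rightarrow> 'm \<Rightarrow> 'm) \<Rightarrow> ('m, 'h) tensor star_alg" where
  "crossed_product M H act = \<lparr>
     carrier = tensor_space (carrier M) (carrier H),
     mult = (\<lambda>s t. tensor_lift (carrier M) (carrier H) (\<lambda>x h.
       tensor_lift (carrier M) (carrier H) (\<lambda>y g.
         sweedler H (\<lambda>h\<^sub>1 h\<^sub>2. (x \<otimes>\<^bsub>M\<^esub> act h\<^sub>1 y) \<boxtimes> (h\<^sub>2 \<otimes>\<^bsub>H\<^esub> g)) h) t) s),
     one = \<one>\<^bsub>M\<^esub> \<boxtimes> \<one>\<^bsub>H\<^esub>,
     star = tensor_lift (carrier M) (carrier H) (\<lambda>x h.
       sweedler H (\<lambda>a b. act a (star M x) \<boxtimes> b) (star H h))\<rparr>"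

definition crossed_base ::
  "('m::complex_vector, 'b) star_alg_scheme \<Rightarrow> ('h::complex_vector, 'c) hopf_alg_scheme
     \<Rightarrow> ('m, 'h) tensor set" where
  "crossed_base M H = (\<lambda>x. x \<boxtimes> \<one>\<^bsub>H\<^esub>) ` carrier M"

definition commutant_in :: "'a set \<Rightarrow> ('a, 'b) monoid_scheme \<Rightarrow> 'a set" where
  "commutant_in N A = {t \<in> carrier A. \<forall>x\<in>N. t \<otimes>\<^bsub>A\<^esub> x = x \<otimes>\<^bsub>A\<^esub> t}"

definition outer_action ::
  "('m::complex_vector, 'b) star_alg_scheme \<Rightarrow> ('h::complex_vector, 'c) hopf_alg_scheme
     \<Rightarrow> ('h \<Rightarrow> 'm \<Rightarrow> 'm) \<Rightarrow> bool" where
  "outer_action M H act \<longleftrightarrow>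
     commutant_in (crossed_base M H) (crossed_product M H act)
       = range (\<lambda>c. c *\<^sub>C \<one>\<^bsub>crossed_product M H act\<^esub>)"

text \<open>The action \<open>u \<cdot> (x \<rtimes> h) = x \<rtimes> h\<^sub>1 u(h\<^sub>2)\<close> of the dual on the crossed product.\<close>

definition dual_action ::
  "('m::complex_vector, 'b) star_alg_scheme \<Rightarrow> ('h::complex_vector, 'c) hopf_alg_scheme
     \<Rightarrow> ('h \<Rightarrow> complex) \<Rightarrow> ('m, 'h) tensor \<Rightarrow> ('m, 'h) tensor" where
  "dual_action M H u = tensor_lift (carrier M) (carrier H) (\<lambda>x h.
     x \<boxtimes> sweedler H (\<lambda>h\<^sub>1 h\<^sub>2. u h\<^sub>2 *\<^sub>C h\<^sub>1) h)"


section \<open>The category of a unital inclusion and its terminal object\<close>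

definition inclusion_object ::
  "'a set \<Rightarrow> ('a::complex_vector, 'c) star_alg_scheme
     \<Rightarrow> ('q::complex_vector, 'b) hopf_alg_scheme \<Rightarrow> ('q \<Rightarrow> 'a \<Rightarrow> 'a) \<Rightarrow> bool" where
  "inclusion_object N R Q act \<longleftrightarrow> module_star_algebra Q R act \<and> N \<subseteq> fixed_points Q R act"

definition inclusion_hom ::
  "('a::complex_vector, 'c) star_alg_scheme
     \<Rightarrow> ('q::complex_vector, 'b) hopf_alg_scheme \<Rightarrow> ('q \<Rightarrow> 'a \<Rightarrow> 'a)
     \<Rightarrow> ('p::complex_vector, 'd) hopf_alg_scheme \<Rightarrow> ('p \<Rightarrow> 'a \<Rightarrow> 'a) \<Rightarrow> ('q \<Rightarrow> 'p) set" where
  "inclusion_hom R Q act Q' act' =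
     {\<phi> \<in> hopf_star_hom Q Q'. \<forall>q\<in>carrier Q. \<forall>x\<in>carrier R. act' (\<phi> q) x = act q x}"

text \<open>
  HOL cannot quantify over types inside a formula, so the type \<open>'q\<close> in which the competing objects
  live is an explicit parameter; the full universal property is the statement for all types \<open>'q\<close>.
\<close>

definition is_QGal ::
  "'q::complex_vector itself \<Rightarrow> 'a set \<Rightarrow> ('a::complex_vector, 'c) star_alg_scheme
     \<Rightarrow> ('p::complex_vector, 'd) hopf_alg_scheme \<Rightarrow> ('p \<Rightarrow> 'a \<Rightarrow> 'a) \<Rightarrow> bool" where
  "is_QGal _ N R G actG \<longleftrightarrow>
     unital_star_subalgebra N R \<and>
     inclusion_object N R G actG \<and>
     (\<forall>(Q :: 'q hopf_alg) act. inclusion_object N R Q act \<longrightarrow>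
        (\<exists>!\<phi>. \<phi> \<in> inclusion_hom R Q act G actG))"

end

theory Submission
  imports Defs
begin

text \<open>
  Let \<open>R\<close> be the crossed product of \<open>M\<close> and \<open>H\<close>, and write \<open>x\<close> for \<open>x \<rtimes> 1\<close> and \<open>h\<close> for \<open>1 \<rtimes> h\<close>.
  Suppose that \<open>Q\<close> acts on \<open>R\<close> and fixes \<open>M\<close> pointwise. Then every \<open>q\<close> acts by a map of
  \<open>M\<close>-bimodules (\<open>act_bimodule\<close>), and as \<open>q \<cdot> (x h) = x (q \<cdot> h)\<close>, it remains to find \<open>q \<cdot> h\<close>.

  Consider \<open>S(h\<^sub>1)(q \<cdot> h\<^sub>2)\<close>. An element \<open>x\<close> of \<open>M\<close> that multiplies it on the right can be moved to the
  left: \<open>(q \<cdot> h) x = q \<cdot> (h x) = (h\<^sub>1 \<cdot> x)(q \<cdot> h\<^sub>2)\<close>, and \<open>S(h\<^sub>1)(h\<^sub>2 \<cdot> x) = x S(h)\<close> in \<open>R\<close>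
  (\<open>antipode_times_base\<close>). Hence this element commutes with \<open>M\<close>, and because the action is outer it
  is a scalar \<open>u\<^sub>q(h)\<close> (\<open>scalar_part_scalar\<close>). Multiplying by \<open>h\<close> on the left gives
  \<open>q \<cdot> h = h\<^sub>1 S(h\<^sub>2)(q \<cdot> h\<^sub>3) = h\<^sub>1 u\<^sub>q(h\<^sub>2)\<close>: the element \<open>q\<close> acts exactly as the functional \<open>u\<^sub>q\<close>
  does (\<open>act_as_dual_action\<close>).

  The dual acts faithfully, because the counit sends \<open>h\<^sub>1 u(h\<^sub>2)\<close> to \<open>u(h)\<close>
  (\<open>dual_action_faithful\<close>). So \<open>q \<mapsto> u\<^sub>q\<close> is the only candidate for a morphism, and faithfulness
  also shows that it is one. It is multiplicative because both sides act in the same way; it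
  respects coproducts because \<open>q\<close> acts on a product \<open>h g\<close> through its coproduct; then it respects
  antipodes, since these are convolution inverses of the identity; and it respects involutions
  because \<open>(q \<cdot> x)\<^sup>* = S(q)\<^sup>* \<cdot> x\<^sup>*\<close> and every element of \<open>Q\<close> has the form \<open>S(q)\<close>.

  It must also be verified that the dual with its action on \<open>R\<close> is an object of the category: \<open>R\<close> is a
  *-algebra (\<open>star_algebra_crossed\<close>), the dual is a Hopf *-algebra (\<open>hopf_star_algebra_dual\<close>), and
  it acts on \<open>R\<close> (\<open>module_star_algebra_dual_action\<close>). Finite dimension of \<open>H\<close> is what makes
  \<open>(h, g) \<mapsto> u(h g)\<close> come from a tensor in \<open>H\<^sup>* \<otimes> H\<^sup>*\<close>, so that the dual has a coproduct.

  The computations are carried out with Sweedler expressions, which are values of (bi)linear maps on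
  coproducts. Since involutions are antilinear, linear and antilinear maps are treated together.
\<close>

section \<open>Semilinear maps on tensor products\<close>

abbreviation csubspace where "csubspace \<equiv> complex_vector.subspace"

text \<open>
  Linear and antilinear maps obey the same laws for tensors. The Boolean flag of \<open>semilin\<close> and
  \<open>bisemilin\<close> is true for antilinear maps, so that composing maps amounts to exclusive or of the flags.
\<close>

definition cnj_if :: "bool \<Rightarrow> complex \<Rightarrow> complex" where
  "cnj_if s c = (if s then cnj c else c)"

lemma cnj_if_simps [simp]:
  "cnj_if False c = c" "cnj_if True c = cnj c" "cnj_if s (cnj_if s c) = c"
  "cnj_if s (c + d) = cnj_if s c + cnj_if s d" "cnj_if s (c * d) = cnj_if s c * cnj_if s d"
  "cnj_if s c = cnj_if s d \<longleftrightarrow> c = d"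
  by (auto simp: cnj_if_def)

definition semilin :: "bool \<Rightarrow> 'a::complex_vector set \<Rightarrow> ('a \<Rightarrow> 'b::complex_vector) \<Rightarrow> bool" where
  "semilin s A f \<longleftrightarrow>
     (\<forall>x\<in>A. \<forall>y\<in>A. f (x + y) = f x + f y) \<and> (\<forall>c. \<forall>x\<in>A. f (c *\<^sub>C x) = cnj_if s c *\<^sub>C f x)"

definition bisemilin :: "bool \<Rightarrow> 'a::complex_vector set \<Rightarrow> 'b::complex_vector set
    \<Rightarrow> ('a \<Rightarrow> 'b \<Rightarrow> 'c::complex_vector) \<Rightarrow> bool" where
  "bisemilin s A B f \<longleftrightarrow>
     (\<forall>y\<in>B. semilin s A (\<lambda>x. f x y)) \<and> (\<forall>x\<in>A. semilin s B (\<lambda>y. f x y))"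

lemma clinear_on_semilin: "clinear_on A f \<longleftrightarrow> semilin False A f"
  by (simp add: clinear_on_def semilin_def)

lemma cbilinear_on_bisemilin: "cbilinear_on A B f \<longleftrightarrow> bisemilin False A B f"
  by (simp add: cbilinear_on_def bisemilin_def clinear_on_semilin)

lemma bisemilinI:
  "(\<And>y. y \<in> B \<Longrightarrow> semilin s A (\<lambda>x. f x y)) \<Longrightarrow> (\<And>x. x \<in> A \<Longrightarrow> semilin s B (\<lambda>y. f x y))
    \<Longrightarrow> bisemilin s A B f"
  by (simp add: bisemilin_def)

lemma semilin_add: "semilin s A f \<Longrightarrow> x \<in> A \<Longrightarrow> y \<in> A \<Longrightarrow> f (x + y) = f x + f y"
  by (simp add: semilin_def)

lemma semilin_scale: "semilin s A f \<Longrightarrow> x \<in> A \<Longrightarrow> f (c *\<^sub>C x) = cnj_if s c *\<^sub>C f x"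
  by (simp add: semilin_def)

lemma semilin_zero: "semilin s A f \<Longrightarrow> csubspace A \<Longrightarrow> f 0 = 0"
  using semilin_scale[of s A f 0 0] by (simp add: complex_vector.subspace_0 cnj_if_def split: if_splits)

lemma semilin_cong: "(\<And>x. x \<in> A \<Longrightarrow> f x = g x) \<Longrightarrow> csubspace A \<Longrightarrow>
    semilin s A f \<longleftrightarrow> semilin s A g"
  by (auto simp: semilin_def complex_vector.subspace_add complex_vector.subspace_scale)

text \<open>
  The flag of the outer map is written as \<open>s \<noteq> r\<close> so that it is determined by the flags of the inner
  and the composed map, which are the ones known when the rule is applied backwards.
\<close>

lemma semilin_compose:
  "semilin (s \<noteq> r) A g \<Longrightarrow> semilin s D f \<Longrightarrow> (\<And>x. x \<in> D \<Longrightarrow> f x \<in> A) \<Longrightarrow>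
    semilin r D (\<lambda>x. g (f x))"
  by (auto simp: semilin_def cnj_if_def)

lemma semilin_compose':
  "semilin False A g \<Longrightarrow> semilin s D f \<Longrightarrow> (\<And>x. x \<in> D \<Longrightarrow> f x \<in> A) \<Longrightarrow>
    semilin s D (\<lambda>x. g (f x))"
  by (auto simp: semilin_def cnj_if_def)

lemma semilin_left:
  "bisemilin False A B m \<Longrightarrow> semilin s D f \<Longrightarrow> (\<And>x. x \<in> D \<Longrightarrow> f x \<in> A) \<Longrightarrow> b \<in> B \<Longrightarrow>
    semilin s D (\<lambda>x. m (f x) b)"
  by (auto simp: semilin_def bisemilin_def cnj_if_def)

lemma semilin_right:
  "bisemilin False A B m \<Longrightarrow> semilin s D f \<Longrightarrow> (\<And>x. x \<in> D \<Longrightarrow> f x \<in> B) \<Longrightarrow> a \<in> A \<Longrightarrow>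
    semilin s D (\<lambda>x. m a (f x))"
  by (auto simp: semilin_def bisemilin_def cnj_if_def)

lemma semilin_ident: "semilin False D (\<lambda>x. x)"
  by (simp add: semilin_def)

lemma semilin_scaleC_right: "semilin s D f \<Longrightarrow> semilin s D (\<lambda>x. c *\<^sub>C f x)"
  by (simp add: semilin_def complex_vector.scale_right_distrib mult.commute scaleC_scaleC)

lemma semilin_scaleC_left: "semilin s D f \<Longrightarrow> semilin s D (\<lambda>x. f x *\<^sub>C v)"
  by (simp add: semilin_def complex_vector.scale_left_distrib scaleC_scaleC scaleC_complex_def)

lemma semilin_times_left: "semilin s D f \<Longrightarrow> semilin s D (\<lambda>x. f x * (c::complex))"
  by (simp add: semilin_def scaleC_complex_def algebra_simps)

lemma semilin_times_right: "semilin s D f \<Longrightarrow> semilin s D (\<lambda>x. (c::complex) * f x)"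
  by (simp add: semilin_def scaleC_complex_def algebra_simps)

lemma semilin_cnj: "semilin (\<not> s) D f \<Longrightarrow> semilin s D (\<lambda>x. cnj (f x))"
  by (cases s) (simp_all add: semilin_def scaleC_complex_def)

lemma pure_tensor_bisemilin: "bisemilin False A B (\<boxtimes>)"
  unfolding bisemilin_def semilin_def pure_tensor_def scaleC_fun_def fun_eq_iff plus_fun_def
  by (auto simp: cbilinear_on_def clinear_on_def)

lemma semilin_pure_left: "semilin s D f \<Longrightarrow> semilin s D (\<lambda>x. f x \<boxtimes> b)"
  using semilin_left[OF pure_tensor_bisemilin[of UNIV UNIV]] by blast

lemma semilin_pure_right: "semilin s D f \<Longrightarrow> semilin s D (\<lambda>x. a \<boxtimes> f x)"
  using semilin_right[OF pure_tensor_bisemilin[of UNIV UNIV]] by blast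

lemma scaleC_pure_right: "a \<boxtimes> (c *\<^sub>C b) = c *\<^sub>C (a \<boxtimes> b)"
  using semilin_scale[OF semilin_pure_right[OF semilin_ident[of UNIV]], of b a c] by simp

lemma scaleC_pure_left: "(c *\<^sub>C a) \<boxtimes> b = c *\<^sub>C (a \<boxtimes> b)"
  by (simp add: scaleC_pure_tensor)

lemma semilin_sum_list:
  assumes "semilin s A f" "csubspace A" "set zs \<subseteq> A"
  shows "sum_list zs \<in> A \<and> f (sum_list zs) = (\<Sum>z\<leftarrow>zs. f z)"
  using assms(3)
  by (induction zs)
    (auto simp: semilin_zero[OF assms(1,2)] semilin_add[OF assms(1)]
      assms(2) complex_vector.subspace_0 complex_vector.subspace_add)

lemma semilin_sum_pairs:
  assumes "semilin s A g" "csubspace A" "\<And>x y. (x, y) \<in> set xys \<Longrightarrow> f x y \<in> A"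
  shows "g (\<Sum>(x, y)\<leftarrow>xys. f x y) = (\<Sum>(x, y)\<leftarrow>xys. g (f x y))"
    and "(\<Sum>(x, y)\<leftarrow>xys. f x y) \<in> A"
proof -
  have "set (map (\<lambda>(x, y). f x y) xys) \<subseteq> A"
    using assms(3) by auto
  from semilin_sum_list[OF assms(1,2) this]
  show "g (\<Sum>(x, y)\<leftarrow>xys. f x y) = (\<Sum>(x, y)\<leftarrow>xys. g (f x y))"
    and "(\<Sum>(x, y)\<leftarrow>xys. f x y) \<in> A"
    by (simp_all add: o_def case_prod_unfold)
qed

lemma subspace_tensor_space: "csubspace (tensor_space A B)"
  by (simp add: tensor_space_def)

lemma pure_in_tensor_space: "x \<in> A \<Longrightarrow> y \<in> B \<Longrightarrow> x \<boxtimes> y \<in> tensor_space A B"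
  by (auto simp: tensor_space_def intro: complex_vector.span_base)

lemma tensor_space_eqI:
  assumes A: "csubspace A" and f: "semilin s (tensor_space A B) f"
    and g: "semilin s (tensor_space A B) g"
    and eq: "\<And>x y. x \<in> A \<Longrightarrow> y \<in> B \<Longrightarrow> f (x \<boxtimes> y) = g (x \<boxtimes> y)"
    and t: "t \<in> tensor_space A B"
  shows "f t = g t"
proof -
  obtain xys where xys: "set xys \<subseteq> A \<times> B" "t = (\<Sum>(x, y)\<leftarrow>xys. x \<boxtimes> y)"
    using tensor_space_decomposition[OF A t] .
  have mem: "x \<boxtimes> y \<in> tensor_space A B" if "(x, y) \<in> set xys" for x y
    using that xys(1) by (auto intro: pure_in_tensor_space)
  have "map (\<lambda>(x, y). f (x \<boxtimes> y)) xys = map (\<lambda>(x, y). g (x \<boxtimes> y)) xys"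
    using xys(1) eq by auto
  then show ?thesis
    unfolding xys(2)
    by (simp only: semilin_sum_pairs[OF f subspace_tensor_space mem]
        semilin_sum_pairs[OF g subspace_tensor_space mem])
qed

text \<open>
  An antilinear map becomes bilinear after composition with a conjugated functional, and functionals
  separate points; so the linear case implies the antilinear one.
\<close>

lemma tensor_sum_eq_semilin:
  fixes f :: "'a::complex_vector \<Rightarrow> 'b::complex_vector \<Rightarrow> 'c::complex_vector"
  assumes A: "csubspace A" and B: "csubspace B"
    and f: "bisemilin s A B f"
    and xys: "set xys \<subseteq> A \<times> B" and uvs: "set uvs \<subseteq> A \<times> B"
    and eq: "(\<Sum>(x, y)\<leftarrow>xys. x \<boxtimes> y) = (\<Sum>(x, y)\<leftarrow>uvs. x \<boxtimes> y)"
  shows "(\<Sum>(x, y)\<leftarrow>xys. f x y) = (\<Sum>(x, y)\<leftarrow>uvs. f x y)"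
proof (rule ccontr)
  assume neq: "\<not> ?thesis"
  obtain g :: "'c \<Rightarrow> complex" where g: "clinear_on UNIV g"
    "g ((\<Sum>(x, y)\<leftarrow>xys. f x y) - (\<Sum>(x, y)\<leftarrow>uvs. f x y)) \<noteq> 0"
    using exists_separating_functional neq by (metis right_minus_eq)
  \<comment> \<open>Conjugating the values of \<open>g \<circ> f\<close> when \<open>f\<close> is antilinear yields a bilinear form.\<close>
  define g' where "g' z = cnj_if s (g z)" for z
  have g1: "semilin False UNIV g"
    using g(1) by (simp add: clinear_on_semilin)
  have g': "semilin s UNIV g'"
    using g1 by (simp add: semilin_def g'_def scaleC_complex_def)
  have "cbilinear_on A B (\<lambda>x y. g' (f x y))"
    using f g' by (auto simp: cbilinear_on_bisemilin bisemilin_def semilin_def)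
  then have "(\<Sum>(x, y)\<leftarrow>xys. g' (f x y)) = (\<Sum>(x, y)\<leftarrow>uvs. g' (f x y))"
    by (rule tensor_sum_eq[OF A B _ xys uvs eq])
  then have "g' (\<Sum>(x, y)\<leftarrow>xys. f x y) = g' (\<Sum>(x, y)\<leftarrow>uvs. f x y)"
    by (simp add: semilin_sum_pairs(1)[OF g'])
  then have *: "g (\<Sum>(x, y)\<leftarrow>xys. f x y) = g (\<Sum>(x, y)\<leftarrow>uvs. f x y)"
    by (simp add: g'_def)
  have "g (a - b) + g b = g a" for a b
    using semilin_add[OF g1, of "a - b" b] by simp
  then show False
    using g(2) * by (metis add_cancel_left_left)
qed

lemma tensor_lift_sum_semilin:
  assumes "csubspace A" "csubspace B" "bisemilin s A B f"
    and "set xys \<subseteq> A \<times> B"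
  shows "tensor_lift A B f (\<Sum>(x, y)\<leftarrow>xys. x \<boxtimes> y) = (\<Sum>(x, y)\<leftarrow>xys. f x y)"
proof -
  let ?P = "\<lambda>uvs. set uvs \<subseteq> A \<times> B \<and> (\<Sum>(x, y)\<leftarrow>xys. x \<boxtimes> y) = (\<Sum>(x, y)\<leftarrow>uvs. x \<boxtimes> y)"
  have "?P (SOME uvs. ?P uvs)"
    using assms(4) by (intro someI[of ?P xys]) simp
  then show ?thesis
    unfolding tensor_lift_def Let_def
    using tensor_sum_eq_semilin[OF assms(1-3), of "SOME uvs. ?P uvs" xys] assms(4) by simp
qed

lemma tensor_lift_pure_semilin:
  assumes "csubspace A" "csubspace B" "bisemilin s A B f"
    and "x \<in> A" "y \<in> B"
  shows "tensor_lift A B f (x \<boxtimes> y) = f x y"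
  using tensor_lift_sum_semilin[OF assms(1-3), of "[(x, y)]"] assms(4,5) by simp

lemma tensor_lift_apply:
  assumes A: "csubspace A" and B: "csubspace B"
    and f: "bisemilin s A B f" and t: "t \<in> tensor_space A B"
    and C: "csubspace C" and fC: "\<And>x y. x \<in> A \<Longrightarrow> y \<in> B \<Longrightarrow> f x y \<in> C"
    and g: "semilin r C g"
  shows "g (tensor_lift A B f t) = tensor_lift A B (\<lambda>x y. g (f x y)) t"
    and "tensor_lift A B f t \<in> C"
proof -
  obtain xys where xys: "set xys \<subseteq> A \<times> B" "t = (\<Sum>(x, y)\<leftarrow>xys. x \<boxtimes> y)"
    using tensor_space_decomposition[OF A t] .
  have gf: "bisemilin (s \<noteq> r) A B (\<lambda>x y. g (f x y))"
    using f g fC by (auto simp: bisemilin_def semilin_def cnj_if_def)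
  have mem: "f x y \<in> C" if "(x, y) \<in> set xys" for x y
    using that xys(1) fC by auto
  show "g (tensor_lift A B f t) = tensor_lift A B (\<lambda>x y. g (f x y)) t"
    unfolding xys(2) tensor_lift_sum_semilin[OF A B f xys(1)]
      tensor_lift_sum_semilin[OF A B gf xys(1)]
    using semilin_sum_pairs(1)[OF g C mem] .
  show "tensor_lift A B f t \<in> C"
    unfolding xys(2) tensor_lift_sum_semilin[OF A B f xys(1)]
    using semilin_sum_pairs(2)[OF g C mem] .
qed

text \<open>
  \<open>tensor_lift\<close> evaluates its argument on one fixed decomposition of the tensor, so this holds for
  arbitrary \<open>f\<close> and \<open>g\<close> and justifies rewriting below a Sweedler expression.
\<close>

lemma tensor_lift_cong:
  assumes A: "csubspace A" and t: "t \<in> tensor_space A B"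
    and eq: "\<And>x y. x \<in> A \<Longrightarrow> y \<in> B \<Longrightarrow> f x y = g x y"
  shows "tensor_lift A B f t = tensor_lift A B g t"
proof -
  let ?P = "\<lambda>xys. set xys \<subseteq> A \<times> B \<and> t = (\<Sum>(x, y)\<leftarrow>xys. x \<boxtimes> y)"
  obtain xys where "?P xys"
    using tensor_space_decomposition[OF A t] by blast
  then have "?P (SOME xys. ?P xys)"
    by (rule someI)
  then have "map (\<lambda>(x, y). f x y) (SOME xys. ?P xys) = map (\<lambda>(x, y). g x y) (SOME xys. ?P xys)"
    using eq by auto
  then show ?thesis
    by (simp only: tensor_lift_def Let_def)
qed

lemma semilin_tensor_lift:
  assumes A: "csubspace A" and B: "csubspace B"
    and f: "bisemilin s A B f"
  shows "semilin s (tensor_space A B) (tensor_lift A B f)"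
  unfolding semilin_def
proof (intro conjI ballI allI)
  fix t t' assume "t \<in> tensor_space A B" "t' \<in> tensor_space A B"
  then obtain xys uvs where *: "set xys \<subseteq> A \<times> B" "t = (\<Sum>(x, y)\<leftarrow>xys. x \<boxtimes> y)"
    "set uvs \<subseteq> A \<times> B" "t' = (\<Sum>(x, y)\<leftarrow>uvs. x \<boxtimes> y)"
    using tensor_space_decomposition[OF A] by metis
  have "t + t' = (\<Sum>(x, y)\<leftarrow>xys @ uvs. x \<boxtimes> y)"
    by (simp add: *)
  then show "tensor_lift A B f (t + t') = tensor_lift A B f t + tensor_lift A B f t'"
    using tensor_lift_sum_semilin[OF A B f, of xys] tensor_lift_sum_semilin[OF A B f, of uvs]
      tensor_lift_sum_semilin[OF A B f, of "xys @ uvs"] * by simp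
next
  fix c t assume "t \<in> tensor_space A B"
  then obtain xys where *: "set xys \<subseteq> A \<times> B" "t = (\<Sum>(x, y)\<leftarrow>xys. x \<boxtimes> y)"
    using tensor_space_decomposition[OF A] by metis
  let ?m = "map (\<lambda>(x, y). (c *\<^sub>C x, y)) xys"
  have "set ?m \<subseteq> A \<times> B"
    using * A by (auto simp: complex_vector.subspace_scale)
  moreover have "(\<Sum>(x, y)\<leftarrow>?m. f x y) = cnj_if s c *\<^sub>C (\<Sum>(x, y)\<leftarrow>xys. f x y)"
    using *(1)
  proof (induction xys)
    case (Cons z zs)
    then show ?case
      using f by (auto simp: bisemilin_def semilin_def complex_vector.scale_right_distrib)
  qed simp
  ultimately show "tensor_lift A B f (c *\<^sub>C t) = cnj_if s c *\<^sub>C tensor_lift A B f t"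
    using tensor_lift_sum_semilin[OF A B f, of xys] tensor_lift_sum_semilin[OF A B f, of ?m] *
    by (simp only: scaleC_tensor_sum)
qed

lemma semilin_tensor_lift_param:
  assumes A: "csubspace A" and B: "csubspace B"
    and t: "t \<in> tensor_space A B" and D: "csubspace D"
    and F: "\<And>z. z \<in> D \<Longrightarrow> bisemilin r A B (F z)"
    and lin: "\<And>x y. x \<in> A \<Longrightarrow> y \<in> B \<Longrightarrow> semilin s D (\<lambda>z. F z x y)"
  shows "semilin s D (\<lambda>z. tensor_lift A B (F z) t)"
proof -
  obtain xys where xys: "set xys \<subseteq> A \<times> B" "t = (\<Sum>(x, y)\<leftarrow>xys. x \<boxtimes> y)"
    using tensor_space_decomposition[OF A t] .
  have eq: "tensor_lift A B (F z) t = (\<Sum>(x, y)\<leftarrow>xys. F z x y)" if "z \<in> D" for z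
    unfolding xys(2) using tensor_lift_sum_semilin[OF A B F[OF that] xys(1)] .
  have "semilin s D (\<lambda>z. \<Sum>(x, y)\<leftarrow>xys. F z x y)"
    using xys(1) lin
    by (induction xys)
      (auto simp: semilin_def complex_vector.scale_right_distrib algebra_simps split_beta)
  then show ?thesis
    using semilin_cong[of D "\<lambda>z. tensor_lift A B (F z) t", OF eq D] by blast
qed

lemma tensor_lift_swap:
  assumes A: "csubspace A" and B: "csubspace B"
    and t: "t \<in> tensor_space A B"
    and C: "csubspace C" and D: "csubspace D"
    and t': "t' \<in> tensor_space C D"
    and F: "\<And>z w. z \<in> C \<Longrightarrow> w \<in> D \<Longrightarrow> bisemilin s A B (\<lambda>x y. F x y z w)"
    and F': "\<And>x y. x \<in> A \<Longrightarrow> y \<in> B \<Longrightarrow> bisemilin r C D (F x y)"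
  shows "tensor_lift A B (\<lambda>x y. tensor_lift C D (\<lambda>z w. F x y z w) t') t
    = tensor_lift C D (\<lambda>z w. tensor_lift A B (\<lambda>x y. F x y z w) t) t'"
proof -
  have 1: "bisemilin r C D (\<lambda>z w. tensor_lift A B (\<lambda>x y. F x y z w) t)"
    using F F' by (intro bisemilinI semilin_tensor_lift_param[OF A B t, where r = s] C D)
      (auto simp: bisemilin_def)
  obtain zws where zws: "set zws \<subseteq> C \<times> D" "t' = (\<Sum>(x, y)\<leftarrow>zws. x \<boxtimes> y)"
    using tensor_space_decomposition[OF C t'] .
  obtain xys where xys: "set xys \<subseteq> A \<times> B" "t = (\<Sum>(x, y)\<leftarrow>xys. x \<boxtimes> y)"
    using tensor_space_decomposition[OF A t] .
  have 2: "bisemilin s A B (\<lambda>x y. tensor_lift C D (\<lambda>z w. F x y z w) t')"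
    using F F' by (intro bisemilinI semilin_tensor_lift_param[OF C D t', where r = r] A B)
      (auto simp: bisemilin_def)
  have L: "tensor_lift A B (\<lambda>x y. tensor_lift C D (\<lambda>z w. F x y z w) t') t
      = (\<Sum>(x, y)\<leftarrow>xys. \<Sum>(z, w)\<leftarrow>zws. F x y z w)"
  proof -
    have "map (\<lambda>(x, y). tensor_lift C D (\<lambda>z w. F x y z w) t') xys
      = map (\<lambda>(x, y). \<Sum>(z, w)\<leftarrow>zws. F x y z w) xys"
      using xys(1) tensor_lift_sum_semilin[OF C D F' zws(1)] zws(2) by auto
    then show ?thesis
      unfolding xys(2) tensor_lift_sum_semilin[OF A B 2 xys(1)] by (simp only:)
  qed
  have R: "tensor_lift C D (\<lambda>z w. tensor_lift A B (\<lambda>x y. F x y z w) t) t'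
      = (\<Sum>(z, w)\<leftarrow>zws. \<Sum>(x, y)\<leftarrow>xys. F x y z w)"
  proof -
    have "map (\<lambda>(z, w). tensor_lift A B (\<lambda>x y. F x y z w) t) zws
      = map (\<lambda>(z, w). \<Sum>(x, y)\<leftarrow>xys. F x y z w) zws"
      using zws(1) tensor_lift_sum_semilin[OF A B F xys(1)] xys(2) by auto
    then show ?thesis
      unfolding zws(2) tensor_lift_sum_semilin[OF C D 1 zws(1)] by (simp only:)
  qed
  show ?thesis
    unfolding L R case_prod_unfold by (induction xys) (simp_all add: sum_list_addf)
qed

text \<open>
  The products of a crossed product and of a tensor product of algebras are both given by iterated
  lifts; this is the universal property that they share.
\<close>

lemma tensor_lift_quadrilinear:
  fixes k :: "'a::complex_vector \<Rightarrow> 'b::complex_vector \<Rightarrow> 'c::complex_vector \<Rightarrow>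
    'd::complex_vector \<Rightarrow> 'e::complex_vector"
  assumes A: "csubspace A" and B: "csubspace B"
    and C: "csubspace C" and D: "csubspace D"
    and V: "csubspace V"
    and k1: "\<And>b c d. b \<in> B \<Longrightarrow> c \<in> C \<Longrightarrow> d \<in> D \<Longrightarrow> semilin False A (\<lambda>a. k a b c d)"
    and k2: "\<And>a c d. a \<in> A \<Longrightarrow> c \<in> C \<Longrightarrow> d \<in> D \<Longrightarrow> semilin False B (\<lambda>b. k a b c d)"
    and k34: "\<And>a b. a \<in> A \<Longrightarrow> b \<in> B \<Longrightarrow> bisemilin False C D (k a b)"
    and k_closed: "\<And>a b c d. a \<in> A \<Longrightarrow> b \<in> B \<Longrightarrow> c \<in> C \<Longrightarrow> d \<in> D \<Longrightarrow> k a b c d \<in> V"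
    and m: "\<And>s t. m s t = tensor_lift A B (\<lambda>a b. tensor_lift C D (k a b) t) s"
  shows "\<And>a b c d. a \<in> A \<Longrightarrow> b \<in> B \<Longrightarrow> c \<in> C \<Longrightarrow> d \<in> D \<Longrightarrow>
      m (a \<boxtimes> b) (c \<boxtimes> d) = k a b c d"
    and "bisemilin False (tensor_space A B) (tensor_space C D) m"
    and "\<And>s t. s \<in> tensor_space A B \<Longrightarrow> t \<in> tensor_space C D \<Longrightarrow> m s t \<in> V"
proof -
  define K where "K a b = tensor_lift C D (k a b)" for a b
  have m': "m s t = tensor_lift A B (\<lambda>a b. K a b t) s" for s t
    by (simp add: m K_def)
  have K12: "bisemilin False A B (\<lambda>a b. K a b t)" if "t \<in> tensor_space C D" for t
    unfolding K_def using k1 k2 k34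
    by (rule_tac bisemilinI; intro semilin_tensor_lift_param[OF C D that, where r = False] A B) simp_all
  have K3: "semilin False (tensor_space C D) (K a b)" if "a \<in> A" "b \<in> B" for a b
    unfolding K_def using that by (intro semilin_tensor_lift C D k34)
  have K_closed: "K a b t \<in> V" if "a \<in> A" "b \<in> B" "t \<in> tensor_space C D" for a b t
    unfolding K_def using that k_closed
    by (intro tensor_lift_apply(2)[OF C D k34 _ V _ semilin_ident]) simp_all
  show "m (a \<boxtimes> b) (c \<boxtimes> d) = k a b c d" if "a \<in> A" "b \<in> B" "c \<in> C" "d \<in> D" for a b c d
    unfolding m' using that
    by (simp add: tensor_lift_pure_semilin[OF A B K12] pure_in_tensor_space)
      (simp add: K_def tensor_lift_pure_semilin[OF C D k34])
  show "bisemilin False (tensor_space A B) (tensor_space C D) m"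
    unfolding m'[abs_def]
  proof (rule bisemilinI)
    show "semilin False (tensor_space A B) (\<lambda>s. tensor_lift A B (\<lambda>a b. K a b t) s)"
      if "t \<in> tensor_space C D" for t
      using that by (intro semilin_tensor_lift A B K12)
    show "semilin False (tensor_space C D) (\<lambda>t. tensor_lift A B (\<lambda>a b. K a b t) s)"
      if "s \<in> tensor_space A B" for s
      using that by (intro semilin_tensor_lift_param[OF A B _ subspace_tensor_space K12] K3)
  qed
  show "m s t \<in> V" if "s \<in> tensor_space A B" "t \<in> tensor_space C D" for s t
    unfolding m' using that
    by (intro tensor_lift_apply(2)[OF A B K12 _ V K_closed semilin_ident])
qed

section \<open>Sweedler calculus\<close>

text \<open>
  The conditional rewrite rules in \<open>lin\<close> prove the side conditions of the calculus: that a map built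
  from the operations of an algebra is (anti)linear, and that its values lie in the right carrier.
\<close>

named_theorems lin

lemma bisemilinD:
  "bisemilin s A B f \<Longrightarrow> b \<in> B \<Longrightarrow> semilin s A (\<lambda>x. f x b)"
  "bisemilin s A B f \<Longrightarrow> a \<in> A \<Longrightarrow> semilin s B (\<lambda>x. f a x)"
  by (auto simp: bisemilin_def)

lemmas [lin] = bisemilinI semilin_ident semilin_scaleC_right semilin_scaleC_left
  semilin_times_left semilin_times_right semilin_cnj semilin_pure_left semilin_pure_right
  pure_in_tensor_space subspace_tensor_space complex_vector.subspace_UNIV

lemma subspace_scale_closed [lin]:
  "csubspace A \<Longrightarrow> x \<in> A \<Longrightarrow> c *\<^sub>C x \<in> A"
  by (rule complex_vector.subspace_scale)

context star_algebra
begin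

lemmas [lin] = subspace_carrier m_closed one_closed star_closed

lemma semilin_mult_left [lin]:
  "semilin s D f \<Longrightarrow> (\<And>x. x \<in> D \<Longrightarrow> f x \<in> carrier A) \<Longrightarrow> c \<in> carrier A \<Longrightarrow>
    semilin s D (\<lambda>x. f x \<otimes> c)"
  using mult_bilinear semilin_left unfolding cbilinear_on_bisemilin by blast

lemma semilin_mult_right [lin]:
  "semilin s D f \<Longrightarrow> (\<And>x. x \<in> D \<Longrightarrow> f x \<in> carrier A) \<Longrightarrow> c \<in> carrier A \<Longrightarrow>
    semilin s D (\<lambda>x. c \<otimes> f x)"
  using mult_bilinear semilin_right unfolding cbilinear_on_bisemilin by blast

lemma semilin_star_carrier: "semilin True (carrier A) (star A)"
  by (simp add: semilin_def star_add star_scaleC)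

lemma semilin_star [lin]:
  "semilin (\<not> s) D f \<Longrightarrow> (\<And>x. x \<in> D \<Longrightarrow> f x \<in> carrier A) \<Longrightarrow> semilin s D (\<lambda>x. star A (f x))"
  by (rule semilin_compose[where A = "carrier A" and s = "\<not> s" and g = "star A" and f = f])
    (simp_all add: semilin_star_carrier)

lemma mult_scaleC:
  assumes "x \<in> carrier A" "y \<in> carrier A"
  shows "(c *\<^sub>C x) \<otimes> y = c *\<^sub>C (x \<otimes> y)" "x \<otimes> (c *\<^sub>C y) = c *\<^sub>C (x \<otimes> y)"
  using semilin_scale[OF semilin_mult_left[OF semilin_ident]]
    semilin_scale[OF semilin_mult_right[OF semilin_ident]] assms by auto

lemma star_one: "star A \<one> = \<one>"
  by (metis one_closed r_one l_one star_closed star_mult star_star)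

end

text \<open>
  Substitution, congruence and exchange of Sweedler sums hold for any linear map into the tensor
  square. They are established at this level because the proof that the dual is a Hopf algebra
  already uses them for the dual.
\<close>

locale star_algebra_with_comult = star_algebra Q
  for Q :: "('a::complex_vector, 'b) hopf_alg_scheme" (structure) +
  assumes comult_closed [lin]:
      "q \<in> carrier Q \<Longrightarrow> comult Q q \<in> tensor_space (carrier Q) (carrier Q)"
    and semilin_comult: "semilin False (carrier Q) (comult Q)"
begin

lemma sweedler_apply_gen:
  assumes "q \<in> carrier Q" "bisemilin s (carrier Q) (carrier Q) f"
    and "csubspace C" "\<And>a b. a \<in> carrier Q \<Longrightarrow> b \<in> carrier Q \<Longrightarrow> f a b \<in> C"
    and "semilin r C g"
  shows "g (sweedler Q f q) = sweedler Q (\<lambda>a b. g (f a b)) q"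
  unfolding sweedler_def
  using tensor_lift_apply(1)[OF subspace_carrier subspace_carrier assms(2) comult_closed assms(3-5)]
    assms(1) by blast

lemmas sweedler_apply = sweedler_apply_gen[where s = False]

lemma sweedler_apply_UNIV:
  assumes "q \<in> carrier Q" "bisemilin False (carrier Q) (carrier Q) f" "semilin r UNIV g"
  shows "g (sweedler Q f q) = sweedler Q (\<lambda>a b. g (f a b)) q"
  using sweedler_apply[OF assms(1,2) _ _ assms(3)] by (simp add: lin)

lemma sweedler_closed_semilin:
  assumes "q \<in> carrier Q" "bisemilin s (carrier Q) (carrier Q) f"
    and "csubspace C" "\<And>a b. a \<in> carrier Q \<Longrightarrow> b \<in> carrier Q \<Longrightarrow> f a b \<in> C"
  shows "sweedler Q f q \<in> C"
  unfolding sweedler_def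
  using tensor_lift_apply(2)[OF subspace_carrier subspace_carrier assms(2) comult_closed assms(3,4)
      semilin_ident] assms(1) by blast

lemmas sweedler_closed [lin] = sweedler_closed_semilin[where s = False]

lemma sweedler_cong:
  assumes "q \<in> carrier Q" "\<And>a b. a \<in> carrier Q \<Longrightarrow> b \<in> carrier Q \<Longrightarrow> f a b = g a b"
  shows "sweedler Q f q = sweedler Q g q"
  unfolding sweedler_def
  using assms by (intro tensor_lift_cong[OF subspace_carrier comult_closed])

lemma semilin_sweedler [lin]:
  assumes "bisemilin False (carrier Q) (carrier Q) f" "semilin s D g"
    "\<And>x. x \<in> D \<Longrightarrow> g x \<in> carrier Q"
  shows "semilin s D (\<lambda>x. sweedler Q f (g x))"
  unfolding sweedler_def
  by (rule semilin_compose'[OF semilin_tensor_lift[OF subspace_carrier subspace_carrier assms(1)]])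
    (use assms in \<open>auto simp: lin intro: semilin_compose'[OF semilin_comult]\<close>)

lemma semilin_sweedler_param_gen:
  assumes "q \<in> carrier Q" "csubspace D"
    and "\<And>z. z \<in> D \<Longrightarrow> bisemilin r (carrier Q) (carrier Q) (F z)"
    and "\<And>x y. x \<in> carrier Q \<Longrightarrow> y \<in> carrier Q \<Longrightarrow> semilin s D (\<lambda>z. F z x y)"
  shows "semilin s D (\<lambda>z. sweedler Q (F z) q)"
  unfolding sweedler_def
  using assms by (intro semilin_tensor_lift_param[where r = r] subspace_carrier comult_closed)

lemmas semilin_sweedler_param [lin] = semilin_sweedler_param_gen[where r = False]

end

sublocale hopf_star_algebra \<subseteq> star_algebra_with_comult
proof
  show "comult Q q \<in> tensor_space (carrier Q) (carrier Q)" if "q \<in> carrier Q" for q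
    using comult_hom that by (auto simp: star_hom_def tensor_alg_def)
  show "semilin False (carrier Q) (comult Q)"
    using comult_hom by (simp add: star_hom_def clinear_on_semilin)
qed

lemma sweedler_swap:
  assumes "star_algebra_with_comult H" "star_algebra_with_comult Q" "h \<in> carrier H" "q \<in> carrier Q"
    and "\<And>z w. z \<in> carrier Q \<Longrightarrow> w \<in> carrier Q \<Longrightarrow>
      bisemilin False (carrier H) (carrier H) (\<lambda>x y. F x y z w)"
    and "\<And>x y. x \<in> carrier H \<Longrightarrow> y \<in> carrier H \<Longrightarrow>
      bisemilin False (carrier Q) (carrier Q) (F x y)"
  shows "sweedler H (\<lambda>x y. sweedler Q (\<lambda>z w. F x y z w) q) h
    = sweedler Q (\<lambda>z w. sweedler H (\<lambda>x y. F x y z w) h) q"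
proof -
  interpret H: star_algebra_with_comult H by fact
  interpret Q: star_algebra_with_comult Q by fact
  show ?thesis
    unfolding sweedler_def using assms(3-)
    by (intro tensor_lift_swap[where s = False and r = False]) (simp_all add: lin)
qed

context hopf_star_algebra
begin

text \<open>
  Both sides are the value of the lifted trilinear map \<open>F\<close> on the two sides of coassociativity.
\<close>

lemma sweedler_coassoc:
  assumes q: "q \<in> carrier Q"
    and 1: "\<And>b c. b \<in> carrier Q \<Longrightarrow> c \<in> carrier Q \<Longrightarrow> semilin False (carrier Q) (\<lambda>a. F a b c)"
    and 2: "\<And>a c. a \<in> carrier Q \<Longrightarrow> c \<in> carrier Q \<Longrightarrow> semilin False (carrier Q) (\<lambda>b. F a b c)"
    and 3: "\<And>a b. a \<in> carrier Q \<Longrightarrow> b \<in> carrier Q \<Longrightarrow> semilin False (carrier Q) (\<lambda>c. F a b c)"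
  shows "sweedler Q (\<lambda>a b. sweedler Q (\<lambda>c d. F c d b) a) q
    = sweedler Q (\<lambda>a b. sweedler Q (\<lambda>c d. F a c d) b) q"
proof -
  let ?T = "tensor_space (carrier Q) (carrier Q)"
  define G where "G a = tensor_lift (carrier Q) (carrier Q) (F a)" for a
  have G: "bisemilin False (carrier Q) ?T G"
    unfolding G_def using 1 2 3
    by (intro bisemilinI semilin_tensor_lift_param[where r = False] semilin_tensor_lift)
      (auto simp: lin)
  let ?L = "tensor_lift (carrier Q) ?T G"
  have L: "semilin False (tensor_space (carrier Q) ?T) ?L"
    using G by (intro semilin_tensor_lift) (simp_all add: lin)
  have L_pure: "?L (a \<boxtimes> t) = G a t" if "a \<in> carrier Q" "t \<in> ?T" for a t
    using G that by (intro tensor_lift_pure_semilin[where s = False]) (simp_all add: lin)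
  have G_pure: "G a (b \<boxtimes> c) = F a b c" if "a \<in> carrier Q" "b \<in> carrier Q" "c \<in> carrier Q" for a b c
    unfolding G_def using that 2 3 by (intro tensor_lift_pure_semilin[where s = False]) (simp_all add: lin)
  have "?L (sweedler Q (\<lambda>a b. sweedler Q (\<lambda>a\<^sub>1 a\<^sub>2. a\<^sub>1 \<boxtimes> (a\<^sub>2 \<boxtimes> b)) a) q)
      = sweedler Q (\<lambda>a b. ?L (sweedler Q (\<lambda>a\<^sub>1 a\<^sub>2. a\<^sub>1 \<boxtimes> (a\<^sub>2 \<boxtimes> b)) a)) q"
    using q by (intro sweedler_apply[OF _ _ _ _ L]) (simp_all add: lin)
  also have "\<dots> = sweedler Q (\<lambda>a b. sweedler Q (\<lambda>a\<^sub>1 a\<^sub>2. ?L (a\<^sub>1 \<boxtimes> (a\<^sub>2 \<boxtimes> b))) a) q"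
    using q by (intro sweedler_cong sweedler_apply[OF _ _ _ _ L]) (simp_all add: lin)
  also have "\<dots> = sweedler Q (\<lambda>a b. sweedler Q (\<lambda>c d. F c d b) a) q"
    using q by (intro sweedler_cong) (simp_all add: L_pure G_pure lin)
  finally have *: "?L (sweedler Q (\<lambda>a b. sweedler Q (\<lambda>a\<^sub>1 a\<^sub>2. a\<^sub>1 \<boxtimes> (a\<^sub>2 \<boxtimes> b)) a) q)
    = sweedler Q (\<lambda>a b. sweedler Q (\<lambda>c d. F c d b) a) q" .
  have "?L (sweedler Q (\<lambda>a b. a \<boxtimes> comult Q b) q) = sweedler Q (\<lambda>a b. ?L (a \<boxtimes> comult Q b)) q"
    using q semilin_comult by (intro sweedler_apply[OF _ _ _ _ L]) (simp_all add: lin)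
  also have "\<dots> = sweedler Q (\<lambda>a b. sweedler Q (\<lambda>c d. F a c d) b) q"
    using q by (intro sweedler_cong) (simp_all add: L_pure lin, simp add: G_def sweedler_def)
  finally show ?thesis
    using coassoc[OF q] * by simp
qed

lemma semilin_counit [lin]:
  "semilin s D f \<Longrightarrow> (\<And>x. x \<in> D \<Longrightarrow> f x \<in> carrier Q) \<Longrightarrow> semilin s D (\<lambda>x. counit Q (f x))"
  by (rule semilin_compose'[OF counit_linear[unfolded clinear_on_semilin]])

lemma semilin_antipode [lin]:
  "semilin s D f \<Longrightarrow> (\<And>x. x \<in> D \<Longrightarrow> f x \<in> carrier Q) \<Longrightarrow> semilin s D (\<lambda>x. antipode Q (f x))"
  by (rule semilin_compose'[OF antipode_linear[unfolded clinear_on_semilin]])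

lemmas [lin] = antipode_closed

lemma sweedler_counit_left:
  assumes "q \<in> carrier Q" "semilin False (carrier Q) F"
  shows "sweedler Q (\<lambda>a b. counit Q a *\<^sub>C F b) q = F q"
proof -
  have "sweedler Q (\<lambda>a b. counit Q a *\<^sub>C F b) q = sweedler Q (\<lambda>a b. F (counit Q a *\<^sub>C b)) q"
    using assms by (intro sweedler_cong) (simp_all add: semilin_scale[OF assms(2)])
  also have "\<dots> = F (sweedler Q (\<lambda>a b. counit Q a *\<^sub>C b) q)"
    using assms by (intro sweedler_apply[symmetric, OF _ _ _ _ assms(2)]) (simp_all add: lin)
  finally show ?thesis
    using assms by (simp add: counit_left)
qed

lemma sweedler_counit_right:
  assumes "q \<in> carrier Q" "semilin False (carrier Q) F"
  shows "sweedler Q (\<lambda>a b. counit Q b *\<^sub>C F a) q = F q"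
proof -
  have "sweedler Q (\<lambda>a b. counit Q b *\<^sub>C F a) q = sweedler Q (\<lambda>a b. F (counit Q b *\<^sub>C a)) q"
    using assms by (intro sweedler_cong) (simp_all add: semilin_scale[OF assms(2)])
  also have "\<dots> = F (sweedler Q (\<lambda>a b. counit Q b *\<^sub>C a) q)"
    using assms by (intro sweedler_apply[symmetric, OF _ _ _ _ assms(2)]) (simp_all add: lin)
  finally show ?thesis
    using assms by (simp add: counit_right)
qed

lemma sweedler_mult:
  assumes f: "bisemilin False (carrier Q) (carrier Q) f"
    and p: "p \<in> carrier Q" and q: "q \<in> carrier Q"
  shows "sweedler Q f (p \<otimes> q) = sweedler Q (\<lambda>a b. sweedler Q (\<lambda>c d. f (a \<otimes> c) (b \<otimes> d)) q) p"
proof -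
  let ?T = "tensor_space (carrier Q) (carrier Q)"
  let ?L = "tensor_lift (carrier Q) (carrier Q) f"
  have L: "semilin False ?T ?L"
    using f by (intro semilin_tensor_lift) (simp_all add: lin)
  have "comult Q (p \<otimes> q) = comult Q p \<otimes>\<^bsub>tensor_alg Q Q\<^esub> comult Q q"
    using comult_hom p q by (simp add: star_hom_def)
  also have "\<dots> = sweedler Q (\<lambda>a b. sweedler Q (\<lambda>c d. (a \<otimes> c) \<boxtimes> (b \<otimes> d)) q) p"
    by (simp add: tensor_alg_def sweedler_def)
  finally have "sweedler Q f (p \<otimes> q)
      = ?L (sweedler Q (\<lambda>a b. sweedler Q (\<lambda>c d. (a \<otimes> c) \<boxtimes> (b \<otimes> d)) q) p)"
    by (simp add: sweedler_def)
  also have "\<dots> = sweedler Q (\<lambda>a b. ?L (sweedler Q (\<lambda>c d. (a \<otimes> c) \<boxtimes> (b \<otimes> d)) q)) p"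
    using p q by (intro sweedler_apply[OF _ _ _ _ L]) (simp_all add: lin)
  also have "\<dots> = sweedler Q (\<lambda>a b. sweedler Q (\<lambda>c d. ?L ((a \<otimes> c) \<boxtimes> (b \<otimes> d))) q) p"
    using p q by (intro sweedler_cong sweedler_apply[OF _ _ _ _ L]) (simp_all add: lin)
  also have "\<dots> = sweedler Q (\<lambda>a b. sweedler Q (\<lambda>c d. f (a \<otimes> c) (b \<otimes> d)) q) p"
    using p q f by (intro sweedler_cong tensor_lift_pure_semilin[where s = False]) (simp_all add: lin)
  finally show ?thesis .
qed

lemma sweedler_one:
  assumes f: "bisemilin s (carrier Q) (carrier Q) f"
  shows "sweedler Q f \<one> = f \<one> \<one>"
proof -
  have "comult Q \<one> = \<one> \<boxtimes> \<one>"
    using comult_hom by (simp add: star_hom_def tensor_alg_def)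
  then show ?thesis
    using f by (simp add: sweedler_def tensor_lift_pure_semilin lin)
qed

lemma sweedler_star:
  assumes f: "bisemilin s (carrier Q) (carrier Q) f" and q: "q \<in> carrier Q"
  shows "sweedler Q f (star Q q) = sweedler Q (\<lambda>a b. f (star Q a) (star Q b)) q"
proof -
  let ?T = "tensor_space (carrier Q) (carrier Q)"
  let ?L = "tensor_lift (carrier Q) (carrier Q) f"
  have L: "semilin s ?T ?L"
    using f by (intro semilin_tensor_lift) (simp_all add: lin)
  have "comult Q (star Q q) = sweedler Q (\<lambda>a b. star Q a \<boxtimes> star Q b) q"
    using comult_hom q by (simp add: star_hom_def tensor_alg_def sweedler_def)
  then have "sweedler Q f (star Q q) = ?L (sweedler Q (\<lambda>a b. star Q a \<boxtimes> star Q b) q)"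
    by (simp add: sweedler_def)
  also have "\<dots> = sweedler Q (\<lambda>a b. ?L (star Q a \<boxtimes> star Q b)) q"
    using q by (intro sweedler_apply_gen[where s = True, OF _ _ _ _ L]) (simp_all add: lin)
  also have "\<dots> = sweedler Q (\<lambda>a b. f (star Q a) (star Q b)) q"
    using q f by (intro sweedler_cong tensor_lift_pure_semilin[where s = s]) (simp_all add: lin)
  finally show ?thesis .
qed

text \<open>
  The conjugate of \<open>q \<mapsto> \<epsilon>(q\<^sup>*)\<close> is again a right counit, and a right counit equals a left one.
\<close>

lemma counit_star:
  assumes q: "q \<in> carrier Q"
  shows "counit Q (star Q q) = cnj (counit Q q)"
proof -
  let ?e = "\<lambda>q. cnj (counit Q (star Q q))"
  have "sweedler Q (\<lambda>a b. ?e b *\<^sub>C a) q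
      = star Q (sweedler Q (\<lambda>a b. counit Q (star Q b) *\<^sub>C star Q a) q)"
    using q
    by (subst sweedler_apply_gen[where s = True, OF _ _ _ _ semilin_star_carrier])
      (simp_all add: lin star_scaleC star_star cong: sweedler_cong)
  also have "\<dots> = star Q (sweedler Q (\<lambda>a b. counit Q b *\<^sub>C a) (star Q q))"
    using q by (subst sweedler_star[where s = False]) (simp_all add: lin)
  also have "\<dots> = q"
    using q by (simp add: counit_right star_star lin)
  finally have "counit Q q = counit Q (sweedler Q (\<lambda>a b. ?e b *\<^sub>C a) q)" by simp
  also have "\<dots> = sweedler Q (\<lambda>a b. counit Q (?e b *\<^sub>C a)) q"
    using q by (intro sweedler_apply[where C = "carrier Q" and r = False])
      (simp_all add: lin)
  also have "\<dots> = sweedler Q (\<lambda>a b. counit Q a *\<^sub>C ?e b) q"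
    using q counit_linear
    by (intro sweedler_cong) (simp_all add: clinear_on_def scaleC_complex_def mult.commute)
  also have "\<dots> = ?e q"
    using q by (intro sweedler_counit_left) (simp_all add: lin)
  finally show ?thesis by simp
qed

end

section \<open>The antipode\<close>

context hopf_star_algebra
begin

text \<open>
  Convolution with the action \<open>m\<close> of \<open>Q\<close> on \<open>V\<close> is undone by convolution with \<open>m \<circ> S\<close>, because
  \<open>S(q\<^sub>1) q\<^sub>2 = \<epsilon>(q) 1\<close>. That antipodes reverse products and coproducts and are preserved by
  morphisms all follows from this inversion formula, each time for another module \<open>V\<close>.
\<close>

lemma antipode_inversion:
  assumes V: "csubspace V"
    and m: "bisemilin False (carrier Q) V m"
    and m_closed: "\<And>p v. p \<in> carrier Q \<Longrightarrow> v \<in> V \<Longrightarrow> m p v \<in> V"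
    and m_mult: "\<And>p q v. p \<in> carrier Q \<Longrightarrow> q \<in> carrier Q \<Longrightarrow> v \<in> V \<Longrightarrow>
      m (p \<otimes> q) v = m p (m q v)"
    and m_one: "\<And>v. v \<in> V \<Longrightarrow> m \<one> v = v"
    and F: "semilin False (carrier Q) F" and F_closed: "\<And>p. p \<in> carrier Q \<Longrightarrow> F p \<in> V"
    and q: "q \<in> carrier Q"
  shows "sweedler Q (\<lambda>a b. m (antipode Q a) (sweedler Q (\<lambda>c d. m c (F d)) b)) q = F q"
proof -
  have mr: "semilin s D (\<lambda>x. m a (f x))"
    if "semilin s D f" "\<And>x. x \<in> D \<Longrightarrow> f x \<in> V" "a \<in> carrier Q" for s D a
    and f :: "'d::complex_vector \<Rightarrow> _"
    using that by (intro semilin_right[OF m])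
  have ml: "semilin s D (\<lambda>x. m (f x) v)"
    if "semilin s D f" "\<And>x. x \<in> D \<Longrightarrow> f x \<in> carrier Q" "v \<in> V" for s D v
    and f :: "'d::complex_vector \<Rightarrow> _"
    using that by (intro semilin_left[OF m])
  have mF: "semilin s D (\<lambda>x. F (f x))"
    if "semilin s D f" "\<And>x. x \<in> D \<Longrightarrow> f x \<in> carrier Q" for s D
    and f :: "'d::complex_vector \<Rightarrow> _"
    using that by (rule semilin_compose'[OF F])
  note [lin] = V m_closed F_closed mr ml mF F
  have "sweedler Q (\<lambda>a b. m (antipode Q a) (sweedler Q (\<lambda>c d. m c (F d)) b)) q
      = sweedler Q (\<lambda>a b. sweedler Q (\<lambda>c d. m (antipode Q a) (m c (F d))) b) q"
    using q by (intro sweedler_cong sweedler_apply[where C = V and r = False]) (simp_all add: lin)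
  also have "\<dots> = sweedler Q (\<lambda>a b. sweedler Q (\<lambda>c d. m (antipode Q a \<otimes> c) (F d)) b) q"
    using q by (intro sweedler_cong) (simp_all add: lin m_mult)
  also have "\<dots> = sweedler Q (\<lambda>a b. sweedler Q (\<lambda>c d. m (antipode Q c \<otimes> d) (F b)) a) q"
    using q by (intro sweedler_coassoc[symmetric]) (simp_all add: lin)
  also have "\<dots> = sweedler Q (\<lambda>a b. m (sweedler Q (\<lambda>c d. antipode Q c \<otimes> d) a) (F b)) q"
    using q by (intro sweedler_cong
        sweedler_apply[symmetric, where C = "carrier Q" and r = False and g = "\<lambda>x. m x (F _)"])
      (simp_all add: lin)
  also have "\<dots> = sweedler Q (\<lambda>a b. counit Q a *\<^sub>C F b) q"
    using q by (intro sweedler_cong)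
      (simp_all add: antipode_left lin m_one semilin_scale[OF ml[OF semilin_ident]])
  also have "\<dots> = F q"
    using q by (intro sweedler_counit_left) (simp_all add: lin)
  finally show ?thesis .
qed

text \<open>
  For \<open>Q\<close> acting on \<open>V = Q\<close> by multiplication and \<open>v = 1\<close> this says that the antipode is the only
  convolution inverse of the identity.
\<close>

lemma antipode_unique:
  assumes V: "csubspace V"
    and m: "bisemilin False (carrier Q) V m"
    and m_closed: "\<And>p v. p \<in> carrier Q \<Longrightarrow> v \<in> V \<Longrightarrow> m p v \<in> V"
    and m_mult: "\<And>p q v. p \<in> carrier Q \<Longrightarrow> q \<in> carrier Q \<Longrightarrow> v \<in> V \<Longrightarrow>
      m (p \<otimes> q) v = m p (m q v)"
    and m_one: "\<And>v. v \<in> V \<Longrightarrow> m \<one> v = v"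
    and F: "semilin False (carrier Q) F" and F_closed: "\<And>p. p \<in> carrier Q \<Longrightarrow> F p \<in> V"
    and v: "v \<in> V"
    and inv: "\<And>p. p \<in> carrier Q \<Longrightarrow> sweedler Q (\<lambda>c d. m c (F d)) p = counit Q p *\<^sub>C v"
    and q: "q \<in> carrier Q"
  shows "F q = m (antipode Q q) v"
proof -
  have ml: "semilin False (carrier Q) (\<lambda>x. m (antipode Q x) v)"
    using v by (intro semilin_left[OF m]) (simp_all add: lin)
  have "F q = sweedler Q (\<lambda>a b. m (antipode Q a) (sweedler Q (\<lambda>c d. m c (F d)) b)) q"
    by (rule antipode_inversion[OF assms(1-7) q, symmetric])
  also have "\<dots> = sweedler Q (\<lambda>a b. counit Q b *\<^sub>C m (antipode Q a) v) q"
    using q v by (intro sweedler_cong)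
      (simp_all add: lin inv semilin_scale[OF semilin_right[OF m semilin_ident]])
  also have "\<dots> = m (antipode Q q) v"
    using q ml by (intro sweedler_counit_right)
  finally show ?thesis .
qed

lemma antipode_mult:
  assumes p: "p \<in> carrier Q" and q: "q \<in> carrier Q"
  shows "antipode Q (p \<otimes> q) = antipode Q q \<otimes> antipode Q p"
proof -
  have bil: "bisemilin False (carrier Q) (carrier Q) (\<otimes>)"
    using mult_bilinear by (simp add: cbilinear_on_bisemilin)
  \<comment> \<open>From \<open>p\<^sub>1 q\<^sub>1 S(p\<^sub>2 q\<^sub>2) = \<epsilon>(p) \<epsilon>(q)\<close>, cancelling \<open>p\<^sub>1\<close> gives \<open>q\<^sub>1 S(p q\<^sub>2) = \<epsilon>(q) S(p)\<close>;
    cancelling \<open>q\<^sub>1\<close> then gives the claim.\<close>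
  have 1: "sweedler Q (\<lambda>a b. a \<otimes> antipode Q (p \<otimes> b)) q = counit Q q *\<^sub>C antipode Q p"
    if p: "p \<in> carrier Q" and q: "q \<in> carrier Q" for p q
  proof -
    have "sweedler Q (\<lambda>c d. c \<otimes> sweedler Q (\<lambda>a b. a \<otimes> antipode Q (d \<otimes> b)) q) p
        = counit Q p *\<^sub>C (counit Q q *\<^sub>C \<one>)" if p: "p \<in> carrier Q" for p
    proof -
      have "sweedler Q (\<lambda>c d. c \<otimes> sweedler Q (\<lambda>a b. a \<otimes> antipode Q (d \<otimes> b)) q) p
        = sweedler Q (\<lambda>c d. sweedler Q (\<lambda>a b. c \<otimes> (a \<otimes> antipode Q (d \<otimes> b))) q) p"
        using p q by (intro sweedler_cong sweedler_apply[where C = "carrier Q" and r = False])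
          (simp_all add: lin)
      also have "\<dots> = sweedler Q (\<lambda>c d. sweedler Q (\<lambda>a b. (c \<otimes> a) \<otimes> antipode Q (d \<otimes> b)) q) p"
        using p q by (intro sweedler_cong) (simp_all add: lin m_assoc)
      also have "\<dots> = sweedler Q (\<lambda>a b. a \<otimes> antipode Q b) (p \<otimes> q)"
        using p q by (intro sweedler_mult[symmetric]) (simp_all add: lin)
      also have "\<dots> = counit Q p *\<^sub>C (counit Q q *\<^sub>C \<one>)"
        using p q by (simp add: antipode_right lin counit_mult scaleC_scaleC)
      finally show ?thesis .
    qed
    then have "sweedler Q (\<lambda>a b. a \<otimes> antipode Q (p \<otimes> b)) q
        = antipode Q p \<otimes> (counit Q q *\<^sub>C \<one>)"
      using p q
      by (intro antipode_unique[where V = "carrier Q" and m = "(\<otimes>)"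
            and F = "\<lambda>p. sweedler Q (\<lambda>a b. a \<otimes> antipode Q (p \<otimes> b)) q"] bil)
        (simp_all add: lin m_assoc)
    then show ?thesis
      using p by (simp add: mult_scaleC lin)
  qed
  show ?thesis
    by (rule antipode_unique[where V = "carrier Q" and m = "(\<otimes>)"
          and F = "\<lambda>q. antipode Q (p \<otimes> q)"])
      (simp_all add: p q 1 bil lin m_assoc)
qed

lemma tensor_lift_pure_id:
  assumes "csubspace A" "csubspace B" "t \<in> tensor_space A B"
  shows "tensor_lift A B (\<boxtimes>) t = t"
  by (rule tensor_space_eqI[OF assms(1) semilin_tensor_lift[OF assms(1,2) pure_tensor_bisemilin]
        semilin_ident tensor_lift_pure_semilin[OF assms(1,2) pure_tensor_bisemilin] assms(3)])

text \<open>
  \<open>\<Delta>(S(q)) = S(q\<^sub>2) \<otimes> S(q\<^sub>1)\<close> because both sides are convolution inverse to \<open>\<Delta>\<close>. For the right-hand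
  side this is \<open>q\<^sub>1 S(q\<^sub>4) \<otimes> q\<^sub>2 S(q\<^sub>3) = \<epsilon>(q) 1 \<otimes> 1\<close>. The uniqueness lemma applies to the action of \<open>Q\<close>
  on its tensor square by multiplication with \<open>\<Delta>(q)\<close>, which is called \<open>m\<close>.
\<close>

lemma sweedler_antipode:
  assumes f: "bisemilin False (carrier Q) (carrier Q) f" and q: "q \<in> carrier Q"
  shows "sweedler Q f (antipode Q q) = sweedler Q (\<lambda>a b. f (antipode Q b) (antipode Q a)) q"
proof -
  let ?V = "tensor_space (carrier Q) (carrier Q)"
  define T where "T e g = tensor_lift (carrier Q) (carrier Q) (\<lambda>x y. (e \<otimes> x) \<boxtimes> (g \<otimes> y))" for e g
  define m where "m c t = sweedler Q (\<lambda>e g. T e g t) c" for c t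
  define F where "F = sweedler Q (\<lambda>a b. antipode Q b \<boxtimes> antipode Q a)"
  have T_pure: "T e g (x \<boxtimes> y) = (e \<otimes> x) \<boxtimes> (g \<otimes> y)"
    if "e \<in> carrier Q" "g \<in> carrier Q" "x \<in> carrier Q" "y \<in> carrier Q" for e g x y
    unfolding T_def using that by (intro tensor_lift_pure_semilin[where s = False]) (simp_all add: lin)
  have T3: "semilin s D (\<lambda>z. T e g (f z))" if "semilin s D f" "\<And>z. z \<in> D \<Longrightarrow> f z \<in> ?V"
    "e \<in> carrier Q" "g \<in> carrier Q" for s D e g and f :: "'d::complex_vector \<Rightarrow> _"
    unfolding T_def using that
    by (intro semilin_compose'[OF semilin_tensor_lift]) (simp_all add: lin)
  have T1: "semilin s D (\<lambda>z. T (f z) g t)" if "semilin s D f" "\<And>z. z \<in> D \<Longrightarrow> f z \<in> carrier Q"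
    "csubspace D" "g \<in> carrier Q" "t \<in> ?V" for s D g t
    and f :: "'d::complex_vector \<Rightarrow> _"
    unfolding T_def using that
    by (intro semilin_tensor_lift_param[where r = False]) (simp_all add: lin)
  have T2: "semilin s D (\<lambda>z. T e (f z) t)" if "semilin s D f" "\<And>z. z \<in> D \<Longrightarrow> f z \<in> carrier Q"
    "csubspace D" "e \<in> carrier Q" "t \<in> ?V" for s D e t
    and f :: "'d::complex_vector \<Rightarrow> _"
    unfolding T_def using that
    by (intro semilin_tensor_lift_param[where r = False]) (simp_all add: lin)
  have T_closed: "T e g t \<in> ?V" if "e \<in> carrier Q" "g \<in> carrier Q" "t \<in> ?V" for e g t
    unfolding T_def using that
    by (intro tensor_lift_apply(2)[where s = False and r = False and g = "\<lambda>x. x"]) (simp_all add: lin)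
  note [lin] = T1 T2 T3 T_closed
  have m_pure: "m p (x \<boxtimes> y) = sweedler Q (\<lambda>e g. (e \<otimes> x) \<boxtimes> (g \<otimes> y)) p"
    if "p \<in> carrier Q" "x \<in> carrier Q" "y \<in> carrier Q" for p x y
    unfolding m_def using that by (intro sweedler_cong) (simp_all add: T_pure)
  have m: "bisemilin False (carrier Q) ?V m"
    unfolding m_def by (simp add: lin)
  have m_closed: "m p t \<in> ?V" if "p \<in> carrier Q" "t \<in> ?V" for p t
    unfolding m_def using that by (simp add: lin)
  have m_right: "semilin False ?V (\<lambda>t. m p (f t))" if "semilin False ?V f" "p \<in> carrier Q"
    "\<And>z. z \<in> ?V \<Longrightarrow> f z \<in> ?V" for p f
    using that by (intro semilin_right[OF m])
  have m_mult: "m (p \<otimes> q) t = m p (m q t)"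
    if p: "p \<in> carrier Q" and q: "q \<in> carrier Q" and t: "t \<in> ?V" for p q t
  proof (rule tensor_space_eqI[OF subspace_carrier _ _ _ t, where s = False])
    fix x y assume xy: "x \<in> carrier Q" "y \<in> carrier Q"
    have "m p (m q (x \<boxtimes> y)) = m p (sweedler Q (\<lambda>e g. (e \<otimes> x) \<boxtimes> (g \<otimes> y)) q)"
      using q xy by (simp add: m_pure)
    also have "\<dots> = sweedler Q (\<lambda>e g. m p ((e \<otimes> x) \<boxtimes> (g \<otimes> y))) q"
      using p q xy m_right[OF semilin_ident]
      by (intro sweedler_apply[where C = ?V and r = False]) (simp_all add: lin)
    also have "\<dots> = sweedler Q (\<lambda>e g. sweedler Q (\<lambda>a b. (a \<otimes> (e \<otimes> x)) \<boxtimes> (b \<otimes> (g \<otimes> y))) p) q"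
      using p q xy by (intro sweedler_cong) (simp_all add: m_pure lin)
    also have "\<dots> = sweedler Q (\<lambda>a b. sweedler Q (\<lambda>e g. (a \<otimes> (e \<otimes> x)) \<boxtimes> (b \<otimes> (g \<otimes> y))) q) p"
      using p q xy by (intro sweedler_swap star_algebra_with_comult_axioms) (simp_all add: lin)
    also have "\<dots> = sweedler Q (\<lambda>a b. sweedler Q (\<lambda>e g. ((a \<otimes> e) \<otimes> x) \<boxtimes> ((b \<otimes> g) \<otimes> y)) q) p"
      using p q xy by (intro sweedler_cong) (simp_all add: lin m_assoc)
    also have "\<dots> = m (p \<otimes> q) (x \<boxtimes> y)"
      using p q xy sweedler_mult[where f = "\<lambda>e g. (e \<otimes> x) \<boxtimes> (g \<otimes> y)"]
      by (simp add: m_pure lin)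
    finally show "m (p \<otimes> q) (x \<boxtimes> y) = m p (m q (x \<boxtimes> y))" ..
  qed (use p q m_right[OF m_right[OF semilin_ident]] m_right[OF semilin_ident] m_closed in
      \<open>simp_all add: m_closed\<close>)
  have m_one: "m \<one> t = t" if "t \<in> ?V" for t
    using m_right[OF semilin_ident]
    by (intro tensor_space_eqI[OF subspace_carrier _ semilin_ident _ that])
      (simp_all add: m_pure lin sweedler_one[where s = False])
  have F_closed: "F p \<in> ?V" if "p \<in> carrier Q" for p
    unfolding F_def using that by (simp add: lin)
  have F: "semilin False (carrier Q) F"
    unfolding F_def
    using semilin_sweedler[OF _ semilin_ident, where f = "\<lambda>a b. antipode Q b \<boxtimes> antipode Q a"]
    by (simp add: lin)
  have inv: "sweedler Q (\<lambda>c d. m c (F d)) p = counit Q p *\<^sub>C (\<one> \<boxtimes> \<one>)" if p: "p \<in> carrier Q" for p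
  proof -
    \<comment> \<open>\<open>Y p\<^sub>1 p\<^sub>2 p\<^sub>3 p\<^sub>4\<close> is \<open>p\<^sub>1 S(p\<^sub>4) \<otimes> p\<^sub>2 S(p\<^sub>3)\<close>.\<close>
    define Y where "Y e g a b = (e \<otimes> antipode Q b) \<boxtimes> (g \<otimes> antipode Q a)" for e g a b
    have "sweedler Q (\<lambda>c d. m c (F d)) p
        = sweedler Q (\<lambda>c d. sweedler Q (\<lambda>e g. T e g (F d)) c) p"
      by (simp add: m_def)
    also have "\<dots> = sweedler Q (\<lambda>c d. sweedler Q (\<lambda>e g. sweedler Q (\<lambda>a b. Y e g a b) d) c) p"
    proof (intro sweedler_cong p)
      fix c d e g assume *: "c \<in> carrier Q" "d \<in> carrier Q" "e \<in> carrier Q" "g \<in> carrier Q"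
      have "T e g (F d) = sweedler Q (\<lambda>a b. T e g (antipode Q b \<boxtimes> antipode Q a)) d"
        unfolding F_def using *
        by (intro sweedler_apply[where C = ?V and r = False]) (simp_all add: lin)
      also have "\<dots> = sweedler Q (\<lambda>a b. Y e g a b) d"
        using * by (intro sweedler_cong) (simp_all add: Y_def T_pure lin)
      finally show "T e g (F d) = sweedler Q (\<lambda>a b. Y e g a b) d" .
    qed
    also have "\<dots> = sweedler Q (\<lambda>e c. sweedler Q (\<lambda>g d. sweedler Q (\<lambda>a b. Y e g a b) d) c) p"
      using p unfolding Y_def by (intro sweedler_coassoc) (simp_all add: lin)
    also have "\<dots> = sweedler Q (\<lambda>e c. sweedler Q (\<lambda>z b. sweedler Q (\<lambda>g a. Y e g a b) z) c) p"
      using p unfolding Y_def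
      by (intro sweedler_cong[OF p] sweedler_coassoc[symmetric]) (simp_all add: lin)
    also have "\<dots> = sweedler Q (\<lambda>e c. (e \<otimes> antipode Q c) \<boxtimes> \<one>) p"
    proof (intro sweedler_cong p)
      fix e c assume *: "e \<in> carrier Q" "c \<in> carrier Q"
      have "sweedler Q (\<lambda>z b. sweedler Q (\<lambda>g a. Y e g a b) z) c
          = sweedler Q (\<lambda>z b. (e \<otimes> antipode Q b) \<boxtimes> sweedler Q (\<lambda>g a. g \<otimes> antipode Q a) z) c"
        unfolding Y_def using *
        by (intro sweedler_cong sweedler_apply[symmetric, where C = "carrier Q" and r = False])
          (simp_all add: lin)
      also have "\<dots> = sweedler Q (\<lambda>z b. counit Q z *\<^sub>C ((e \<otimes> antipode Q b) \<boxtimes> \<one>)) c"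
        using * by (intro sweedler_cong) (simp_all add: lin antipode_right scaleC_pure_right)
      also have "\<dots> = (e \<otimes> antipode Q c) \<boxtimes> \<one>"
        using * by (intro sweedler_counit_left) (simp_all add: lin)
      finally show "sweedler Q (\<lambda>z b. sweedler Q (\<lambda>g a. Y e g a b) z) c
        = (e \<otimes> antipode Q c) \<boxtimes> \<one>" .
    qed
    also have "\<dots> = sweedler Q (\<lambda>e c. e \<otimes> antipode Q c) p \<boxtimes> \<one>"
      using p by (intro sweedler_apply[symmetric, where C = "carrier Q" and r = False
            and g = "\<lambda>x. x \<boxtimes> \<one>"]) (simp_all add: lin)
    also have "\<dots> = counit Q p *\<^sub>C (\<one> \<boxtimes> \<one>)"
      using p by (simp add: antipode_right scaleC_pure_left)
    finally show ?thesis .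
  qed
  have "F q = m (antipode Q q) (\<one> \<boxtimes> \<one>)"
    by (rule antipode_unique[where V = ?V and m = m and F = F])
      (simp_all add: m m_closed m_mult m_one F F_closed inv q lin)
  also have "\<dots> = sweedler Q (\<lambda>e g. e \<boxtimes> g) (antipode Q q)"
    using q by (simp add: m_pure lin cong: sweedler_cong)
  also have "\<dots> = comult Q (antipode Q q)"
    unfolding sweedler_def using q by (intro tensor_lift_pure_id) (simp_all add: lin)
  finally have "sweedler Q f (antipode Q q)
      = tensor_lift (carrier Q) (carrier Q) f (sweedler Q (\<lambda>a b. antipode Q b \<boxtimes> antipode Q a) q)"
    by (simp add: F_def sweedler_def)
  also have "\<dots> = sweedler Q (\<lambda>a b. tensor_lift (carrier Q) (carrier Q) f
      (antipode Q b \<boxtimes> antipode Q a)) q"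
    using q by (intro sweedler_apply[OF _ _ _ _ semilin_tensor_lift[OF _ _ f]]) (simp_all add: lin)
  also have "\<dots> = sweedler Q (\<lambda>a b. f (antipode Q b) (antipode Q a)) q"
    using q by (intro sweedler_cong tensor_lift_pure_semilin[OF _ _ f]) (simp_all add: lin)
  finally show ?thesis .
qed

lemma antipode_star_antipode:
  assumes "q \<in> carrier Q"
  shows "antipode Q (star Q (antipode Q q)) = star Q q"
  by (metis antipode_closed antipode_star_involution assms star_closed star_star)

end

section \<open>The crossed product\<close>

context module_star_algebra
begin

abbreviation R where "R \<equiv> crossed_product A Q act"

abbreviation crossed_mult (infixl \<open>\<bullet>\<close> 70) where "s \<bullet> t \<equiv> s \<otimes>\<^bsub>R\<^esub> t"

lemmas [lin] = act_closed

lemma act_bisemilin: "bisemilin False (carrier Q) (carrier A) act"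
  using act_bilinear by (simp add: cbilinear_on_bisemilin)

lemma semilin_act_left [lin]:
  "semilin s D f \<Longrightarrow> (\<And>x. x \<in> D \<Longrightarrow> f x \<in> carrier Q) \<Longrightarrow> y \<in> carrier A \<Longrightarrow>
    semilin s D (\<lambda>x. act (f x) y)"
  by (rule semilin_left[OF act_bisemilin])

lemma semilin_act_right [lin]:
  "semilin s D f \<Longrightarrow> (\<And>x. x \<in> D \<Longrightarrow> f x \<in> carrier A) \<Longrightarrow> q \<in> carrier Q \<Longrightarrow>
    semilin s D (\<lambda>x. act q (f x))"
  by (rule semilin_right[OF act_bisemilin])

lemma carrier_crossed: "carrier R = tensor_space (carrier A) (carrier Q)"
  by (simp add: crossed_product_def)

lemma subspace_crossed [lin]: "csubspace (carrier R)"
  by (simp add: carrier_crossed lin)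

lemma pure_in_crossed [lin]: "x \<in> carrier A \<Longrightarrow> h \<in> carrier Q \<Longrightarrow> x \<boxtimes> h \<in> carrier R"
  by (simp add: carrier_crossed lin)

lemma one_crossed: "\<one>\<^bsub>R\<^esub> = \<one>\<^bsub>A\<^esub> \<boxtimes> \<one>"
  by (simp add: crossed_product_def)

lemma crossed_eqI:
  assumes "semilin s (carrier R) f" "semilin s (carrier R) g"
    and "\<And>x h. x \<in> carrier A \<Longrightarrow> h \<in> carrier Q \<Longrightarrow> f (x \<boxtimes> h) = g (x \<boxtimes> h)"
    and "t \<in> carrier R"
  shows "f t = g t"
  using assms unfolding carrier_crossed by (rule tensor_space_eqI[OF alg.subspace_carrier])

lemma mult_crossed_facts:
  shows mult_crossed_pure: "\<And>x h y g. x \<in> carrier A \<Longrightarrow> h \<in> carrier Q \<Longrightarrow> y \<in> carrier A \<Longrightarrow> g \<in> carrier Q \<Longrightarrow>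
      (x \<boxtimes> h) \<bullet> (y \<boxtimes> g) = sweedler Q (\<lambda>a b. (x \<otimes>\<^bsub>A\<^esub> act a y) \<boxtimes> (b \<otimes> g)) h"
    and mult_crossed_bisemilin: "bisemilin False (carrier R) (carrier R) (mult R)"
    and mult_crossed_closed: "\<And>s t. s \<in> carrier R \<Longrightarrow> t \<in> carrier R \<Longrightarrow> s \<bullet> t \<in> carrier R"
proof -
  have m: "s \<bullet> t = tensor_lift (carrier A) (carrier Q) (\<lambda>x h. tensor_lift (carrier A) (carrier Q)
      (\<lambda>y g. sweedler Q (\<lambda>a b. (x \<otimes>\<^bsub>A\<^esub> act a y) \<boxtimes> (b \<otimes> g)) h) t) s" for s t
    by (simp add: crossed_product_def)
  note facts = tensor_lift_quadrilinear[where m = "mult R" and V = "carrier R" and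
      k = "\<lambda>x h y g. sweedler Q (\<lambda>a b. (x \<otimes>\<^bsub>A\<^esub> act a y) \<boxtimes> (b \<otimes> g)) h",
      OF alg.subspace_carrier subspace_carrier alg.subspace_carrier subspace_carrier
        subspace_crossed _ _ _ _ m]
  show "(x \<boxtimes> h) \<bullet> (y \<boxtimes> g) = sweedler Q (\<lambda>a b. (x \<otimes>\<^bsub>A\<^esub> act a y) \<boxtimes> (b \<otimes> g)) h"
    if "x \<in> carrier A" "h \<in> carrier Q" "y \<in> carrier A" "g \<in> carrier Q" for x h y g
    using that by (intro facts(1)) (simp_all add: lin)
  show "bisemilin False (carrier R) (carrier R) (mult R)"
    unfolding carrier_crossed by (intro facts(2)) (simp_all add: lin)
  show "s \<bullet> t \<in> carrier R" if "s \<in> carrier R" "t \<in> carrier R" for s t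
    using that by (intro facts(3)) (simp_all add: lin flip: carrier_crossed)
qed

lemmas [lin] = mult_crossed_closed

lemma semilin_mult_crossed_left [lin]:
  "semilin s D f \<Longrightarrow> (\<And>x. x \<in> D \<Longrightarrow> f x \<in> carrier R) \<Longrightarrow> t \<in> carrier R \<Longrightarrow>
    semilin s D (\<lambda>x. f x \<bullet> t)"
  by (rule semilin_left[OF mult_crossed_bisemilin])

lemma semilin_mult_crossed_right [lin]:
  "semilin s D f \<Longrightarrow> (\<And>x. x \<in> D \<Longrightarrow> f x \<in> carrier R) \<Longrightarrow> t \<in> carrier R \<Longrightarrow>
    semilin s D (\<lambda>x. t \<bullet> f x)"
  by (rule semilin_right[OF mult_crossed_bisemilin])

text \<open>
  Both products equal \<open>x (h\<^sub>1 \<cdot> y)(h\<^sub>2 \<cdot> g\<^sub>1 \<cdot> z) \<rtimes> h\<^sub>3 g\<^sub>2 k\<close>: one from multiplicativity of the coproduct, the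
  other from the rule for the action on a product.
\<close>

lemma crossed_assoc_pure:
  assumes x: "x \<in> carrier A" and y: "y \<in> carrier A" and z: "z \<in> carrier A"
    and h: "h \<in> carrier Q" and g: "g \<in> carrier Q" and k: "k \<in> carrier Q"
  shows "(x \<boxtimes> h) \<bullet> (y \<boxtimes> g) \<bullet> (z \<boxtimes> k) = (x \<boxtimes> h) \<bullet> ((y \<boxtimes> g) \<bullet> (z \<boxtimes> k))"
proof -
  define X where "X a c d e f =
    (x \<otimes>\<^bsub>A\<^esub> (act a y \<otimes>\<^bsub>A\<^esub> act c (act e z))) \<boxtimes> (d \<otimes> (f \<otimes> k))" for a c d e f
  have "(x \<boxtimes> h) \<bullet> (y \<boxtimes> g) \<bullet> (z \<boxtimes> k)
      = sweedler Q (\<lambda>a b. (x \<otimes>\<^bsub>A\<^esub> act a y) \<boxtimes> (b \<otimes> g)) h \<bullet> (z \<boxtimes> k)"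
    using assms by (simp add: mult_crossed_pure)
  also have "\<dots> = sweedler Q (\<lambda>a b. ((x \<otimes>\<^bsub>A\<^esub> act a y) \<boxtimes> (b \<otimes> g)) \<bullet> (z \<boxtimes> k)) h"
    using assms
    by (intro sweedler_apply[where C = "carrier R" and r = False and g = "\<lambda>t. t \<bullet> (z \<boxtimes> k)"])
      (simp_all add: lin)
  also have "\<dots> = sweedler Q (\<lambda>a b. sweedler Q (\<lambda>c d. sweedler Q (\<lambda>e f. X a c d e f) g) b) h"
  proof (intro sweedler_cong h)
    fix a b assume ab: "a \<in> carrier Q" "b \<in> carrier Q"
    have "((x \<otimes>\<^bsub>A\<^esub> act a y) \<boxtimes> (b \<otimes> g)) \<bullet> (z \<boxtimes> k)
        = sweedler Q (\<lambda>c d. ((x \<otimes>\<^bsub>A\<^esub> act a y) \<otimes>\<^bsub>A\<^esub> act c z) \<boxtimes> (d \<otimes> k)) (b \<otimes> g)"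
      using assms ab by (simp add: mult_crossed_pure lin)
    also have "\<dots> = sweedler Q (\<lambda>c d. sweedler Q (\<lambda>e f.
        ((x \<otimes>\<^bsub>A\<^esub> act a y) \<otimes>\<^bsub>A\<^esub> act (c \<otimes> e) z) \<boxtimes> (d \<otimes> f \<otimes> k)) g) b"
      using assms ab by (intro sweedler_mult) (simp_all add: lin)
    also have "\<dots> = sweedler Q (\<lambda>c d. sweedler Q (\<lambda>e f. X a c d e f) g) b"
      using assms ab by (intro sweedler_cong) (simp_all add: lin X_def m_assoc alg.m_assoc act_mult)
    finally show "((x \<otimes>\<^bsub>A\<^esub> act a y) \<boxtimes> (b \<otimes> g)) \<bullet> (z \<boxtimes> k)
        = sweedler Q (\<lambda>c d. sweedler Q (\<lambda>e f. X a c d e f) g) b" .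
  qed
  also have "\<dots> = sweedler Q (\<lambda>a b. sweedler Q (\<lambda>c d. sweedler Q (\<lambda>e f. X c d b e f) g) a) h"
    using assms unfolding X_def by (intro sweedler_coassoc[symmetric]) (simp_all add: lin)
  finally have 1: "(x \<boxtimes> h) \<bullet> (y \<boxtimes> g) \<bullet> (z \<boxtimes> k)
    = sweedler Q (\<lambda>a b. sweedler Q (\<lambda>c d. sweedler Q (\<lambda>e f. X c d b e f) g) a) h" .
  have "(x \<boxtimes> h) \<bullet> ((y \<boxtimes> g) \<bullet> (z \<boxtimes> k))
      = (x \<boxtimes> h) \<bullet> sweedler Q (\<lambda>e f. (y \<otimes>\<^bsub>A\<^esub> act e z) \<boxtimes> (f \<otimes> k)) g"
    using assms by (simp add: mult_crossed_pure)
  also have "\<dots> = sweedler Q (\<lambda>e f. (x \<boxtimes> h) \<bullet> ((y \<otimes>\<^bsub>A\<^esub> act e z) \<boxtimes> (f \<otimes> k))) g"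
    using assms
    by (intro sweedler_apply[where C = "carrier R" and r = False]) (simp_all add: lin)
  also have "\<dots> = sweedler Q (\<lambda>e f. sweedler Q (\<lambda>a b.
      (x \<otimes>\<^bsub>A\<^esub> act a (y \<otimes>\<^bsub>A\<^esub> act e z)) \<boxtimes> (b \<otimes> (f \<otimes> k))) h) g"
    using assms by (intro sweedler_cong) (simp_all add: lin mult_crossed_pure)
  also have "\<dots> = sweedler Q (\<lambda>a b. sweedler Q (\<lambda>e f.
      (x \<otimes>\<^bsub>A\<^esub> act a (y \<otimes>\<^bsub>A\<^esub> act e z)) \<boxtimes> (b \<otimes> (f \<otimes> k))) g) h"
    using assms by (intro sweedler_swap star_algebra_with_comult_axioms) (simp_all add: lin)
  also have "\<dots> = sweedler Q (\<lambda>a b. sweedler Q (\<lambda>e f. sweedler Q (\<lambda>c d. X c d b e f) a) g) h"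
  proof (intro sweedler_cong h g)
    fix a b e f assume *: "a \<in> carrier Q" "b \<in> carrier Q" "e \<in> carrier Q" "f \<in> carrier Q"
    have "(x \<otimes>\<^bsub>A\<^esub> act a (y \<otimes>\<^bsub>A\<^esub> act e z)) \<boxtimes> (b \<otimes> (f \<otimes> k))
        = (x \<otimes>\<^bsub>A\<^esub> sweedler Q (\<lambda>c d. act c y \<otimes>\<^bsub>A\<^esub> act d (act e z)) a) \<boxtimes> (b \<otimes> (f \<otimes> k))"
      using assms * by (simp add: act_on_mult lin)
    also have "\<dots> = sweedler Q (\<lambda>c d. X c d b e f) a"
      using assms * unfolding X_def
      by (intro sweedler_apply[where C = "carrier A" and r = False and
            g = "\<lambda>u. (x \<otimes>\<^bsub>A\<^esub> u) \<boxtimes> (b \<otimes> (f \<otimes> k))"]) (simp_all add: lin)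
    finally show "(x \<otimes>\<^bsub>A\<^esub> act a (y \<otimes>\<^bsub>A\<^esub> act e z)) \<boxtimes> (b \<otimes> (f \<otimes> k))
      = sweedler Q (\<lambda>c d. X c d b e f) a" .
  qed
  also have "\<dots> = sweedler Q (\<lambda>a b. sweedler Q (\<lambda>c d. sweedler Q (\<lambda>e f. X c d b e f) g) a) h"
    using assms unfolding X_def
    by (intro sweedler_cong[OF h] sweedler_swap star_algebra_with_comult_axioms) (simp_all add: lin)
  finally show ?thesis
    using 1 by simp
qed

lemma monoid_crossed: "monoid R"
proof
  show "\<one>\<^bsub>R\<^esub> \<in> carrier R"
    by (simp add: one_crossed lin)
  show "s \<bullet> t \<in> carrier R" if "s \<in> carrier R" "t \<in> carrier R" for s t
    using that by (simp add: lin)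
  show "s \<bullet> t \<bullet> u = s \<bullet> (t \<bullet> u)"
    if s: "s \<in> carrier R" and t: "t \<in> carrier R" and u: "u \<in> carrier R" for s t u
  proof (rule crossed_eqI[OF _ _ _ s, where s = False])
    fix x h assume xh: "x \<in> carrier A" "h \<in> carrier Q"
    show "(x \<boxtimes> h) \<bullet> t \<bullet> u = (x \<boxtimes> h) \<bullet> (t \<bullet> u)"
    proof (rule crossed_eqI[OF _ _ _ t, where s = False])
      fix y g assume yg: "y \<in> carrier A" "g \<in> carrier Q"
      show "(x \<boxtimes> h) \<bullet> (y \<boxtimes> g) \<bullet> u = (x \<boxtimes> h) \<bullet> ((y \<boxtimes> g) \<bullet> u)"
        by (rule crossed_eqI[OF _ _ _ u, where s = False])
          (use xh yg crossed_assoc_pure in \<open>simp_all add: lin\<close>)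
    qed (use xh u in \<open>simp_all add: lin\<close>)
  qed (use t u in \<open>simp_all add: lin\<close>)
  show "\<one>\<^bsub>R\<^esub> \<bullet> t = t" if "t \<in> carrier R" for t
    by (rule crossed_eqI[OF _ _ _ that, where s = False])
      (simp_all add: one_crossed lin mult_crossed_pure sweedler_one[where s = False] act_unit)
  show "t \<bullet> \<one>\<^bsub>R\<^esub> = t" if "t \<in> carrier R" for t
  proof (rule crossed_eqI[OF _ _ _ that, where s = False])
    fix x h assume "x \<in> carrier A" "h \<in> carrier Q"
    then show "(x \<boxtimes> h) \<bullet> \<one>\<^bsub>R\<^esub> = x \<boxtimes> h"
      using sweedler_counit_left[of h "\<lambda>b. x \<boxtimes> b"]
      by (simp add: one_crossed lin mult_crossed_pure act_on_one alg.mult_scaleC scaleC_pure_left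
          cong: sweedler_cong)
  qed (simp_all add: lin one_crossed)
qed

lemma star_crossed_pure:
  assumes "x \<in> carrier A" "h \<in> carrier Q"
  shows "star R (x \<boxtimes> h) = sweedler Q (\<lambda>a b. act a (star A x) \<boxtimes> b) (star Q h)"
  unfolding crossed_product_def using assms
  by (simp, intro tensor_lift_pure_semilin[where s = True])
    (auto simp: lin intro!: bisemilinI semilin_sweedler_param[where s = True])

lemma semilin_star_crossed_carrier: "semilin True (carrier R) (star R)"
proof -
  have "star R = tensor_lift (carrier A) (carrier Q)
      (\<lambda>x h. sweedler Q (\<lambda>a b. act a (star A x) \<boxtimes> b) (star Q h))"
    by (simp add: crossed_product_def)
  then show ?thesis
    unfolding carrier_crossed by (simp, intro semilin_tensor_lift) (simp_all add: lin)
qed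

lemma star_crossed_closed [lin]:
  assumes "t \<in> carrier R"
  shows "star R t \<in> carrier R"
proof -
  have "star R t = tensor_lift (carrier A) (carrier Q)
      (\<lambda>x h. sweedler Q (\<lambda>a b. act a (star A x) \<boxtimes> b) (star Q h)) t"
    by (simp add: crossed_product_def)
  then show ?thesis
    using tensor_lift_apply(2)[where s = True and r = False and g = "\<lambda>x. x" and t = t and
        C = "carrier R" and A = "carrier A" and B = "carrier Q" and
        f = "\<lambda>x h. sweedler Q (\<lambda>a b. act a (star A x) \<boxtimes> b) (star Q h)"] assms
    by (simp add: lin carrier_crossed[symmetric])
qed

text \<open>
  The map \<open>q \<mapsto> S(q\<^sup>*)\<^sup>*\<close> is the inverse of the antipode. The identity is the adjoint of
  \<open>S(k\<^sub>1) k\<^sub>2 = \<epsilon>(k) 1\<close> at \<open>k = q\<^sup>*\<close>.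
\<close>

lemma star_antipode_cancel:
  assumes q: "q \<in> carrier Q"
  shows "sweedler Q (\<lambda>c d. d \<otimes> star Q (antipode Q (star Q c))) q = counit Q q *\<^sub>C \<one>"
proof -
  have "sweedler Q (\<lambda>c d. d \<otimes> star Q (antipode Q (star Q c))) q
      = sweedler Q (\<lambda>c d. star Q (antipode Q (star Q c) \<otimes> star Q d)) q"
    using q by (intro sweedler_cong) (simp_all add: lin star_mult star_star)
  also have "\<dots> = sweedler Q (\<lambda>c d. star Q (antipode Q c \<otimes> d)) (star Q q)"
    using q by (intro sweedler_star[where s = True, symmetric]) (simp_all add: lin)
  also have "\<dots> = star Q (sweedler Q (\<lambda>c d. antipode Q c \<otimes> d) (star Q q))"
    using q by (intro sweedler_apply[symmetric, OF _ _ _ _ semilin_star_carrier]) (simp_all add: lin)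
  also have "\<dots> = counit Q q *\<^sub>C \<one>"
    using q by (simp add: antipode_left lin counit_star star_scaleC star_one)
  finally show ?thesis .
qed

text \<open>
  This is \<open>k\<^sub>2 (S\<^sup>-\<^sup>1(k\<^sub>1) \<cdot> z) = z k\<close> in the crossed product. It is behind both nontrivial laws of the
  involution, as \<open>(h \<cdot> x)\<^sup>*\<close> is \<open>S(h)\<^sup>* \<cdot> x\<^sup>*\<close>.
\<close>

lemma crossed_antipode_cancel:
  assumes k: "k \<in> carrier Q" and z: "z \<in> carrier A"
  shows "sweedler Q (\<lambda>a b. sweedler Q (\<lambda>c d.
    act c (act (star Q (antipode Q (star Q a))) z) \<boxtimes> d) b) k = z \<boxtimes> k"
proof -
  have "sweedler Q (\<lambda>a b. sweedler Q (\<lambda>c d.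
      act c (act (star Q (antipode Q (star Q a))) z) \<boxtimes> d) b) k
    = sweedler Q (\<lambda>a b. sweedler Q (\<lambda>c d.
      act d (act (star Q (antipode Q (star Q c))) z) \<boxtimes> b) a) k"
    using assms by (intro sweedler_coassoc[symmetric]) (simp_all add: lin)
  also have "\<dots> = sweedler Q (\<lambda>a b. sweedler Q (\<lambda>c d.
      act (d \<otimes> star Q (antipode Q (star Q c))) z \<boxtimes> b) a) k"
    using assms by (intro sweedler_cong) (simp_all add: act_mult lin)
  also have "\<dots> = sweedler Q (\<lambda>a b.
      act (sweedler Q (\<lambda>c d. d \<otimes> star Q (antipode Q (star Q c))) a) z \<boxtimes> b) k"
    using assms by (intro sweedler_cong sweedler_apply[symmetric, where C = "carrier Q" and r = False and
          g = "\<lambda>u. act u z \<boxtimes> _"]) (simp_all add: lin)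
  also have "\<dots> = sweedler Q (\<lambda>a b. counit Q a *\<^sub>C (z \<boxtimes> b)) k"
    using assms semilin_scale[OF semilin_act_left[OF semilin_ident]]
    by (intro sweedler_cong) (simp_all add: star_antipode_cancel lin act_unit scaleC_pure_left)
  also have "\<dots> = z \<boxtimes> k"
    using assms by (intro sweedler_counit_left) (simp_all add: lin)
  finally show ?thesis .
qed

text \<open>
  Multiplication rules for the two subalgebras that generate the crossed product. The last one is
  the commutation relation \<open>h x = (h\<^sub>1 \<cdot> x) h\<^sub>2\<close>.
\<close>

lemma embed_mult:
  assumes "x \<in> carrier A" "h \<in> carrier Q"
  shows base_times: "y \<in> carrier A \<Longrightarrow> (x \<boxtimes> \<one>) \<bullet> (y \<boxtimes> h) = (x \<otimes>\<^bsub>A\<^esub> y) \<boxtimes> h"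
    and times_hopf: "g \<in> carrier Q \<Longrightarrow> (x \<boxtimes> h) \<bullet> (\<one>\<^bsub>A\<^esub> \<boxtimes> g) = x \<boxtimes> (h \<otimes> g)"
    and hopf_times_base:
      "(\<one>\<^bsub>A\<^esub> \<boxtimes> h) \<bullet> (x \<boxtimes> \<one>) = sweedler Q (\<lambda>a b. act a x \<boxtimes> b) h"
proof -
  show "(x \<boxtimes> \<one>) \<bullet> (y \<boxtimes> h) = (x \<otimes>\<^bsub>A\<^esub> y) \<boxtimes> h" if "y \<in> carrier A"
    using assms that by (simp add: mult_crossed_pure lin sweedler_one[where s = False] act_unit)
  show "(x \<boxtimes> h) \<bullet> (\<one>\<^bsub>A\<^esub> \<boxtimes> g) = x \<boxtimes> (h \<otimes> g)" if "g \<in> carrier Q"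
    using assms that sweedler_counit_left[of h "\<lambda>b. x \<boxtimes> (b \<otimes> g)"]
    by (simp add: mult_crossed_pure lin act_on_one alg.mult_scaleC scaleC_pure_left cong: sweedler_cong)
  show "(\<one>\<^bsub>A\<^esub> \<boxtimes> h) \<bullet> (x \<boxtimes> \<one>) = sweedler Q (\<lambda>a b. act a x \<boxtimes> b) h"
    using assms by (simp add: mult_crossed_pure lin cong: sweedler_cong)
qed

lemma star_crossed_product_form:
  assumes "x \<in> carrier A" "h \<in> carrier Q"
  shows "star R (x \<boxtimes> h) = (\<one>\<^bsub>A\<^esub> \<boxtimes> star Q h) \<bullet> (star A x \<boxtimes> \<one>)"
  using assms by (simp add: star_crossed_pure hopf_times_base lin)

lemma semilin_star_crossed [lin]:
  "semilin (\<not> s) D f \<Longrightarrow> (\<And>x. x \<in> D \<Longrightarrow> f x \<in> carrier R) \<Longrightarrow> semilin s D (\<lambda>x. star R (f x))"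
  by (rule semilin_compose[where A = "carrier R" and s = "\<not> s" and g = "star R" and f = f])
    (simp_all add: semilin_star_crossed_carrier)

lemma star_star_crossed_pure:
  assumes x: "x \<in> carrier A" and h: "h \<in> carrier Q"
  shows "star R (star R (x \<boxtimes> h)) = x \<boxtimes> h"
proof -
  have "star R (star R (x \<boxtimes> h)) = star R (sweedler Q (\<lambda>a b. act a (star A x) \<boxtimes> b) (star Q h))"
    using assms by (simp add: star_crossed_pure)
  also have "\<dots> = sweedler Q (\<lambda>a b. star R (act a (star A x) \<boxtimes> b)) (star Q h)"
    using assms by (intro sweedler_apply[OF _ _ _ _ semilin_star_crossed_carrier]) (simp_all add: lin)
  also have "\<dots> = sweedler Q (\<lambda>a b. star R (act (star Q a) (star A x) \<boxtimes> star Q b)) h"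
    using assms
    by (intro sweedler_star[where s = True]) (simp_all add: lin)
  also have "\<dots> = sweedler Q (\<lambda>a b. sweedler Q (\<lambda>c d.
      act c (act (star Q (antipode Q (star Q a))) x) \<boxtimes> d) b) h"
    using assms by (intro sweedler_cong)
      (simp_all add: lin star_crossed_pure act_star star_star alg.star_star)
  also have "\<dots> = x \<boxtimes> h"
    by (rule crossed_antipode_cancel[OF h x])
  finally show ?thesis .
qed

text \<open>
  Writing \<open>(x h)\<^sup>*\<close> as \<open>h\<^sup>* x\<^sup>*\<close>, everything reduces to \<open>h\<^sub>2\<^sup>* (h\<^sub>1 \<cdot> y)\<^sup>* = y\<^sup>* h\<^sup>*\<close>, the adjoint of the
  commutation relation.
\<close>

lemma star_mult_crossed_pure:
  assumes x: "x \<in> carrier A" and h: "h \<in> carrier Q" and y: "y \<in> carrier A" and g: "g \<in> carrier Q"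
  shows "star R ((x \<boxtimes> h) \<bullet> (y \<boxtimes> g)) = star R (y \<boxtimes> g) \<bullet> star R (x \<boxtimes> h)"
proof -
  interpret R: monoid R by (rule monoid_crossed)
  let ?i = "\<lambda>h. \<one>\<^bsub>A\<^esub> \<boxtimes> h" and ?j = "\<lambda>x. x \<boxtimes> \<one>"
  have i_mult: "?i (h \<otimes> g) = ?i h \<bullet> ?i g" if "h \<in> carrier Q" "g \<in> carrier Q" for h g
    using that by (simp add: times_hopf)
  have j_mult: "?j (x \<otimes>\<^bsub>A\<^esub> y) = ?j x \<bullet> ?j y" if "x \<in> carrier A" "y \<in> carrier A" for x y
    using that by (simp add: base_times lin)
  note [lin] = R.m_assoc
  let ?y = "star A y"
  have "star R ((x \<boxtimes> h) \<bullet> (y \<boxtimes> g))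
      = star R (sweedler Q (\<lambda>a b. (x \<otimes>\<^bsub>A\<^esub> act a y) \<boxtimes> (b \<otimes> g)) h)"
    using assms by (simp add: mult_crossed_pure)
  also have "\<dots> = sweedler Q (\<lambda>a b. star R ((x \<otimes>\<^bsub>A\<^esub> act a y) \<boxtimes> (b \<otimes> g))) h"
    using assms by (intro sweedler_apply[OF _ _ _ _ semilin_star_crossed_carrier]) (simp_all add: lin)
  also have "\<dots> = sweedler Q (\<lambda>a b. ?i (star Q g) \<bullet>
      (?i (star Q b) \<bullet> ?j (act (star Q (antipode Q a)) ?y)) \<bullet> ?j (star A x)) h"
    using assms
    by (intro sweedler_cong)
      (simp_all add: star_crossed_product_form lin star_mult alg.star_mult act_star i_mult j_mult)
  also have "\<dots> = ?i (star Q g) \<bullet> sweedler Q (\<lambda>a b.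
      ?i (star Q b) \<bullet> ?j (act (star Q (antipode Q a)) ?y)) h \<bullet> ?j (star A x)"
    using assms
    by (intro sweedler_apply_gen[symmetric, where s = True and r = False and C = "carrier R" and
          g = "\<lambda>t. ?i (star Q g) \<bullet> t \<bullet> ?j (star A x)"]) (simp_all add: lin)
  also have "sweedler Q (\<lambda>a b. ?i (star Q b) \<bullet> ?j (act (star Q (antipode Q a)) ?y)) h
      = ?j ?y \<bullet> ?i (star Q h)"
  proof -
    have "sweedler Q (\<lambda>a b. ?i (star Q b) \<bullet> ?j (act (star Q (antipode Q a)) ?y)) h
      = sweedler Q (\<lambda>a b. ?i (star Q (star Q b)) \<bullet>
          ?j (act (star Q (antipode Q (star Q a))) ?y)) (star Q h)"
      using assms by (subst sweedler_star[where s = False and q = h])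
        (simp_all add: lin star_star cong: sweedler_cong)
    also have "\<dots> = sweedler Q (\<lambda>a b. sweedler Q (\<lambda>c d.
      act c (act (star Q (antipode Q (star Q a))) ?y) \<boxtimes> d) b) (star Q h)"
      using assms by (intro sweedler_cong) (simp_all add: lin hopf_times_base star_star)
    also have "\<dots> = ?y \<boxtimes> star Q h"
      using assms by (intro crossed_antipode_cancel) (simp_all add: lin)
    also have "\<dots> = ?j ?y \<bullet> ?i (star Q h)"
      using assms by (simp add: base_times lin)
    finally show ?thesis .
  qed
  also have "?i (star Q g) \<bullet> (?j ?y \<bullet> ?i (star Q h)) \<bullet> ?j (star A x)
      = star R (y \<boxtimes> g) \<bullet> star R (x \<boxtimes> h)"
    using assms by (simp add: star_crossed_product_form lin)
  finally show ?thesis .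
qed

lemma star_algebra_crossed: "star_algebra R"
proof -
  interpret R: monoid R by (rule monoid_crossed)
  show ?thesis
  proof
    show "csubspace (carrier R)" by (simp add: lin)
    show "cbilinear_on (carrier R) (carrier R) (mult R)"
      using mult_crossed_bisemilin by (simp add: cbilinear_on_bisemilin)
    show "star R t \<in> carrier R" if "t \<in> carrier R" for t
      using that by (rule star_crossed_closed)
    show "star R (s + t) = star R s + star R t" if "s \<in> carrier R" "t \<in> carrier R" for s t
      using that by (rule semilin_add[OF semilin_star_crossed_carrier])
    show "star R (c *\<^sub>C t) = cnj c *\<^sub>C star R t" if "t \<in> carrier R" for c t
      using semilin_scale[OF semilin_star_crossed_carrier that] by simp
    show "star R (star R t) = t" if "t \<in> carrier R" for t
      by (rule crossed_eqI[OF _ _ _ that, where s = False])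
        (simp_all add: lin star_star_crossed_pure)
    show "star R (s \<bullet> t) = star R t \<bullet> star R s"
      if s: "s \<in> carrier R" and t: "t \<in> carrier R" for s t
    proof (rule crossed_eqI[OF _ _ _ s, where s = True])
      fix x h assume xh: "x \<in> carrier A" "h \<in> carrier Q"
      show "star R ((x \<boxtimes> h) \<bullet> t) = star R t \<bullet> star R (x \<boxtimes> h)"
        by (rule crossed_eqI[OF _ _ _ t, where s = True])
          (use xh in \<open>simp_all add: lin star_mult_crossed_pure\<close>)
    qed (use t in \<open>simp_all add: lin\<close>)
  qed
qed

lemma unital_star_subalgebra_crossed_base: "unital_star_subalgebra (crossed_base A Q) R"
proof -
  have "csubspace (crossed_base A Q)"
    unfolding crossed_base_def complex_vector.subspace_def
  proof (intro conjI ballI allI)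
    have add: "x \<boxtimes> \<one> + y \<boxtimes> \<one> = (x + y) \<boxtimes> \<one>" for x y :: 'a
      using semilin_add[OF semilin_pure_left[OF semilin_ident[of UNIV]], of x y "\<one>"] by simp
    have "0 \<boxtimes> \<one> = (0 :: ('a, 'q) tensor)"
      using scaleC_pure_left[of 0 "0::'a" "\<one>"] by simp
    then show "0 \<in> (\<lambda>x. x \<boxtimes> \<one>) ` carrier A"
      using complex_vector.subspace_0[OF alg.subspace_carrier] by force
    show "u + v \<in> (\<lambda>x. x \<boxtimes> \<one>) ` carrier A"
      if "u \<in> (\<lambda>x. x \<boxtimes> \<one>) ` carrier A" "v \<in> (\<lambda>x. x \<boxtimes> \<one>) ` carrier A" for u v
      using that by (auto simp: add complex_vector.subspace_add[OF alg.subspace_carrier])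
    show "c *\<^sub>C u \<in> (\<lambda>x. x \<boxtimes> \<one>) ` carrier A" if "u \<in> (\<lambda>x. x \<boxtimes> \<one>) ` carrier A" for c u
      using that by (auto simp: scaleC_pure_tensor lin intro!: imageI)
  qed
  moreover have "star R (x \<boxtimes> \<one>) = star A x \<boxtimes> \<one>" if "x \<in> carrier A" for x
    using that by (simp add: star_crossed_product_form star_one lin base_times)
  ultimately show ?thesis
    by (auto simp: unital_star_subalgebra_def crossed_base_def lin one_crossed base_times)
qed

end

section \<open>Functionals that separate tensors\<close>

text \<open>
  A tensor killed by \<open>\<phi>\<^sub>i \<otimes> \<psi>\<^sub>j\<close> for all members of two separating families is zero. The proof shortens
  a decomposition \<open>x \<otimes> y + \<dots>\<close> of the tensor: if \<open>\<phi>\<^sub>k(x)\<close> is not zero, the hypothesis for \<open>k\<close> expresses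
  \<open>y\<close> by the other second factors.
\<close>

lemma tensor_zeroI:
  fixes \<phi> :: "'i \<Rightarrow> 'a::complex_vector \<Rightarrow> complex" and \<psi> :: "'j \<Rightarrow> 'b::complex_vector \<Rightarrow> complex"
  assumes A: "csubspace A" and B: "csubspace B"
    and \<phi>: "\<And>i. i \<in> I \<Longrightarrow> semilin False A (\<phi> i)" and \<psi>: "\<And>j. j \<in> J \<Longrightarrow> semilin False B (\<psi> j)"
    and sep\<phi>: "\<And>x. x \<in> A \<Longrightarrow> (\<And>i. i \<in> I \<Longrightarrow> \<phi> i x = 0) \<Longrightarrow> x = 0"
    and sep\<psi>: "\<And>y. y \<in> B \<Longrightarrow> (\<And>j. j \<in> J \<Longrightarrow> \<psi> j y = 0) \<Longrightarrow> y = 0"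
    and t: "t \<in> tensor_space A B"
    and zero: "\<And>i j. i \<in> I \<Longrightarrow> j \<in> J \<Longrightarrow> tensor_lift A B (\<lambda>x y. \<phi> i x * \<psi> j y) t = 0"
  shows "t = 0"
proof -
  have claim: "(\<Sum>(x, y)\<leftarrow>xys. x \<boxtimes> y) = 0"
    if "set xys \<subseteq> A \<times> B" "\<And>i. i \<in> I \<Longrightarrow> (\<Sum>(x, y)\<leftarrow>xys. \<phi> i x *\<^sub>C y) = 0" for xys :: "('a \<times> 'b) list"
    using that
  proof (induction xys rule: length_induct)
    case (1 xys)
    show ?case
    proof (cases xys)
      case (Cons p rest)
      obtain x y where p: "p = (x, y)" by (cases p)
      have xy: "x \<in> A" "y \<in> B" and rest: "set rest \<subseteq> A \<times> B"
        using "1.prems"(1) by (auto simp: Cons p)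
      show ?thesis
      proof (cases "x = 0")
        case True
        have "x \<boxtimes> y = 0"
          using scaleC_pure_left[of 0 x y] True by simp
        moreover have "\<phi> i x = 0" if "i \<in> I" for i
          using True semilin_zero[OF \<phi>[OF that] A] by simp
        ultimately show ?thesis
          using "1.IH"[rule_format, of rest] "1.prems"(2) rest by (simp add: Cons p)
      next
        case False
        then obtain k where k: "k \<in> I" "\<phi> k x \<noteq> 0"
          using sep\<phi> xy(1) by blast
        \<comment> \<open>Subtracting multiples of \<open>x\<close> from the remaining first factors eliminates \<open>x \<boxtimes> y\<close>.\<close>
        define r where "r z = z - (\<phi> k z / \<phi> k x) *\<^sub>C x" for z
        define rest' where "rest' = map (\<lambda>(z, w). (r z, w)) rest"
        have r: "r z \<in> A" if "z \<in> A" for z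
          unfolding r_def using that xy(1) A
          by (intro complex_vector.subspace_diff complex_vector.subspace_scale)
        have elim: "(\<Sum>(z, w)\<leftarrow>rest'. b z w) = (\<Sum>(z, w)\<leftarrow>xys. b z w)"
          if b: "bisemilin False A UNIV b" for b :: "'a \<Rightarrow> 'b \<Rightarrow> 'c::complex_vector"
        proof -
          have b_r: "b (r z) w = b z w - b x ((\<phi> k z / \<phi> k x) *\<^sub>C w)" if "z \<in> A" for z w
          proof -
            have l: "semilin False A (\<lambda>z. b z w)" and r': "semilin False UNIV (b x)"
              using b xy(1) by (simp_all add: bisemilin_def)
            have "b (r z) w + b ((\<phi> k z / \<phi> k x) *\<^sub>C x) w = b z w"
              using semilin_add[OF l r[OF that], of "(\<phi> k z / \<phi> k x) *\<^sub>C x"] xy(1) A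
              by (simp add: complex_vector.subspace_scale r_def)
            moreover have "b ((\<phi> k z / \<phi> k x) *\<^sub>C x) w = b x ((\<phi> k z / \<phi> k x) *\<^sub>C w)"
              using semilin_scale[OF l xy(1)] semilin_scale[OF r'] by simp
            ultimately show ?thesis by (simp add: algebra_simps)
          qed
          have bx: "semilin False UNIV (b x)"
            using b xy(1) by (simp add: bisemilin_def)
          have "(\<Sum>(z, w)\<leftarrow>rest'. b z w)
              = (\<Sum>(z, w)\<leftarrow>rest. b z w) - (\<Sum>(z, w)\<leftarrow>rest. b x ((\<phi> k z / \<phi> k x) *\<^sub>C w))"
            using rest unfolding rest'_def by (induction rest) (auto simp: b_r algebra_simps)
          also have "(\<Sum>(z, w)\<leftarrow>rest. b x ((\<phi> k z / \<phi> k x) *\<^sub>C w))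
              = b x (\<Sum>(z, w)\<leftarrow>rest. (\<phi> k z / \<phi> k x) *\<^sub>C w)"
            by (rule semilin_sum_pairs(1)[OF bx, symmetric]) simp_all
          also have "(\<Sum>(z, w)\<leftarrow>rest. (\<phi> k z / \<phi> k x) *\<^sub>C w)
              = (1 / \<phi> k x) *\<^sub>C (\<Sum>(z, w)\<leftarrow>rest. \<phi> k z *\<^sub>C w)"
            by (induction rest) (auto simp: complex_vector.scale_right_distrib scaleC_scaleC)
          also have "(\<Sum>(z, w)\<leftarrow>rest. \<phi> k z *\<^sub>C w) = - (\<phi> k x *\<^sub>C y)"
            using "1.prems"(2)[OF k(1)] by (simp add: Cons p add_eq_0_iff)
          also have "(1 / \<phi> k x) *\<^sub>C - (\<phi> k x *\<^sub>C y) = - y"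
            using k(2) by (simp add: scaleC_scaleC scaleC_one)
          also have "b x (- y) = - b x y"
            using semilin_scale[OF bx, of y "-1"] by (simp add: scaleC_one)
          finally show ?thesis by (simp add: Cons p)
        qed
        have "(\<Sum>(x, y)\<leftarrow>rest'. \<phi> i x *\<^sub>C y) = 0" if "i \<in> I" for i
          using "1.prems"(2)[OF that] \<phi>[OF that]
          by (subst elim) (auto intro!: bisemilinI semilin_scaleC_left semilin_scaleC_right semilin_ident)
        moreover have "set rest' \<subseteq> A \<times> B" "length rest' < length xys"
          using rest r by (auto simp: rest'_def Cons)
        ultimately have "(\<Sum>(x, y)\<leftarrow>rest'. x \<boxtimes> y) = 0"
          using "1.IH" by blast
        then show ?thesis
          by (subst (asm) elim[OF pure_tensor_bisemilin])
      qed
    qed simp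
  qed
  obtain xys where xys: "set xys \<subseteq> A \<times> B" "t = (\<Sum>(x, y)\<leftarrow>xys. x \<boxtimes> y)"
    using tensor_space_decomposition[OF A t] .
  have "(\<Sum>(x, y)\<leftarrow>xys. \<phi> i x *\<^sub>C y) = 0" if i: "i \<in> I" for i
  proof (rule sep\<psi>)
    have mem: "\<phi> i x *\<^sub>C y \<in> B" if "(x, y) \<in> set xys" for x y
      using that xys(1) B by (auto simp: complex_vector.subspace_scale)
    show "(\<Sum>(x, y)\<leftarrow>xys. \<phi> i x *\<^sub>C y) \<in> B"
      by (rule semilin_sum_pairs(2)[OF semilin_ident B mem])
    fix j assume j: "j \<in> J"
    have bil: "bisemilin False A B (\<lambda>x y. \<phi> i x * \<psi> j y)"
      using \<phi>[OF i] \<psi>[OF j]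
      by (intro bisemilinI semilin_times_left semilin_times_right)
    have "\<psi> j (\<Sum>(x, y)\<leftarrow>xys. \<phi> i x *\<^sub>C y) = (\<Sum>(x, y)\<leftarrow>xys. \<psi> j (\<phi> i x *\<^sub>C y))"
      by (rule semilin_sum_pairs(1)[OF \<psi>[OF j] B mem])
    also have "map (\<lambda>(x, y). \<psi> j (\<phi> i x *\<^sub>C y)) xys = map (\<lambda>(x, y). \<phi> i x * \<psi> j y) xys"
      using xys(1) semilin_scale[OF \<psi>[OF j]] by (auto simp: scaleC_complex_def)
    also have "(\<Sum>(x, y)\<leftarrow>xys. \<phi> i x * \<psi> j y) = 0"
      using zero[OF i j] tensor_lift_sum_semilin[OF A B bil xys(1)] xys(2) by simp
    finally show "\<psi> j (\<Sum>(x, y)\<leftarrow>xys. \<phi> i x *\<^sub>C y) = 0" .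
  qed
  then show ?thesis
    using claim[OF xys(1)] xys(2) by simp
qed

lemma semilin_diff:
  assumes "semilin s A f" "csubspace A" "x \<in> A" "y \<in> A"
  shows "f (x - y) = f x - f y"
  using semilin_add[OF assms(1), of "x - y" y] assms by (simp add: complex_vector.subspace_diff)

lemma tensor_eqI:
  fixes \<phi> :: "'i \<Rightarrow> 'a::complex_vector \<Rightarrow> complex" and \<psi> :: "'j \<Rightarrow> 'b::complex_vector \<Rightarrow> complex"
  assumes A: "csubspace A" and B: "csubspace B"
    and \<phi>: "\<And>i. i \<in> I \<Longrightarrow> semilin False A (\<phi> i)" and \<psi>: "\<And>j. j \<in> J \<Longrightarrow> semilin False B (\<psi> j)"
    and sep\<phi>: "\<And>x. x \<in> A \<Longrightarrow> (\<And>i. i \<in> I \<Longrightarrow> \<phi> i x = 0) \<Longrightarrow> x = 0"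
    and sep\<psi>: "\<And>y. y \<in> B \<Longrightarrow> (\<And>j. j \<in> J \<Longrightarrow> \<psi> j y = 0) \<Longrightarrow> y = 0"
    and t: "t \<in> tensor_space A B" and t': "t' \<in> tensor_space A B"
    and eq: "\<And>i j. i \<in> I \<Longrightarrow> j \<in> J \<Longrightarrow>
      tensor_lift A B (\<lambda>x y. \<phi> i x * \<psi> j y) t = tensor_lift A B (\<lambda>x y. \<phi> i x * \<psi> j y) t'"
  shows "t = t'"
proof -
  have "t - t' = 0"
  proof (rule tensor_zeroI[OF A B \<phi> \<psi> sep\<phi> sep\<psi>])
    show "t - t' \<in> tensor_space A B"
      using t t' by (simp add: subspace_tensor_space complex_vector.subspace_diff)
    fix i j assume ij: "i \<in> I" "j \<in> J"
    have "bisemilin False A B (\<lambda>x y. \<phi> i x * \<psi> j y)"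
      using \<phi>[OF ij(1)] \<psi>[OF ij(2)] by (intro bisemilinI semilin_times_left semilin_times_right)
    then show "tensor_lift A B (\<lambda>x y. \<phi> i x * \<psi> j y) (t - t') = 0"
      using semilin_diff[OF semilin_tensor_lift[OF A B] subspace_tensor_space t t'] eq[OF ij]
      by (metis right_minus_eq)
  qed
  then show ?thesis by simp
qed

section \<open>Multiplication in tensor products of algebras\<close>

lemma mult_tensor_alg_facts:
  assumes "star_algebra A" "star_algebra B"
  shows mult_tensor_alg_pure:
      "\<And>a b c d. a \<in> carrier A \<Longrightarrow> b \<in> carrier B \<Longrightarrow> c \<in> carrier A \<Longrightarrow> d \<in> carrier B \<Longrightarrow>
        (a \<boxtimes> b) \<otimes>\<^bsub>tensor_alg A B\<^esub> (c \<boxtimes> d) = (a \<otimes>\<^bsub>A\<^esub> c) \<boxtimes> (b \<otimes>\<^bsub>B\<^esub> d)"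
    and mult_tensor_alg_bisemilin:
      "bisemilin False (tensor_space (carrier A) (carrier B)) (tensor_space (carrier A) (carrier B))
        (mult (tensor_alg A B))"
    and mult_tensor_alg_closed:
      "\<And>s t. s \<in> tensor_space (carrier A) (carrier B) \<Longrightarrow>
        t \<in> tensor_space (carrier A) (carrier B) \<Longrightarrow>
        s \<otimes>\<^bsub>tensor_alg A B\<^esub> t \<in> tensor_space (carrier A) (carrier B)"
proof -
  interpret A: star_algebra A by fact
  interpret B: star_algebra B by fact
  have m: "s \<otimes>\<^bsub>tensor_alg A B\<^esub> t = tensor_lift (carrier A) (carrier B) (\<lambda>a b.
      tensor_lift (carrier A) (carrier B) (\<lambda>c d. (a \<otimes>\<^bsub>A\<^esub> c) \<boxtimes> (b \<otimes>\<^bsub>B\<^esub> d)) t) s" for s t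
    by (simp add: tensor_alg_def)
  note facts = tensor_lift_quadrilinear[where m = "mult (tensor_alg A B)" and
      k = "\<lambda>a b c d. (a \<otimes>\<^bsub>A\<^esub> c) \<boxtimes> (b \<otimes>\<^bsub>B\<^esub> d)",
      OF A.subspace_carrier B.subspace_carrier A.subspace_carrier B.subspace_carrier
        subspace_tensor_space _ _ _ _ m]
  show "(a \<boxtimes> b) \<otimes>\<^bsub>tensor_alg A B\<^esub> (c \<boxtimes> d) = (a \<otimes>\<^bsub>A\<^esub> c) \<boxtimes> (b \<otimes>\<^bsub>B\<^esub> d)"
    if "a \<in> carrier A" "b \<in> carrier B" "c \<in> carrier A" "d \<in> carrier B" for a b c d
    using that by (intro facts(1)[of "carrier A" "carrier B"]) (simp_all add: lin)
  show "bisemilin False (tensor_space (carrier A) (carrier B)) (tensor_space (carrier A) (carrier B))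
      (mult (tensor_alg A B))"
    by (intro facts(2)[of "carrier A" "carrier B"]) (simp_all add: lin)
  show "s \<otimes>\<^bsub>tensor_alg A B\<^esub> t \<in> tensor_space (carrier A) (carrier B)"
    if "s \<in> tensor_space (carrier A) (carrier B)" "t \<in> tensor_space (carrier A) (carrier B)" for s t
    using that by (intro facts(3)) (simp_all add: lin)
qed

section \<open>The dual Hopf algebra\<close>

text \<open>
  Application of a functional, as a constant: it makes the linearity rules in both arguments
  usable for rewriting, where a bare application of a variable would match everything.
\<close>

definition pairing :: "('a \<Rightarrow> complex) \<Rightarrow> 'a \<Rightarrow> complex" where
  "pairing u h = u h"

lemma semilin_pairing_left [lin]: "semilin s D f \<Longrightarrow> semilin s D (\<lambda>x. pairing (f x) h)"
  by (simp add: semilin_def pairing_def scaleC_fun_def)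

locale fin_dim_hopf_star_algebra = hopf_star_algebra +
  assumes fin_dim: "\<exists>B. finite B \<and> complex_vector.span B = carrier Q"
begin

abbreviation D where "D \<equiv> dual_hopf Q"

abbreviation DD where "DD \<equiv> tensor_space (carrier D) (carrier D)"

abbreviation dual_mult (infixl \<open>\<star>\<close> 70) where "u \<star> v \<equiv> u \<otimes>\<^bsub>D\<^esub> v"

lemma carrier_dual: "u \<in> carrier D \<longleftrightarrow> semilin False (carrier Q) u \<and> (\<forall>x. x \<notin> carrier Q \<longrightarrow> u x = 0)"
  by (simp add: dual_hopf_def dual_space_def clinear_on_semilin)

lemma dual_eqI:
  assumes "u \<in> carrier D" "v \<in> carrier D" "\<And>h. h \<in> carrier Q \<Longrightarrow> pairing u h = pairing v h"
  shows "u = v"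
proof
  show "u x = v x" for x
    using assms unfolding carrier_dual pairing_def by (cases "x \<in> carrier Q") simp_all
qed

lemma restrict_zero_dual:
  assumes "semilin False (carrier Q) u"
  shows "restrict_zero (carrier Q) u \<in> carrier D"
  using assms semilin_cong[of "carrier Q" "restrict_zero (carrier Q) u" u False]
  by (simp add: carrier_dual restrict_zero_def subspace_carrier)

lemma subspace_dual [lin]: "csubspace (carrier D)"
  unfolding complex_vector.subspace_def
  by (auto simp: carrier_dual semilin_def scaleC_fun_def algebra_simps scaleC_complex_def)

lemma semilin_pairing_right [lin]:
  "u \<in> carrier D \<Longrightarrow> semilin s E f \<Longrightarrow> (\<And>x. x \<in> E \<Longrightarrow> f x \<in> carrier Q) \<Longrightarrow>
    semilin s E (\<lambda>x. pairing u (f x))"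
  unfolding pairing_def carrier_dual by (blast intro: semilin_compose')

lemma semilin_dualI:
  assumes "csubspace E" "\<And>x. x \<in> E \<Longrightarrow> f x \<in> carrier D"
    and "\<And>h. h \<in> carrier Q \<Longrightarrow> semilin s E (\<lambda>x. pairing (f x) h)"
  shows "semilin s E f"
  unfolding semilin_def
proof (intro conjI ballI allI)
  fix x y assume xy: "x \<in> E" "y \<in> E"
  show "f (x + y) = f x + f y"
  proof (rule dual_eqI)
    show "f (x + y) \<in> carrier D" "f x + f y \<in> carrier D"
      using assms(1,2) xy by (simp_all add: complex_vector.subspace_add subspace_dual)
    show "pairing (f (x + y)) h = pairing (f x + f y) h" if "h \<in> carrier Q" for h
      using semilin_add[OF assms(3)[OF that] xy] by (simp add: pairing_def)
  qed
next
  fix c x assume x: "x \<in> E"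
  show "f (c *\<^sub>C x) = cnj_if s c *\<^sub>C f x"
  proof (rule dual_eqI)
    show "f (c *\<^sub>C x) \<in> carrier D" "cnj_if s c *\<^sub>C f x \<in> carrier D"
      using assms(1,2) x by (simp_all add: complex_vector.subspace_scale subspace_dual)
    show "pairing (f (c *\<^sub>C x)) h = pairing (cnj_if s c *\<^sub>C f x) h" if "h \<in> carrier Q" for h
      using semilin_scale[OF assms(3)[OF that] x]
      by (simp add: pairing_def scaleC_fun_def)
  qed
qed

lemma pairing_scaleC: "pairing (c *\<^sub>C u) h = c * pairing u h"
  by (simp add: pairing_def scaleC_fun_def scaleC_complex_def)

lemma mult_dual_closed: "u \<in> carrier D \<Longrightarrow> v \<in> carrier D \<Longrightarrow> u \<star> v \<in> carrier D"
  using semilin_sweedler[OF _ semilin_ident, of "\<lambda>a b. pairing u a * pairing v b" "carrier Q"]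
  by (simp add: dual_hopf_def restrict_zero_dual[unfolded dual_hopf_def, simplified] lin
      flip: pairing_def[of u] pairing_def[of v])

lemma pairing_mult:
  "h \<in> carrier Q \<Longrightarrow> pairing (u \<star> v) h = sweedler Q (\<lambda>a b. pairing u a * pairing v b) h"
  by (simp add: pairing_def dual_hopf_def restrict_zero_def)

lemma one_dual_closed: "\<one>\<^bsub>D\<^esub> \<in> carrier D"
  using restrict_zero_dual[of "counit Q"] semilin_counit[OF semilin_ident, of "carrier Q"]
  by (simp add: dual_hopf_def)

lemma pairing_one: "h \<in> carrier Q \<Longrightarrow> pairing \<one>\<^bsub>D\<^esub> h = counit Q h"
  by (simp add: pairing_def dual_hopf_def restrict_zero_def)

lemma star_dual_closed: "u \<in> carrier D \<Longrightarrow> star D u \<in> carrier D"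
  using restrict_zero_dual[of "\<lambda>h. cnj (pairing u (star Q (antipode Q h)))"]
  by (simp add: lin) (simp add: dual_hopf_def pairing_def)

lemma pairing_star:
  "h \<in> carrier Q \<Longrightarrow> pairing (star D u) h = cnj (pairing u (star Q (antipode Q h)))"
  by (simp add: pairing_def dual_hopf_def restrict_zero_def)

lemma antipode_dual_closed: "u \<in> carrier D \<Longrightarrow> antipode D u \<in> carrier D"
  using restrict_zero_dual[of "\<lambda>h. pairing u (antipode Q h)"]
  by (simp add: lin) (simp add: dual_hopf_def pairing_def)

lemma pairing_antipode: "h \<in> carrier Q \<Longrightarrow> pairing (antipode D u) h = pairing u (antipode Q h)"
  by (simp add: pairing_def dual_hopf_def restrict_zero_def)

lemma counit_dual: "counit D u = pairing u \<one>"
  by (simp add: pairing_def dual_hopf_def)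

lemma monoid_dual: "monoid D"
proof
  fix u v w assume u: "u \<in> carrier D" and v: "v \<in> carrier D" and w: "w \<in> carrier D"
  show "u \<star> v \<star> w = u \<star> (v \<star> w)"
  proof (rule dual_eqI)
    fix h assume h: "h \<in> carrier Q"
    have "pairing (u \<star> v \<star> w) h
        = sweedler Q (\<lambda>a b. sweedler Q (\<lambda>c d. pairing u c * pairing v d) a * pairing w b) h"
      using h by (simp add: pairing_mult cong: sweedler_cong)
    also have "\<dots> = sweedler Q (\<lambda>a b. sweedler Q (\<lambda>c d. pairing u c * pairing v d * pairing w b) a) h"
      using u v w h
      by (intro sweedler_cong sweedler_apply_UNIV[where r = False and g = "\<lambda>x. x * pairing w _"])
        (simp_all add: lin)
    also have "\<dots> = sweedler Q (\<lambda>a b. sweedler Q (\<lambda>c d. pairing u a * pairing v c * pairing w d) b) h"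
      using u v w h by (intro sweedler_coassoc) (simp_all add: lin)
    also have "\<dots> = sweedler Q (\<lambda>a b. sweedler Q (\<lambda>c d. pairing u a * (pairing v c * pairing w d)) b) h"
      by (simp add: mult.assoc)
    also have "\<dots> = sweedler Q (\<lambda>a b. pairing u a * sweedler Q (\<lambda>c d. pairing v c * pairing w d) b) h"
      using u v w h
      by (intro sweedler_cong sweedler_apply_UNIV[symmetric, where r = False])
        (simp_all add: lin)
    also have "\<dots> = pairing (u \<star> (v \<star> w)) h"
      using h by (simp add: pairing_mult cong: sweedler_cong)
    finally show "pairing (u \<star> v \<star> w) h = pairing (u \<star> (v \<star> w)) h" .
  qed (use u v w in \<open>simp_all add: mult_dual_closed\<close>)
next
  fix u assume u: "u \<in> carrier D"
  show "\<one>\<^bsub>D\<^esub> \<star> u = u"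
  proof (rule dual_eqI)
    fix h assume h: "h \<in> carrier Q"
    show "pairing (\<one>\<^bsub>D\<^esub> \<star> u) h = pairing u h"
      using u h sweedler_counit_left[of h "pairing u"] semilin_pairing_right[OF u semilin_ident]
      by (simp add: pairing_mult pairing_one scaleC_complex_def cong: sweedler_cong)
  qed (use u in \<open>simp_all add: mult_dual_closed one_dual_closed\<close>)
  show "u \<star> \<one>\<^bsub>D\<^esub> = u"
  proof (rule dual_eqI)
    fix h assume h: "h \<in> carrier Q"
    show "pairing (u \<star> \<one>\<^bsub>D\<^esub>) h = pairing u h"
      using u h sweedler_counit_right[of h "pairing u"] semilin_pairing_right[OF u semilin_ident]
      by (simp add: pairing_mult pairing_one scaleC_complex_def mult.commute cong: sweedler_cong)
  qed (use u in \<open>simp_all add: mult_dual_closed one_dual_closed\<close>)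
qed (simp_all add: mult_dual_closed one_dual_closed)

text \<open>
  The map \<open>h \<mapsto> S(h)\<^sup>*\<close> reverses coproducts, so its transpose reverses convolution products.
\<close>

lemma star_mult_dual:
  assumes u: "u \<in> carrier D" and v: "v \<in> carrier D"
  shows "star D (u \<star> v) = star D v \<star> star D u"
proof (rule dual_eqI)
  fix h assume h: "h \<in> carrier Q"
  have "pairing (star D (u \<star> v)) h
      = cnj (sweedler Q (\<lambda>a b. pairing u a * pairing v b) (star Q (antipode Q h)))"
    using h by (simp add: pairing_star pairing_mult lin)
  also have "\<dots> = cnj (sweedler Q (\<lambda>a b. pairing u (star Q a) * pairing v (star Q b)) (antipode Q h))"
    using u v h by (subst sweedler_star[where s = False]) (simp_all add: lin)
  also have "\<dots> = sweedler Q (\<lambda>a b. cnj (pairing u (star Q a) * pairing v (star Q b))) (antipode Q h)"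
    using u v h
    by (intro sweedler_apply_gen[where s = True and r = True and C = UNIV]) (simp_all add: lin)
  also have "\<dots> = sweedler Q (\<lambda>a b. cnj (pairing u (star Q (antipode Q b)) *
      pairing v (star Q (antipode Q a)))) h"
    using u v h by (intro sweedler_antipode) (simp_all add: lin)
  also have "\<dots> = pairing (star D v \<star> star D u) h"
    using h by (simp add: pairing_mult pairing_star mult.commute cong: sweedler_cong)
  finally show "pairing (star D (u \<star> v)) h = pairing (star D v \<star> star D u) h" .
qed (use u v in \<open>simp_all add: mult_dual_closed star_dual_closed\<close>)

lemma semilin_star_dual: "semilin True (carrier D) (star D)"
proof (rule semilin_dualI)
  fix h assume h: "h \<in> carrier Q"
  have "semilin True (carrier D) (\<lambda>u. cnj (pairing u (star Q (antipode Q h))))"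
    by (simp add: lin)
  then show "semilin True (carrier D) (\<lambda>u. pairing (star D u) h)"
    using h by (simp add: pairing_star)
qed (simp_all add: star_dual_closed lin)

lemma star_algebra_dual: "star_algebra D"
proof -
  interpret D: monoid D by (rule monoid_dual)
  show ?thesis
  proof
    show "cbilinear_on (carrier D) (carrier D) (mult D)"
      unfolding cbilinear_on_bisemilin
      by (intro bisemilinI semilin_dualI) (simp_all add: lin mult_dual_closed pairing_mult)
    show "star D (u + v) = star D u + star D v" if "u \<in> carrier D" "v \<in> carrier D" for u v
      using that by (rule semilin_add[OF semilin_star_dual])
    show "star D (c *\<^sub>C u) = cnj c *\<^sub>C star D u" if "u \<in> carrier D" for c u
      using semilin_scale[OF semilin_star_dual that] by simp
    show "star D (star D u) = u" if "u \<in> carrier D" for u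
      using that
      by (intro dual_eqI) (simp_all add: star_dual_closed pairing_star lin antipode_star_involution)
  qed (simp_all add: lin star_dual_closed star_mult_dual)
qed

text \<open>
  For a basis \<open>B\<close> with dual basis \<open>e\<close>, the tensor is \<open>\<Sum>b\<in>B. e b \<otimes> \<beta>(b, -)\<close>.
\<close>

lemma dual_tensor_of_form:
  assumes \<beta>: "bisemilin False (carrier Q) (carrier Q) \<beta>"
  obtains t where "t \<in> DD"
    "\<And>h g. h \<in> carrier Q \<Longrightarrow> g \<in> carrier Q \<Longrightarrow>
      tensor_lift (carrier D) (carrier D) (\<lambda>v w. pairing v h * pairing w g) t = \<beta> h g"
proof -
  obtain B\<^sub>0 where B\<^sub>0: "finite B\<^sub>0" "complex_vector.span B\<^sub>0 = carrier Q"
    using fin_dim by blast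
  obtain B where B: "B \<subseteq> B\<^sub>0" "complex_vector.independent B" "B\<^sub>0 \<subseteq> complex_vector.span B"
    using complex_vector.maximal_independent_subset[of B\<^sub>0] by blast
  have span: "complex_vector.span B = carrier Q"
    using B(1,3) B\<^sub>0(2) complex_vector.span_mono complex_vector.span_minimal
      complex_vector.subspace_span by (metis subset_antisym)
  have finB: "finite B" and BQ: "\<And>b. b \<in> B \<Longrightarrow> b \<in> carrier Q"
    using B(1) B\<^sub>0(1) finite_subset span complex_vector.span_base by (blast, metis)
  define e where "e b = restrict_zero (carrier Q) (\<lambda>h. complex_vector.representation B h b)" for b
  define w where "w b = restrict_zero (carrier Q) (\<beta> b)" for b
  have rep: "semilin False (carrier Q) (\<lambda>h. complex_vector.representation B h b)" for b
    by (simp add: semilin_def complex_vector.representation_add[OF B(2)] span scaleC_complex_def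
        complex_vector.representation_scale[OF B(2)])
  have e: "e b \<in> carrier D" for b
    unfolding e_def by (rule restrict_zero_dual[OF rep])
  have w: "w b \<in> carrier D" if "b \<in> B" for b
    unfolding w_def using bisemilinD(2)[OF \<beta> BQ[OF that]] by (rule restrict_zero_dual)
  let ?T = "DD"
  define t where "t = (\<Sum>b\<in>B. e b \<boxtimes> w b)"
  have t: "t \<in> ?T"
    unfolding t_def using e w by (intro complex_vector.subspace_sum) (simp_all add: lin)
  moreover have "tensor_lift (carrier D) (carrier D) (\<lambda>v w. pairing v h * pairing w g) t = \<beta> h g"
    if h: "h \<in> carrier Q" and g: "g \<in> carrier Q" for h g
  proof -
    let ?E = "tensor_lift (carrier D) (carrier D) (\<lambda>v w. pairing v h * pairing w g)"
    have bil: "bisemilin False (carrier D) (carrier D) (\<lambda>v w. pairing v h * pairing w g)"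
      by (simp add: lin)
    have E: "semilin False ?T ?E"
      by (intro semilin_tensor_lift bil) (simp_all add: lin)
    have sum: "f (\<Sum>b\<in>C. x b) = (\<Sum>b\<in>C. f (x b)) \<and> (\<Sum>b\<in>C. x b) \<in> V"
      if "finite C" "semilin False V f" "csubspace V" "\<And>b. b \<in> C \<Longrightarrow> x b \<in> V"
      for V f x and C :: "'a set"
      using that(1,4)
      by (induction C) (simp_all add: semilin_zero[OF that(2,3)] semilin_add[OF that(2)]
          that(3) complex_vector.subspace_0 complex_vector.subspace_add)
    have "?E t = (\<Sum>b\<in>B. ?E (e b \<boxtimes> w b))"
      unfolding t_def using sum[OF finB E] e w by (simp add: lin)
    also have "\<dots> = (\<Sum>b\<in>B. complex_vector.representation B h b * \<beta> b g)"
      using e w h g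
      by (intro sum.cong refl)
        (simp add: tensor_lift_pure_semilin[OF _ _ bil] lin,
          simp add: pairing_def e_def w_def restrict_zero_def)
    also have "\<dots> = (\<Sum>b\<in>B. \<beta> (complex_vector.representation B h b *\<^sub>C b) g)"
      using semilin_scale[OF bisemilinD(1)[OF \<beta> g]] BQ
      by (intro sum.cong refl) (simp add: scaleC_complex_def)
    also have "\<dots> = \<beta> (\<Sum>b\<in>B. complex_vector.representation B h b *\<^sub>C b) g"
      using sum[OF finB bisemilinD(1)[OF \<beta> g] subspace_carrier,
          of "\<lambda>b. complex_vector.representation B h b *\<^sub>C b"] BQ by (simp add: lin)
    also have "(\<Sum>b\<in>B. complex_vector.representation B h b *\<^sub>C b) = h"
      using h span by (intro complex_vector.sum_representation_eq B(2) finB) auto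
    finally show ?thesis .
  qed
  ultimately show ?thesis
    using that by blast
qed

definition tensor_eval :: "'a \<Rightarrow> 'a \<Rightarrow> ('a \<Rightarrow> complex, 'a \<Rightarrow> complex) tensor \<Rightarrow> complex" where
  "tensor_eval h g = tensor_lift (carrier D) (carrier D) (\<lambda>v w. pairing v h * pairing w g)"

lemma tensor_eval_pure:
  "v \<in> carrier D \<Longrightarrow> w \<in> carrier D \<Longrightarrow> tensor_eval h g (v \<boxtimes> w) = pairing v h * pairing w g"
  unfolding tensor_eval_def by (intro tensor_lift_pure_semilin[where s = False]) (simp_all add: lin)

lemma semilin_tensor_eval_carrier:
  "semilin False (DD) (tensor_eval h g)"
  unfolding tensor_eval_def by (intro semilin_tensor_lift) (simp_all add: lin)

lemma semilin_tensor_eval [lin]: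
  assumes "semilin s E f" "\<And>x. x \<in> E \<Longrightarrow> f x \<in> DD"
  shows "semilin s E (\<lambda>x. tensor_eval h g (f x))"
  by (rule semilin_compose'[OF semilin_tensor_eval_carrier assms])

lemma semilin_tensor_eval_left [lin]:
  assumes "semilin s E f" "\<And>x. x \<in> E \<Longrightarrow> f x \<in> carrier Q" "csubspace E"
    "t \<in> DD"
  shows "semilin s E (\<lambda>x. tensor_eval (f x) g t)"
  unfolding tensor_eval_def using assms
  by (intro semilin_tensor_lift_param[where r = False]) (simp_all add: lin)

lemma semilin_tensor_eval_right [lin]:
  assumes "semilin s E f" "\<And>x. x \<in> E \<Longrightarrow> f x \<in> carrier Q" "csubspace E"
    "t \<in> DD"
  shows "semilin s E (\<lambda>x. tensor_eval h (f x) t)"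
  unfolding tensor_eval_def using assms
  by (intro semilin_tensor_lift_param[where r = False]) (simp_all add: lin)

lemma dual_zeroI:
  "u \<in> carrier D \<Longrightarrow> (\<And>h. h \<in> carrier Q \<Longrightarrow> pairing u h = 0) \<Longrightarrow> u = 0"
  using dual_eqI[of u 0] complex_vector.subspace_0[OF subspace_dual] by (simp add: pairing_def)

lemma tensor_eval_eqI:
  assumes "t \<in> DD" "t' \<in> DD"
    and "\<And>h g. h \<in> carrier Q \<Longrightarrow> g \<in> carrier Q \<Longrightarrow> tensor_eval h g t = tensor_eval h g t'"
  shows "t = t'"
  by (rule tensor_eqI[where I = "carrier Q" and J = "carrier Q"
        and \<phi> = "\<lambda>h u. pairing u h" and \<psi> = "\<lambda>h u. pairing u h"
        and A = "carrier D" and B = "carrier D"])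
    (use assms in \<open>simp_all add: lin dual_zeroI flip: tensor_eval_def\<close>)

text \<open>
  The coproduct of \<open>u\<close> is defined by a description. A tensor satisfying it exists by
  \<open>dual_tensor_of_form\<close> for the form \<open>(h, g) \<mapsto> u(h g)\<close>, and it is unique because evaluations
  separate tensors.
\<close>

lemma comult_dual_facts:
  assumes u: "u \<in> carrier D"
  shows comult_dual_closed: "comult D u \<in> DD"
    and tensor_eval_comult: "\<And>h g. h \<in> carrier Q \<Longrightarrow> g \<in> carrier Q \<Longrightarrow>
      tensor_eval h g (comult D u) = pairing u (h \<otimes> g)"
proof -
  let ?P = "\<lambda>t. t \<in> DD \<and>
    (\<forall>h\<in>carrier Q. \<forall>g\<in>carrier Q. tensor_eval h g t = pairing u (h \<otimes> g))"
  have "bisemilin False (carrier Q) (carrier Q) (\<lambda>h g. pairing u (h \<otimes> g))"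
    using u by (simp add: lin)
  then obtain t where t: "?P t"
    using dual_tensor_of_form unfolding tensor_eval_def by metis
  have "comult D u = (THE t. ?P t)"
    by (simp add: dual_hopf_def pairing_def tensor_eval_def)
  moreover have "?P (THE t. ?P t)"
    by (rule theI[of ?P t]) (use t in \<open>auto intro!: tensor_eval_eqI\<close>)
  ultimately have "?P (comult D u)" by simp
  then show "comult D u \<in> DD"
    and "\<And>h g. h \<in> carrier Q \<Longrightarrow> g \<in> carrier Q \<Longrightarrow> tensor_eval h g (comult D u) = pairing u (h \<otimes> g)"
    by blast+
qed

lemma semilin_comult_dual: "semilin False (carrier D) (comult D)"
  unfolding semilin_def
proof (intro conjI ballI allI)
  note [simp] = tensor_eval_comult comult_dual_closed
  fix u v assume uv: "u \<in> carrier D" "v \<in> carrier D"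
  then show "comult D (u + v) = comult D u + comult D v"
    by (intro tensor_eval_eqI)
      (simp_all add: complex_vector.subspace_add lin semilin_add[OF semilin_tensor_eval_carrier],
        simp add: pairing_def)
next
  note [simp] = tensor_eval_comult comult_dual_closed
  fix c u assume u: "u \<in> carrier D"
  then show "comult D (c *\<^sub>C u) = cnj_if False c *\<^sub>C comult D u"
    by (intro tensor_eval_eqI)
      (simp_all add: lin semilin_scale[OF semilin_tensor_eval_carrier] scaleC_complex_def
        pairing_scaleC)
qed

end

sublocale fin_dim_hopf_star_algebra \<subseteq> dual: star_algebra "dual_hopf Q"
  by (rule star_algebra_dual)

sublocale fin_dim_hopf_star_algebra \<subseteq> dual: star_algebra_with_comult "dual_hopf Q"
  by unfold_locales (simp_all add: comult_dual_closed semilin_comult_dual)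

context fin_dim_hopf_star_algebra
begin

lemma sweedler_dual_pairing:
  "u \<in> carrier D \<Longrightarrow> h \<in> carrier Q \<Longrightarrow> g \<in> carrier Q \<Longrightarrow>
    sweedler D (\<lambda>v w. pairing v h * pairing w g) u = pairing u (h \<otimes> g)"
  using tensor_eval_comult by (simp add: sweedler_def tensor_eval_def)

lemma semilin_antipode_dual_carrier: "semilin False (carrier D) (antipode D)"
  by (rule semilin_dualI) (simp_all add: lin antipode_dual_closed pairing_antipode)

lemma semilin_antipode_dual [lin]:
  "semilin s E f \<Longrightarrow> (\<And>x. x \<in> E \<Longrightarrow> f x \<in> carrier D) \<Longrightarrow> semilin s E (\<lambda>x. antipode D (f x))"
  by (rule semilin_compose'[OF semilin_antipode_dual_carrier])

lemmas [lin] = antipode_dual_closed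

text \<open>
  Evaluation at \<open>(h, g)\<close> turns the product of tensors into convolution over \<open>h\<close> and \<open>g\<close>; with
  \<open>\<Delta>(h g) = \<Delta>(h) \<Delta>(g)\<close> this makes the dual coproduct multiplicative.
\<close>

lemma tensor_eval_mult:
  assumes s: "s \<in> DD" and t: "t \<in> DD"
    and h: "h \<in> carrier Q" and g: "g \<in> carrier Q"
  shows "tensor_eval h g (s \<otimes>\<^bsub>tensor_alg D D\<^esub> t)
    = sweedler Q (\<lambda>a b. sweedler Q (\<lambda>c d. tensor_eval a c s * tensor_eval b d t) g) h"
proof -
  let ?T = "DD"
  note D = dual.star_algebra_axioms
  have [lin]: "semilin False ?T (\<lambda>t. s \<otimes>\<^bsub>tensor_alg D D\<^esub> t)" if "s \<in> ?T" for s
    by (rule bisemilinD(2)[OF mult_tensor_alg_bisemilin[OF D D] that])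
  have [lin]: "semilin False ?T (\<lambda>s. s \<otimes>\<^bsub>tensor_alg D D\<^esub> t)" if "t \<in> ?T" for t
    by (rule bisemilinD(1)[OF mult_tensor_alg_bisemilin[OF D D] that])
  note [lin] = mult_tensor_alg_closed[OF D D]
  show ?thesis
  proof (rule tensor_space_eqI[OF subspace_dual _ _ _ s, where s = False])
    fix u v assume uv: "u \<in> carrier D" "v \<in> carrier D"
    show "tensor_eval h g ((u \<boxtimes> v) \<otimes>\<^bsub>tensor_alg D D\<^esub> t)
      = sweedler Q (\<lambda>a b. sweedler Q (\<lambda>c d. tensor_eval a c (u \<boxtimes> v) * tensor_eval b d t) g) h"
    proof (rule tensor_space_eqI[OF subspace_dual _ _ _ t, where s = False])
      fix x y assume xy: "x \<in> carrier D" "y \<in> carrier D"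
      have "tensor_eval h g ((u \<boxtimes> v) \<otimes>\<^bsub>tensor_alg D D\<^esub> (x \<boxtimes> y))
          = sweedler Q (\<lambda>a b. pairing u a * pairing x b) h *
            sweedler Q (\<lambda>c d. pairing v c * pairing y d) g"
        using uv xy h g by (simp add: mult_tensor_alg_pure[OF D D] tensor_eval_pure pairing_mult lin)
      also have "\<dots> = sweedler Q (\<lambda>a b. pairing u a * pairing x b *
            sweedler Q (\<lambda>c d. pairing v c * pairing y d) g) h"
        using uv xy h g by (intro sweedler_apply_UNIV[where r = False and g = "\<lambda>x. x * _"])
          (simp_all add: lin)
      also have "\<dots> = sweedler Q (\<lambda>a b.
            sweedler Q (\<lambda>c d. pairing u a * pairing x b * (pairing v c * pairing y d)) g) h"
        using uv xy h g by (intro sweedler_cong sweedler_apply_UNIV[where r = False])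
          (simp_all add: lin)
      also have "\<dots> = sweedler Q (\<lambda>a b.
            sweedler Q (\<lambda>c d. tensor_eval a c (u \<boxtimes> v) * tensor_eval b d (x \<boxtimes> y)) g) h"
        using uv xy h g by (intro sweedler_cong) (simp_all add: tensor_eval_pure)
      finally show "tensor_eval h g ((u \<boxtimes> v) \<otimes>\<^bsub>tensor_alg D D\<^esub> (x \<boxtimes> y)) = \<dots>" .
    qed (use uv h g in \<open>simp_all add: lin\<close>)
  qed (use t h g in \<open>simp_all add: lin\<close>)
qed

text \<open>
  Together with \<open>S(h g)\<^sup>* = S(h)\<^sup>* S(g)\<^sup>*\<close> this makes the dual coproduct compatible with involutions.
\<close>

lemma tensor_eval_star:
  assumes t: "t \<in> DD" and h: "h \<in> carrier Q" and g: "g \<in> carrier Q"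
  shows "tensor_eval h g (star (tensor_alg D D) t)
    = cnj (tensor_eval (star Q (antipode Q h)) (star Q (antipode Q g)) t)"
proof -
  let ?st = "tensor_lift (carrier D) (carrier D) (\<lambda>a b. star D a \<boxtimes> star D b)"
  have bil: "bisemilin True (carrier D) (carrier D) (\<lambda>a b. star D a \<boxtimes> star D b)"
    by (simp add: lin)
  have [lin]: "semilin True (DD) ?st"
    by (intro semilin_tensor_lift bil) (simp_all add: lin)
  have [lin]: "?st t \<in> DD"
    if "t \<in> DD" for t
    using that by (intro tensor_lift_apply(2)[OF _ _ bil _ _ _ semilin_ident]) (simp_all add: lin)
  have "tensor_eval h g (?st t) = cnj (tensor_eval (star Q (antipode Q h)) (star Q (antipode Q g)) t)"
    by (rule tensor_space_eqI[OF subspace_dual _ _ _ t, where s = True])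
      (use h g in \<open>simp_all add: lin tensor_eval_pure pairing_star
        tensor_lift_pure_semilin[OF _ _ bil]\<close>)
  then show ?thesis
    by (simp add: tensor_alg_def)
qed

lemma comult_dual_hom: "comult D \<in> star_hom D (tensor_alg D D)"
proof -
  note D = dual.star_algebra_axioms
  note [simp] = tensor_eval_comult
  have "comult D (u \<star> v) = comult D u \<otimes>\<^bsub>tensor_alg D D\<^esub> comult D v"
    if uv: "u \<in> carrier D" "v \<in> carrier D" for u v
  proof (rule tensor_eval_eqI)
    fix h g assume hg: "h \<in> carrier Q" "g \<in> carrier Q"
    have "tensor_eval h g (comult D (u \<star> v))
        = sweedler Q (\<lambda>a b. pairing u a * pairing v b) (h \<otimes> g)"
      using uv hg by (simp add: pairing_mult lin)
    also have "\<dots> = sweedler Q (\<lambda>a b. sweedler Q (\<lambda>c d. pairing u (a \<otimes> c) * pairing v (b \<otimes> d)) g) h"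
      using uv hg by (intro sweedler_mult) (simp_all add: lin)
    also have "\<dots> = sweedler Q (\<lambda>a b. sweedler Q (\<lambda>c d.
        tensor_eval a c (comult D u) * tensor_eval b d (comult D v)) g) h"
      using uv hg by (intro sweedler_cong) simp_all
    also have "\<dots> = tensor_eval h g (comult D u \<otimes>\<^bsub>tensor_alg D D\<^esub> comult D v)"
      using uv hg by (simp add: tensor_eval_mult lin)
    finally show "tensor_eval h g (comult D (u \<star> v))
      = tensor_eval h g (comult D u \<otimes>\<^bsub>tensor_alg D D\<^esub> comult D v)" .
  qed (use uv in \<open>simp_all add: lin mult_tensor_alg_closed[OF D D]\<close>)
  moreover have "comult D \<one>\<^bsub>D\<^esub> = \<one>\<^bsub>D\<^esub> \<boxtimes> \<one>\<^bsub>D\<^esub>"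
    by (rule tensor_eval_eqI) (simp_all add: lin tensor_eval_pure pairing_one counit_mult)
  moreover have "comult D (star D u) = star (tensor_alg D D) (comult D u)" if u: "u \<in> carrier D" for u
  proof (rule tensor_eval_eqI)
    show "star (tensor_alg D D) (comult D u) \<in> DD"
      using u by (simp add: tensor_alg_def,
        intro tensor_lift_apply(2)[where s = True and r = False and g = "\<lambda>x. x"]) (simp_all add: lin)
  qed (use u in \<open>simp_all add: lin tensor_eval_star pairing_star antipode_mult star_mult\<close>)
  ultimately show ?thesis
    by (simp add: star_hom_def clinear_on_semilin dual.semilin_comult lin)
      (simp add: tensor_alg_def lin)
qed

text \<open>
  Evaluated at three elements \<open>h, g, k\<close>, the two sides are \<open>u((h g) k)\<close> and \<open>u(h (g k))\<close>.
\<close>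

lemma dual_coassoc:
  assumes u: "u \<in> carrier D"
  shows "sweedler D (\<lambda>a b. sweedler D (\<lambda>a\<^sub>1 a\<^sub>2. a\<^sub>1 \<boxtimes> (a\<^sub>2 \<boxtimes> b)) a) u
    = sweedler D (\<lambda>a b. a \<boxtimes> comult D b) u"
proof -
  let ?T = "DD"
  note [lin] = dual.semilin_comult
  show ?thesis
  proof (rule tensor_eqI[where I = "carrier Q" and J = "carrier Q \<times> carrier Q"
        and \<phi> = "\<lambda>h u. pairing u h" and \<psi> = "\<lambda>(h, g). tensor_eval h g" and A = "carrier D" and B = ?T])
    show "t = 0" if "t \<in> ?T" "\<And>j. j \<in> carrier Q \<times> carrier Q \<Longrightarrow> (case j of (h, g) \<Rightarrow> tensor_eval h g) t = 0" for t
      using that tensor_eval_eqI[of t 0] complex_vector.subspace_0[OF subspace_tensor_space]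
        semilin_zero[OF semilin_tensor_eval_carrier subspace_tensor_space] by fastforce
    fix h j assume h: "h \<in> carrier Q" and j: "j \<in> carrier Q \<times> carrier Q"
    obtain g k where j_eq: "j = (g, k)" by (cases j)
    then have g: "g \<in> carrier Q" and k: "k \<in> carrier Q"
      using j by simp_all
    let ?L = "tensor_lift (carrier D) ?T (\<lambda>x t. pairing x h * tensor_eval g k t)"
    have bil: "bisemilin False (carrier D) ?T (\<lambda>x t. pairing x h * tensor_eval g k t)"
      using g k by (simp add: lin)
    have L: "semilin False (tensor_space (carrier D) ?T) ?L"
      by (intro semilin_tensor_lift bil) (simp_all add: lin)
    have L_pure: "?L (x \<boxtimes> t) = pairing x h * tensor_eval g k t" if "x \<in> carrier D" "t \<in> ?T" for x t
      using that by (intro tensor_lift_pure_semilin[OF _ _ bil]) (simp_all add: lin)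
    have "?L (sweedler D (\<lambda>a b. sweedler D (\<lambda>a\<^sub>1 a\<^sub>2. a\<^sub>1 \<boxtimes> (a\<^sub>2 \<boxtimes> b)) a) u)
        = sweedler D (\<lambda>a b. ?L (sweedler D (\<lambda>a\<^sub>1 a\<^sub>2. a\<^sub>1 \<boxtimes> (a\<^sub>2 \<boxtimes> b)) a)) u"
      using u by (intro dual.sweedler_apply[OF _ _ _ _ L]) (simp_all add: lin)
    also have "\<dots> = sweedler D (\<lambda>a b. sweedler D (\<lambda>a\<^sub>1 a\<^sub>2. ?L (a\<^sub>1 \<boxtimes> (a\<^sub>2 \<boxtimes> b))) a) u"
      using u by (intro dual.sweedler_cong dual.sweedler_apply[OF _ _ _ _ L]) (simp_all add: lin)
    also have "\<dots> = sweedler D (\<lambda>a b. sweedler D (\<lambda>a\<^sub>1 a\<^sub>2. pairing a\<^sub>1 h * pairing a\<^sub>2 g * pairing b k) a) u"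
      using u by (intro dual.sweedler_cong) (simp_all add: L_pure tensor_eval_pure lin)
    also have "\<dots> = sweedler D (\<lambda>a b. sweedler D (\<lambda>a\<^sub>1 a\<^sub>2. pairing a\<^sub>1 h * pairing a\<^sub>2 g) a * pairing b k) u"
      using u by (intro dual.sweedler_cong
          dual.sweedler_apply_UNIV[symmetric, where r = False and g = "\<lambda>x. x * _"]) (simp_all add: lin)
    also have "\<dots> = pairing u (h \<otimes> g \<otimes> k)"
      using u h g k by (simp add: sweedler_dual_pairing lin cong: dual.sweedler_cong)
    finally have 1: "?L (sweedler D (\<lambda>a b. sweedler D (\<lambda>a\<^sub>1 a\<^sub>2. a\<^sub>1 \<boxtimes> (a\<^sub>2 \<boxtimes> b)) a) u)
      = pairing u (h \<otimes> g \<otimes> k)" .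
    have "?L (sweedler D (\<lambda>a b. a \<boxtimes> comult D b) u) = sweedler D (\<lambda>a b. ?L (a \<boxtimes> comult D b)) u"
      using u by (intro dual.sweedler_apply[OF _ _ _ _ L]) (simp_all add: lin)
    also have "\<dots> = sweedler D (\<lambda>a b. pairing a h * pairing b (g \<otimes> k)) u"
      using u g k by (intro dual.sweedler_cong) (simp_all add: L_pure tensor_eval_comult lin)
    also have "\<dots> = pairing u (h \<otimes> (g \<otimes> k))"
      using u h g k by (simp add: sweedler_dual_pairing lin)
    finally show "tensor_lift (carrier D) ?T (\<lambda>x y. pairing x h * (case j of (h, g) \<Rightarrow> tensor_eval h g) y)
        (sweedler D (\<lambda>a b. sweedler D (\<lambda>a\<^sub>1 a\<^sub>2. a\<^sub>1 \<boxtimes> (a\<^sub>2 \<boxtimes> b)) a) u)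
      = tensor_lift (carrier D) ?T (\<lambda>x y. pairing x h * (case j of (h, g) \<Rightarrow> tensor_eval h g) y)
        (sweedler D (\<lambda>a b. a \<boxtimes> comult D b) u)"
      using 1 h g k by (simp add: j_eq m_assoc)
  qed (use u in \<open>auto simp: lin dual_zeroI semilin_tensor_eval_carrier\<close>)
qed

text \<open>
  The product after the coproduct in the dual is the transpose of the product after the coproduct in
  \<open>Q\<close>, also with the transposed maps \<open>F\<close> of \<open>f\<close> and \<open>G\<close> of \<open>g\<close> inserted. Taking the antipode for one of
  them transposes the antipode law.
\<close>

lemma pairing_sweedler_dual_mult:
  assumes u: "u \<in> carrier D" and h: "h \<in> carrier Q"
    and F: "semilin False (carrier D) F" "\<And>v. v \<in> carrier D \<Longrightarrow> F v \<in> carrier D"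
      "\<And>v x. v \<in> carrier D \<Longrightarrow> x \<in> carrier Q \<Longrightarrow> pairing (F v) x = pairing v (f x)"
    and G: "semilin False (carrier D) G" "\<And>v. v \<in> carrier D \<Longrightarrow> G v \<in> carrier D"
      "\<And>v x. v \<in> carrier D \<Longrightarrow> x \<in> carrier Q \<Longrightarrow> pairing (G v) x = pairing v (g x)"
    and f: "semilin False (carrier Q) f" "\<And>x. x \<in> carrier Q \<Longrightarrow> f x \<in> carrier Q"
    and g: "semilin False (carrier Q) g" "\<And>x. x \<in> carrier Q \<Longrightarrow> g x \<in> carrier Q"
  shows "pairing (sweedler D (\<lambda>v w. F v \<star> G w) u) h
    = pairing u (sweedler Q (\<lambda>x y. f x \<otimes> g y) h)"
proof -
  note [lin] = F(1,2) G(1,2) f g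
  have p: "semilin False UNIV (\<lambda>v. pairing v h)"
    by (simp add: lin)
  have "pairing (sweedler D (\<lambda>v w. F v \<star> G w) u) h
      = sweedler D (\<lambda>v w. pairing (F v \<star> G w) h) u"
    using u by (intro dual.sweedler_apply_UNIV[OF _ _ p]) (simp_all add: lin)
  also have "\<dots> = sweedler D (\<lambda>v w. sweedler Q (\<lambda>x y. pairing v (f x) * pairing w (g y)) h) u"
    using h by (intro dual.sweedler_cong u) (simp add: pairing_mult F(3) G(3) cong: sweedler_cong)
  also have "\<dots> = sweedler Q (\<lambda>x y. sweedler D (\<lambda>v w. pairing v (f x) * pairing w (g y)) u) h"
    using u h by (intro sweedler_swap[OF dual.star_algebra_with_comult_axioms
          star_algebra_with_comult_axioms]) (simp_all add: lin)
  also have "\<dots> = sweedler Q (\<lambda>x y. pairing u (f x \<otimes> g y)) h"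
    using u h by (intro sweedler_cong) (simp_all add: sweedler_dual_pairing lin)
  also have "\<dots> = pairing u (sweedler Q (\<lambda>x y. f x \<otimes> g y) h)"
    using u h by (intro sweedler_apply[symmetric, OF _ _ _ _ semilin_pairing_right[OF u semilin_ident]])
      (simp_all add: lin)
  finally show ?thesis .
qed

lemma dual_antipode:
  assumes u: "u \<in> carrier D"
  shows "sweedler D (\<lambda>v w. antipode D v \<star> w) u = counit D u *\<^sub>C \<one>\<^bsub>D\<^esub>"
    and "sweedler D (\<lambda>v w. v \<star> antipode D w) u = counit D u *\<^sub>C \<one>\<^bsub>D\<^esub>"
proof -
  have scale: "pairing u (c *\<^sub>C \<one>) = c * pairing u \<one>" for c
    using semilin_scale[OF semilin_pairing_right[OF u semilin_ident], where c = c and x = \<one>]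
    by (simp add: scaleC_complex_def lin)
  note [simp] = scale counit_dual pairing_scaleC pairing_one antipode_left antipode_right
  note ant = semilin_antipode_dual_carrier pairing_antipode antipode_linear[unfolded clinear_on_semilin]
  show "sweedler D (\<lambda>v w. antipode D v \<star> w) u = counit D u *\<^sub>C \<one>\<^bsub>D\<^esub>"
  proof (rule dual_eqI)
    fix h assume h: "h \<in> carrier Q"
    show "pairing (sweedler D (\<lambda>v w. antipode D v \<star> w) u) h = pairing (counit D u *\<^sub>C \<one>\<^bsub>D\<^esub>) h"
      using u h by (subst pairing_sweedler_dual_mult[where f = "antipode Q" and g = "\<lambda>x. x"])
        (simp_all add: ant lin)
  qed (use u in \<open>simp_all add: lin\<close>)
  show "sweedler D (\<lambda>v w. v \<star> antipode D w) u = counit D u *\<^sub>C \<one>\<^bsub>D\<^esub>"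
  proof (rule dual_eqI)
    fix h assume h: "h \<in> carrier Q"
    show "pairing (sweedler D (\<lambda>v w. v \<star> antipode D w) u) h = pairing (counit D u *\<^sub>C \<one>\<^bsub>D\<^esub>) h"
      using u h by (subst pairing_sweedler_dual_mult[where f = "\<lambda>x. x" and g = "antipode Q"])
        (simp_all add: ant lin)
  qed (use u in \<open>simp_all add: lin\<close>)
qed

theorem hopf_star_algebra_dual: "hopf_star_algebra D"
proof
  have p: "semilin False UNIV (\<lambda>v. pairing v h)" for h
    by (simp add: lin)
  show "comult D \<in> star_hom D (tensor_alg D D)" by (rule comult_dual_hom)
  have counit: "counit D = (\<lambda>u. pairing u \<one>)"
    by (simp add: fun_eq_iff counit_dual)
  show "clinear_on (carrier D) (counit D)"
    unfolding clinear_on_semilin counit by (simp add: lin)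
  show "counit D (u \<star> v) = counit D u * counit D v" if "u \<in> carrier D" "v \<in> carrier D" for u v
    using that by (simp add: counit_dual pairing_mult lin sweedler_one[where s = False])
  show "counit D \<one>\<^bsub>D\<^esub> = 1"
    by (simp add: counit_dual pairing_one counit_one)
  show "clinear_on (carrier D) (antipode D)"
    by (simp add: clinear_on_semilin semilin_antipode_dual_carrier)
  fix u assume u: "u \<in> carrier D"
  show "sweedler D (\<lambda>a b. sweedler D (\<lambda>a\<^sub>1 a\<^sub>2. a\<^sub>1 \<boxtimes> (a\<^sub>2 \<boxtimes> b)) a) u = sweedler D (\<lambda>a b. a \<boxtimes> comult D b) u"
    using u by (rule dual_coassoc)
  show "antipode D u \<in> carrier D"
    using u by (simp add: lin)
  show "sweedler D (\<lambda>v w. antipode D v \<star> w) u = counit D u *\<^sub>C \<one>\<^bsub>D\<^esub>"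
    "sweedler D (\<lambda>a b. a \<star> antipode D b) u = counit D u *\<^sub>C \<one>\<^bsub>D\<^esub>"
    using u by (rule dual_antipode)+
  show "star D (antipode D (star D (antipode D u))) = u"
    using u by (intro dual_eqI)
      (simp_all add: lin pairing_star pairing_antipode antipode_star_antipode star_star)
  have apply_pairing: "pairing (sweedler D f u) h = sweedler D (\<lambda>a b. pairing (f a b) h) u"
    if "bisemilin False (carrier D) (carrier D) f" for f h
    using u that by (rule dual.sweedler_apply_UNIV[OF _ _ p])
  show "sweedler D (\<lambda>a b. counit D a *\<^sub>C b) u = u"
    using u by (intro dual_eqI)
      (simp_all add: lin counit_dual apply_pairing pairing_scaleC sweedler_dual_pairing)
  show "sweedler D (\<lambda>a b. counit D b *\<^sub>C a) u = u"
    using u by (intro dual_eqI) (simp_all add: lin counit_dual apply_pairing pairing_scaleC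
        mult.commute[of "pairing _ \<one>"] sweedler_dual_pairing)
qed

end

sublocale fin_dim_hopf_star_algebra \<subseteq> dual: hopf_star_algebra "dual_hopf Q"
  by (rule hopf_star_algebra_dual)

section \<open>The dual action\<close>

locale fin_dim_module_star_algebra = module_star_algebra Q A act + fin_dim_hopf_star_algebra Q
  for Q :: "('q::complex_vector, 'b) hopf_alg_scheme" (structure)
    and A :: "('a::complex_vector, 'c) star_alg_scheme"
    and act :: "'q \<Rightarrow> 'a \<Rightarrow> 'a"
begin

text \<open>
  The action \<open>h \<mapsto> h\<^sub>1 u(h\<^sub>2)\<close> of the dual on \<open>H\<close> itself; the dual action on the crossed product is
  \<open>id \<otimes> shift u\<close>.
\<close>

definition shift :: "('q \<Rightarrow> complex) \<Rightarrow> 'q \<Rightarrow> 'q" where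
  "shift u h = sweedler Q (\<lambda>a b. pairing u b *\<^sub>C a) h"

lemma shift_closed [lin]: "u \<in> carrier D \<Longrightarrow> h \<in> carrier Q \<Longrightarrow> shift u h \<in> carrier Q"
  by (simp add: shift_def lin)

lemma semilin_shift_left [lin]:
  "semilin s E f \<Longrightarrow> (\<And>x. x \<in> E \<Longrightarrow> f x \<in> carrier D) \<Longrightarrow> h \<in> carrier Q \<Longrightarrow>
    semilin s E (\<lambda>x. shift (f x) h)"
  by (rule semilin_left[where A = "carrier D" and B = "carrier Q"])
    (simp_all add: shift_def lin)

lemma semilin_shift_right [lin]:
  "semilin s E f \<Longrightarrow> (\<And>x. x \<in> E \<Longrightarrow> f x \<in> carrier Q) \<Longrightarrow> u \<in> carrier D \<Longrightarrow>
    semilin s E (\<lambda>x. shift u (f x))"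
  by (simp add: shift_def lin)

text \<open>
  By coassociativity, \<open>shift u\<close> is a map of left comodules: it only affects the last Sweedler factor.
\<close>

lemma sweedler_shift:
  assumes f: "bisemilin False (carrier Q) (carrier Q) f" and u: "u \<in> carrier D" and h: "h \<in> carrier Q"
  shows "sweedler Q f (shift u h) = sweedler Q (\<lambda>a b. f a (shift u b)) h"
proof -
  note [lin] = bisemilinD[OF f]
  have [lin]: "semilin s E (\<lambda>x. f (g x) b)" if "semilin s E g" "\<And>x. x \<in> E \<Longrightarrow> g x \<in> carrier Q"
    "b \<in> carrier Q" for s E b and g :: "'e::complex_vector \<Rightarrow> _"
    using that by (rule semilin_left[OF f])
  have [lin]: "semilin s E (\<lambda>x. f b (g x))" if "semilin s E g" "\<And>x. x \<in> E \<Longrightarrow> g x \<in> carrier Q"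
    "b \<in> carrier Q" for s E b and g :: "'e::complex_vector \<Rightarrow> _"
    using that by (rule semilin_right[OF f])
  note F = semilin_sweedler[OF f semilin_ident, of "carrier Q", simplified]
  have "sweedler Q f (shift u h) = sweedler Q (\<lambda>x y. sweedler Q f (pairing u y *\<^sub>C x)) h"
    unfolding shift_def using u h by (intro sweedler_apply[OF _ _ _ _ F]) (simp_all add: lin)
  also have "\<dots> = sweedler Q (\<lambda>x y. pairing u y *\<^sub>C sweedler Q f x) h"
    using u h by (intro sweedler_cong) (simp_all add: semilin_scale[OF F])
  also have "\<dots> = sweedler Q (\<lambda>x y. sweedler Q (\<lambda>a b. pairing u y *\<^sub>C f a b) x) h"
    using u h f
    by (intro sweedler_cong sweedler_apply_UNIV[where r = False and g = "\<lambda>t. _ *\<^sub>C t"]) (simp_all add: lin)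
  also have "\<dots> = sweedler Q (\<lambda>a x. sweedler Q (\<lambda>b y. pairing u y *\<^sub>C f a b) x) h"
    using u h by (intro sweedler_coassoc) (simp_all add: lin)
  also have "\<dots> = sweedler Q (\<lambda>a x. sweedler Q (\<lambda>b y. f a (pairing u y *\<^sub>C b)) x) h"
    using u h f by (intro sweedler_cong) (simp_all add: semilin_scale[OF bisemilinD(2)])
  also have "\<dots> = sweedler Q (\<lambda>a b. f a (shift u b)) h"
    unfolding shift_def using u h
    by (intro sweedler_cong sweedler_apply[symmetric, OF _ _ _ _ bisemilinD(2)[OF f]]) (simp_all add: lin)
  finally show ?thesis .
qed

lemma shift_mult:
  assumes u: "u \<in> carrier D" and v: "v \<in> carrier D" and h: "h \<in> carrier Q"
  shows "shift (u \<star> v) h = shift u (shift v h)"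
proof -
  have "shift u (shift v h) = sweedler Q (\<lambda>a b. pairing u (shift v b) *\<^sub>C a) h"
    unfolding shift_def[of u] using u v h by (intro sweedler_shift) (simp_all add: lin)
  also have "\<dots> = sweedler Q (\<lambda>a b. pairing (u \<star> v) b *\<^sub>C a) h"
  proof (intro sweedler_cong h)
    fix a b assume b: "b \<in> carrier Q"
    have "pairing u (shift v b) = sweedler Q (\<lambda>c d. pairing u (pairing v d *\<^sub>C c)) b"
      unfolding shift_def using u v b
      by (intro sweedler_apply[OF _ _ _ _ semilin_pairing_right[OF u semilin_ident]])
        (simp_all add: lin)
    also have "\<dots> = pairing (u \<star> v) b"
      using u v b semilin_scale[OF semilin_pairing_right[OF u semilin_ident]]
      by (simp add: pairing_mult scaleC_complex_def mult.commute cong: sweedler_cong)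
    finally show "pairing u (shift v b) *\<^sub>C a = pairing (u \<star> v) b *\<^sub>C a" by simp
  qed
  finally show ?thesis
    by (simp add: shift_def)
qed

lemma shift_one: "h \<in> carrier Q \<Longrightarrow> shift \<one>\<^bsub>D\<^esub> h = h"
  using counit_right by (simp add: shift_def pairing_one cong: sweedler_cong)

lemma counit_shift:
  assumes u: "u \<in> carrier D" and h: "h \<in> carrier Q"
  shows "counit Q (shift u h) = pairing u h"
proof -
  note c = semilin_counit[OF semilin_ident]
  have "counit Q (shift u h) = sweedler Q (\<lambda>a b. counit Q (pairing u b *\<^sub>C a)) h"
    unfolding shift_def using u h by (intro sweedler_apply[OF _ _ _ _ c]) (simp_all add: lin)
  also have "\<dots> = sweedler Q (\<lambda>a b. counit Q a *\<^sub>C pairing u b) h"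
    using u h by (intro sweedler_cong) (simp_all add: semilin_scale[OF c] scaleC_complex_def)
  also have "\<dots> = pairing u h"
    using u h by (intro sweedler_counit_left) (simp_all add: lin)
  finally show ?thesis .
qed

lemma shift_unit: "u \<in> carrier D \<Longrightarrow> shift u \<one> = pairing u \<one> *\<^sub>C \<one>"
  by (simp add: shift_def sweedler_one[where s = False] lin)

lemma shift_on_mult:
  assumes u: "u \<in> carrier D" and h: "h \<in> carrier Q" and g: "g \<in> carrier Q"
  shows "shift u (h \<otimes> g) = sweedler D (\<lambda>v w. shift v h \<otimes> shift w g) u"
proof -
  note swap = sweedler_swap[OF star_algebra_with_comult_axioms dual.star_algebra_with_comult_axioms]
  have "shift u (h \<otimes> g) = sweedler Q (\<lambda>a b. sweedler Q (\<lambda>c d. pairing u (b \<otimes> d) *\<^sub>C (a \<otimes> c)) g) h"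
    unfolding shift_def using u h g by (intro sweedler_mult) (simp_all add: lin)
  also have "\<dots> = sweedler Q (\<lambda>a b. sweedler Q (\<lambda>c d. sweedler D (\<lambda>v w.
      (pairing v b *\<^sub>C a) \<otimes> (pairing w d *\<^sub>C c)) u) g) h"
  proof (intro sweedler_cong h g)
    fix a b c d assume *: "a \<in> carrier Q" "b \<in> carrier Q" "c \<in> carrier Q" "d \<in> carrier Q"
    have "pairing u (b \<otimes> d) *\<^sub>C (a \<otimes> c) = sweedler D (\<lambda>v w. pairing v b * pairing w d) u *\<^sub>C (a \<otimes> c)"
      using u * by (simp add: sweedler_dual_pairing)
    also have "\<dots> = sweedler D (\<lambda>v w. (pairing v b * pairing w d) *\<^sub>C (a \<otimes> c)) u"
      using u * by (intro dual.sweedler_apply_UNIV[where r = False and g = "\<lambda>k. k *\<^sub>C _"])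
        (simp_all add: lin)
    also have "\<dots> = sweedler D (\<lambda>v w. (pairing v b *\<^sub>C a) \<otimes> (pairing w d *\<^sub>C c)) u"
      using * by (simp add: mult_scaleC lin scaleC_scaleC mult.commute)
    finally show "pairing u (b \<otimes> d) *\<^sub>C (a \<otimes> c)
      = sweedler D (\<lambda>v w. (pairing v b *\<^sub>C a) \<otimes> (pairing w d *\<^sub>C c)) u" .
  qed
  also have "\<dots> = sweedler Q (\<lambda>a b. sweedler D (\<lambda>v w. sweedler Q (\<lambda>c d.
      (pairing v b *\<^sub>C a) \<otimes> (pairing w d *\<^sub>C c)) g) u) h"
    using u h g by (intro sweedler_cong[OF h] swap) (simp_all add: lin)
  also have "\<dots> = sweedler Q (\<lambda>a b. sweedler D (\<lambda>v w. (pairing v b *\<^sub>C a) \<otimes> shift w g) u) h"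
    unfolding shift_def using u h g
    by (intro sweedler_cong[OF h] dual.sweedler_cong
        sweedler_apply[symmetric, where C = "carrier Q" and r = False]) (simp_all add: lin)
  also have "\<dots> = sweedler D (\<lambda>v w. sweedler Q (\<lambda>a b. (pairing v b *\<^sub>C a) \<otimes> shift w g) h) u"
    using u h g by (intro swap) (simp_all add: lin)
  also have "\<dots> = sweedler D (\<lambda>v w. shift v h \<otimes> shift w g) u"
    unfolding shift_def[of _ h] using u h g
    by (intro dual.sweedler_cong
        sweedler_apply[symmetric, where C = "carrier Q" and r = False and g = "\<lambda>x. x \<otimes> _"])
      (simp_all add: lin)
  finally show ?thesis .
qed

lemma star_shift:
  assumes u: "u \<in> carrier D" and h: "h \<in> carrier Q"
  shows "star Q (shift u h) = shift (star D (antipode D u)) (star Q h)"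
proof -
  have "shift (star D (antipode D u)) (star Q h)
      = sweedler Q (\<lambda>a b. cnj (pairing u (star Q b)) *\<^sub>C a) (star Q h)"
    unfolding shift_def using u h
    by (intro sweedler_cong)
      (simp_all add: lin pairing_star pairing_antipode antipode_star_antipode)
  also have "\<dots> = sweedler Q (\<lambda>a b. cnj (pairing u (star Q (star Q b))) *\<^sub>C star Q a) h"
    using u h by (intro sweedler_star[where s = False]) (simp_all add: lin)
  also have "\<dots> = sweedler Q (\<lambda>a b. star Q (pairing u b *\<^sub>C a)) h"
    using u h by (intro sweedler_cong) (simp_all add: lin star_star star_scaleC)
  also have "\<dots> = star Q (shift u h)"
    unfolding shift_def using u h
    by (intro sweedler_apply[symmetric, OF _ _ _ _ semilin_star_carrier]) (simp_all add: lin)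
  finally show ?thesis ..
qed

abbreviation dual_act where "dual_act \<equiv> dual_action A Q"

lemma dual_action_as_lift:
  "dual_act u = tensor_lift (carrier A) (carrier Q) (\<lambda>x h. x \<boxtimes> shift u h)"
  by (simp add: dual_action_def shift_def pairing_def)

lemma dual_action_pure:
  "u \<in> carrier D \<Longrightarrow> x \<in> carrier A \<Longrightarrow> h \<in> carrier Q \<Longrightarrow> dual_act u (x \<boxtimes> h) = x \<boxtimes> shift u h"
  unfolding dual_action_as_lift by (intro tensor_lift_pure_semilin[where s = False]) (simp_all add: lin)

lemma dual_action_closed [lin]: "u \<in> carrier D \<Longrightarrow> t \<in> carrier R \<Longrightarrow> dual_act u t \<in> carrier R"
  unfolding dual_action_as_lift
  by (intro tensor_lift_apply(2)[where s = False and r = False and g = "\<lambda>x. x"])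
    (simp_all add: lin carrier_crossed[symmetric])

lemma dual_action_bisemilin: "bisemilin False (carrier D) (carrier R) dual_act"
proof (rule bisemilinI)
  show "semilin False (carrier D) (\<lambda>u. dual_act u t)" if "t \<in> carrier R" for t
    unfolding dual_action_as_lift using that
    by (intro semilin_tensor_lift_param[where r = False])
      (simp_all add: lin carrier_crossed[symmetric])
  show "semilin False (carrier R) (\<lambda>t. dual_act u t)" if "u \<in> carrier D" for u
    unfolding dual_action_as_lift carrier_crossed using that
    by (intro semilin_tensor_lift) (simp_all add: lin)
qed

lemma semilin_dual_action_left [lin]:
  "semilin s E f \<Longrightarrow> (\<And>x. x \<in> E \<Longrightarrow> f x \<in> carrier D) \<Longrightarrow> t \<in> carrier R \<Longrightarrow>
    semilin s E (\<lambda>x. dual_act (f x) t)"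
  by (rule semilin_left[OF dual_action_bisemilin])

lemma semilin_dual_action_right [lin]:
  "semilin s E f \<Longrightarrow> (\<And>x. x \<in> E \<Longrightarrow> f x \<in> carrier R) \<Longrightarrow> u \<in> carrier D \<Longrightarrow>
    semilin s E (\<lambda>x. dual_act u (f x))"
  by (rule semilin_right[OF dual_action_bisemilin])

text \<open>
  In \<open>x (h\<^sub>1 \<cdot> y) \<rtimes> h\<^sub>2 g\<close> only the second factor is shifted, and there \<open>shift\<close> is compatible with products;
  as \<open>h\<^sub>1\<close> is not affected, shifting \<open>h\<close> before multiplying gives the same.
\<close>

lemma dual_action_on_mult_pure:
  assumes u: "u \<in> carrier D" and x: "x \<in> carrier A" and y: "y \<in> carrier A"
    and h: "h \<in> carrier Q" and g: "g \<in> carrier Q"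
  shows "dual_act u ((x \<boxtimes> h) \<bullet> (y \<boxtimes> g))
    = sweedler D (\<lambda>v w. dual_act v (x \<boxtimes> h) \<bullet> dual_act w (y \<boxtimes> g)) u"
proof -
  note swap = sweedler_swap[OF star_algebra_with_comult_axioms dual.star_algebra_with_comult_axioms]
  have "dual_act u ((x \<boxtimes> h) \<bullet> (y \<boxtimes> g))
      = dual_act u (sweedler Q (\<lambda>a b. (x \<otimes>\<^bsub>A\<^esub> act a y) \<boxtimes> (b \<otimes> g)) h)"
    using assms by (simp add: mult_crossed_pure)
  also have "\<dots> = sweedler Q (\<lambda>a b. dual_act u ((x \<otimes>\<^bsub>A\<^esub> act a y) \<boxtimes> (b \<otimes> g))) h"
    using assms by (intro sweedler_apply[OF _ _ _ _ bisemilinD(2)[OF dual_action_bisemilin u]])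
      (simp_all add: lin)
  also have "\<dots> = sweedler Q (\<lambda>a b. (x \<otimes>\<^bsub>A\<^esub> act a y) \<boxtimes> sweedler D (\<lambda>v w. shift v b \<otimes> shift w g) u) h"
    using assms by (intro sweedler_cong) (simp_all add: lin dual_action_pure shift_on_mult)
  also have "\<dots> = sweedler Q (\<lambda>a b. sweedler D (\<lambda>v w.
      (x \<otimes>\<^bsub>A\<^esub> act a y) \<boxtimes> (shift v b \<otimes> shift w g)) u) h"
    using assms
    by (intro sweedler_cong dual.sweedler_apply[where C = "carrier Q" and r = False]) (simp_all add: lin)
  also have "\<dots> = sweedler D (\<lambda>v w. sweedler Q (\<lambda>a b.
      (x \<otimes>\<^bsub>A\<^esub> act a y) \<boxtimes> (shift v b \<otimes> shift w g)) h) u"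
    using assms by (intro swap) (simp_all add: lin)
  also have "\<dots> = sweedler D (\<lambda>v w. dual_act v (x \<boxtimes> h) \<bullet> dual_act w (y \<boxtimes> g)) u"
  proof (intro dual.sweedler_cong u)
    fix v w assume vw: "v \<in> carrier D" "w \<in> carrier D"
    have "dual_act v (x \<boxtimes> h) \<bullet> dual_act w (y \<boxtimes> g)
        = sweedler Q (\<lambda>a b. (x \<otimes>\<^bsub>A\<^esub> act a y) \<boxtimes> (b \<otimes> shift w g)) (shift v h)"
      using assms vw by (simp add: dual_action_pure mult_crossed_pure lin)
    also have "\<dots> = sweedler Q (\<lambda>a b. (x \<otimes>\<^bsub>A\<^esub> act a y) \<boxtimes> (shift v b \<otimes> shift w g)) h"
      using assms vw by (intro sweedler_shift) (simp_all add: lin)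
    finally show "sweedler Q (\<lambda>a b. (x \<otimes>\<^bsub>A\<^esub> act a y) \<boxtimes> (shift v b \<otimes> shift w g)) h
      = dual_act v (x \<boxtimes> h) \<bullet> dual_act w (y \<boxtimes> g)" ..
  qed
  finally show ?thesis .
qed

lemma dual_action_star_pure:
  assumes u: "u \<in> carrier D" and x: "x \<in> carrier A" and h: "h \<in> carrier Q"
  shows "star R (dual_act u (x \<boxtimes> h)) = dual_act (star D (antipode D u)) (star R (x \<boxtimes> h))"
proof -
  let ?u = "star D (antipode D u)"
  have u': "?u \<in> carrier D"
    using u by (simp add: lin)
  have "star R (dual_act u (x \<boxtimes> h))
      = sweedler Q (\<lambda>a b. act a (star A x) \<boxtimes> b) (shift ?u (star Q h))"
    using assms by (simp add: dual_action_pure star_crossed_pure star_shift lin)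
  also have "\<dots> = sweedler Q (\<lambda>a b. act a (star A x) \<boxtimes> shift ?u b) (star Q h)"
    using assms u' by (intro sweedler_shift) (simp_all add: lin)
  also have "\<dots> = sweedler Q (\<lambda>a b. dual_act ?u (act a (star A x) \<boxtimes> b)) (star Q h)"
    using assms u' by (intro sweedler_cong) (simp_all add: lin dual_action_pure)
  also have "\<dots> = dual_act ?u (star R (x \<boxtimes> h))"
    unfolding star_crossed_pure[OF x h] using assms
    by (intro sweedler_apply[symmetric, OF _ _ _ _ bisemilinD(2)[OF dual_action_bisemilin u']])
      (simp_all add: lin)
  finally show ?thesis .
qed

end

sublocale module_star_algebra \<subseteq> crossed: star_algebra "crossed_product A Q act"
  by (rule star_algebra_crossed)

context fin_dim_module_star_algebra
begin

theorem module_star_algebra_dual_action: "module_star_algebra D R dual_act"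
proof
  show "cbilinear_on (carrier D) (carrier R) dual_act"
    by (simp add: cbilinear_on_bisemilin dual_action_bisemilin)
  fix u t assume u: "u \<in> carrier D" and t: "t \<in> carrier R"
  show "dual_act u t \<in> carrier R"
    using u t by (simp add: lin)
  show "dual_act (u \<star> v) t = dual_act u (dual_act v t)" if v: "v \<in> carrier D" for v
    by (rule crossed_eqI[OF _ _ _ t, where s = False])
      (use u v in \<open>simp_all add: lin dual_action_pure shift_mult\<close>)
  show "star R (dual_act u t) = dual_act (star D (antipode D u)) (star R t)"
    by (rule crossed_eqI[OF _ _ _ t, where s = True])
      (use u in \<open>simp_all add: lin dual_action_star_pure\<close>)
  show "dual_act u (t \<bullet> t') = sweedler D (\<lambda>v w. dual_act v t \<bullet> dual_act w t') u"
    if t': "t' \<in> carrier R" for t'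
  proof (rule crossed_eqI[OF _ _ _ t, where s = False])
    fix x h assume xh: "x \<in> carrier A" "h \<in> carrier Q"
    show "dual_act u ((x \<boxtimes> h) \<bullet> t') = sweedler D (\<lambda>v w. dual_act v (x \<boxtimes> h) \<bullet> dual_act w t') u"
      by (rule crossed_eqI[OF _ _ _ t', where s = False])
        (use u xh in \<open>simp_all add: lin dual_action_on_mult_pure\<close>)
  qed (use u t' in \<open>simp_all add: lin\<close>)
next
  show "dual_act \<one>\<^bsub>D\<^esub> t = t" if t: "t \<in> carrier R" for t
    by (rule crossed_eqI[OF _ _ _ t, where s = False])
      (simp_all add: lin dual_action_pure shift_one)
  show "dual_act u \<one>\<^bsub>R\<^esub> = counit D u *\<^sub>C \<one>\<^bsub>R\<^esub>" if u: "u \<in> carrier D" for u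
    using u by (simp add: one_crossed dual_action_pure lin shift_unit scaleC_pure_right counit_dual)
qed

lemma inclusion_object_dual: "inclusion_object (crossed_base A Q) R D dual_act"
  using module_star_algebra_dual_action
  by (auto simp: inclusion_object_def fixed_points_def crossed_base_def lin dual_action_pure
      shift_unit scaleC_pure_right counit_dual)

end

section \<open>The universal property\<close>

locale outer_fin_dim_action = fin_dim_module_star_algebra Q A act
  for Q :: "('q::complex_vector, 'b) hopf_alg_scheme" (structure)
    and A :: "('a::complex_vector, 'c) star_alg_scheme"
    and act :: "'q \<Rightarrow> 'a \<Rightarrow> 'a" +
  assumes one_nonzero: "\<one>\<^bsub>A\<^esub> \<noteq> 0"
    and outer: "outer_action A Q act"
begin

abbreviation hopf_embed where "hopf_embed h \<equiv> \<one>\<^bsub>A\<^esub> \<boxtimes> h"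
abbreviation base_embed where "base_embed x \<equiv> x \<boxtimes> \<one>"

text \<open>
  The functional is \<open>\<omega> \<otimes> \<epsilon>\<close> with \<open>\<omega>(1) = 1\<close>. It recovers \<open>u\<close> from its action by
  \<open>u(h) = (\<omega> \<otimes> \<epsilon>)(u \<cdot> h)\<close>.
\<close>

lemma exists_hopf_functional:
  "\<exists>\<Omega> :: ('a, 'q) tensor \<Rightarrow> complex. semilin False (carrier R) \<Omega> \<and>
    (\<forall>h\<in>carrier Q. \<Omega> (hopf_embed h) = counit Q h)"
proof -
  obtain \<omega>\<^sub>0 :: "'a \<Rightarrow> complex" where \<omega>\<^sub>0: "clinear_on UNIV \<omega>\<^sub>0" "\<omega>\<^sub>0 \<one>\<^bsub>A\<^esub> \<noteq> 0"
    using exists_separating_functional[OF one_nonzero] .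
  define \<omega> where "\<omega> x = \<omega>\<^sub>0 x / \<omega>\<^sub>0 \<one>\<^bsub>A\<^esub>" for x
  have \<omega>: "semilin False (carrier A) \<omega>"
    using \<omega>\<^sub>0(1) by (simp add: \<omega>_def semilin_def clinear_on_def scaleC_complex_def add_divide_distrib)
  let ?\<Omega> = "tensor_lift (carrier A) (carrier Q) (\<lambda>x h. \<omega> x * counit Q h)"
  have bil: "bisemilin False (carrier A) (carrier Q) (\<lambda>x h. \<omega> x * counit Q h)"
    using \<omega> by (simp add: lin)
  have "semilin False (carrier R) ?\<Omega>"
    unfolding carrier_crossed by (intro semilin_tensor_lift bil) (simp_all add: lin)
  moreover have "?\<Omega> (hopf_embed h) = counit Q h" if "h \<in> carrier Q" for h
    using that \<omega>\<^sub>0(2) by (subst tensor_lift_pure_semilin[OF _ _ bil]) (simp_all add: lin \<omega>_def)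
  ultimately show ?thesis
    by blast
qed

lemma dual_action_faithful:
  assumes u: "u \<in> carrier D" and v: "v \<in> carrier D"
    and eq: "\<And>t. t \<in> carrier R \<Longrightarrow> dual_act u t = dual_act v t"
  shows "u = v"
proof (rule dual_eqI[OF u v])
  obtain \<Omega> :: "('a, 'q) tensor \<Rightarrow> complex"
    where \<Omega>: "\<And>h. h \<in> carrier Q \<Longrightarrow> \<Omega> (hopf_embed h) = counit Q h"
    using exists_hopf_functional by blast
  fix h assume h: "h \<in> carrier Q"
  have "\<Omega> (dual_act w (hopf_embed h)) = pairing w h" if "w \<in> carrier D" for w
    using that h by (simp add: dual_action_pure lin \<Omega> counit_shift)
  then show "pairing u h = pairing v h"
    using u v h eq[of "hopf_embed h"] by (metis alg.one_closed pure_in_crossed)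
qed

text \<open>
  \<open>S(h\<^sub>1)(h\<^sub>2 \<cdot> x) = x S(h)\<close> in the crossed product. The action satisfies \<open>h\<^sub>1 (x S(h\<^sub>2)) = h \<cdot> x\<close>, and
  the inversion formula for left multiplication solves this equation for \<open>x S(h)\<close>.
\<close>

lemma antipode_times_base:
  assumes x: "x \<in> carrier A" and h: "h \<in> carrier Q"
  shows "sweedler Q (\<lambda>a b. hopf_embed (antipode Q a) \<bullet> base_embed (act b x)) h
    = x \<boxtimes> antipode Q h"
proof -
  have *: "sweedler Q (\<lambda>c d. hopf_embed c \<bullet> (x \<boxtimes> antipode Q d)) b = base_embed (act b x)"
    if b: "b \<in> carrier Q" for b
  proof -
    have "sweedler Q (\<lambda>c d. hopf_embed c \<bullet> (x \<boxtimes> antipode Q d)) b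
        = sweedler Q (\<lambda>c d. sweedler Q (\<lambda>e f. act e x \<boxtimes> (f \<otimes> antipode Q d)) c) b"
      using b x by (intro sweedler_cong) (simp_all add: mult_crossed_pure lin cong: sweedler_cong)
    also have "\<dots> = sweedler Q (\<lambda>e c. sweedler Q (\<lambda>f d. act e x \<boxtimes> (f \<otimes> antipode Q d)) c) b"
      using b x by (intro sweedler_coassoc) (simp_all add: lin)
    also have "\<dots> = sweedler Q (\<lambda>e c. act e x \<boxtimes> sweedler Q (\<lambda>f d. f \<otimes> antipode Q d) c) b"
      using b x by (intro sweedler_cong sweedler_apply[symmetric, where C = "carrier Q" and r = False])
        (simp_all add: lin)
    also have "\<dots> = sweedler Q (\<lambda>e c. counit Q c *\<^sub>C (act e x \<boxtimes> \<one>)) b"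
      using b by (intro sweedler_cong) (simp_all add: antipode_right scaleC_pure_right)
    also have "\<dots> = base_embed (act b x)"
      using b x by (intro sweedler_counit_right) (simp_all add: lin)
    finally show ?thesis .
  qed
  have "x \<boxtimes> antipode Q h = sweedler Q (\<lambda>a b. hopf_embed (antipode Q a) \<bullet>
      sweedler Q (\<lambda>c d. hopf_embed c \<bullet> (x \<boxtimes> antipode Q d)) b) h"
    using x h
    by (intro antipode_inversion[symmetric, where V = "carrier R"
          and m = "\<lambda>h t. hopf_embed h \<bullet> t" and F = "\<lambda>h. x \<boxtimes> antipode Q h"])
      (simp_all add: lin times_hopf[symmetric] crossed.m_assoc one_crossed[symmetric])
  also have "\<dots> = sweedler Q (\<lambda>a b. hopf_embed (antipode Q a) \<bullet> base_embed (act b x)) h"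
    using h by (intro sweedler_cong) (simp_all add: *)
  finally show ?thesis ..
qed

end

locale crossed_product_symmetry = outer_fin_dim_action Q A act +
  sym: module_star_algebra P "crossed_product A Q act" actP
  for Q :: "('q::complex_vector, 'b) hopf_alg_scheme" (structure)
    and A :: "('a::complex_vector, 'c) star_alg_scheme"
    and act :: "'q \<Rightarrow> 'a \<Rightarrow> 'a"
    and P :: "('p::complex_vector, 'd) hopf_alg_scheme"
    and actP :: "'p \<Rightarrow> ('a, 'q) tensor \<Rightarrow> ('a, 'q) tensor" +
  assumes base_fixed: "crossed_base A Q \<subseteq> fixed_points P (crossed_product A Q act) actP"
begin

lemma act_base:
  "p \<in> carrier P \<Longrightarrow> x \<in> carrier A \<Longrightarrow> actP p (base_embed x) = counit P p *\<^sub>C base_embed x"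
  using base_fixed by (auto simp: crossed_base_def fixed_points_def)

text \<open>
  As \<open>x\<close> in \<open>M\<close> is fixed, the Sweedler factor that acts on it is absorbed by the counit.
\<close>

lemma act_bimodule:
  assumes p: "p \<in> carrier P" and x: "x \<in> carrier A" and t: "t \<in> carrier R"
  shows act_base_times: "actP p (base_embed x \<bullet> t) = base_embed x \<bullet> actP p t"
    and act_times_base: "actP p (t \<bullet> base_embed x) = actP p t \<bullet> base_embed x"
proof -
  have "actP p (base_embed x \<bullet> t)
      = sweedler P (\<lambda>a b. counit P a *\<^sub>C (base_embed x \<bullet> actP b t)) p"
    using assms
    by (simp add: sym.act_on_mult lin act_base crossed.mult_scaleC cong: sym.sweedler_cong)
  also have "\<dots> = base_embed x \<bullet> actP p t"
    using assms by (intro sym.sweedler_counit_left) (simp_all add: lin)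
  finally show "actP p (base_embed x \<bullet> t) = base_embed x \<bullet> actP p t" .
  have "actP p (t \<bullet> base_embed x)
      = sweedler P (\<lambda>a b. counit P b *\<^sub>C (actP a t \<bullet> base_embed x)) p"
    using assms
    by (simp add: sym.act_on_mult lin act_base crossed.mult_scaleC cong: sym.sweedler_cong)
  also have "\<dots> = actP p t \<bullet> base_embed x"
    using assms by (intro sym.sweedler_counit_right) (simp_all add: lin)
  finally show "actP p (t \<bullet> base_embed x) = actP p t \<bullet> base_embed x" .
qed

text \<open>
  The element \<open>S(h\<^sub>1)(p \<cdot> h\<^sub>2)\<close>, which outerness will force to be a multiple of the unit.
\<close>

definition scalar_part :: "'p \<Rightarrow> 'q \<Rightarrow> ('a, 'q) tensor" where
  "scalar_part p h = sweedler Q (\<lambda>a b. hopf_embed (antipode Q a) \<bullet> actP p (hopf_embed b)) h"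

lemma scalar_part_closed [lin]: "p \<in> carrier P \<Longrightarrow> h \<in> carrier Q \<Longrightarrow> scalar_part p h \<in> carrier R"
  by (simp add: scalar_part_def lin)

lemma semilin_scalar_part_right [lin]: "p \<in> carrier P \<Longrightarrow> semilin False (carrier Q) (scalar_part p)"
  using semilin_sweedler[OF _ semilin_ident,
      of "\<lambda>a b. hopf_embed (antipode Q a) \<bullet> actP p (hopf_embed b)" "carrier Q"]
  by (simp add: scalar_part_def[abs_def] lin)

text \<open>
  \<open>S(h\<^sub>1)(p \<cdot> h\<^sub>2) x = S(h\<^sub>1)(h\<^sub>2 \<cdot> x)(p \<cdot> h\<^sub>3) = x S(h\<^sub>1)(p \<cdot> h\<^sub>2)\<close>.
\<close>

lemma scalar_part_commutes:
  assumes p: "p \<in> carrier P" and h: "h \<in> carrier Q" and x: "x \<in> carrier A"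
  shows "scalar_part p h \<bullet> base_embed x = base_embed x \<bullet> scalar_part p h"
proof -
  note act = sym.semilin_act_right[OF semilin_ident _ p]
  have "scalar_part p h \<bullet> base_embed x = sweedler Q (\<lambda>a b.
      hopf_embed (antipode Q a) \<bullet> actP p (hopf_embed b) \<bullet> base_embed x) h"
    unfolding scalar_part_def using assms
    by (intro sweedler_apply[where C = "carrier R" and r = False and g = "\<lambda>t. t \<bullet> _"])
      (simp_all add: lin)
  also have "\<dots> = sweedler Q (\<lambda>a b. sweedler Q (\<lambda>c d.
      hopf_embed (antipode Q a) \<bullet> base_embed (act c x) \<bullet> actP p (hopf_embed d)) b) h"
  proof (intro sweedler_cong h)
    fix a b assume ab: "a \<in> carrier Q" "b \<in> carrier Q"
    have "hopf_embed (antipode Q a) \<bullet> actP p (hopf_embed b) \<bullet> base_embed x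
        = hopf_embed (antipode Q a) \<bullet> actP p (hopf_embed b \<bullet> base_embed x)"
      using assms ab by (simp add: act_times_base crossed.m_assoc lin)
    also have "hopf_embed b \<bullet> base_embed x
        = sweedler Q (\<lambda>c d. base_embed (act c x) \<bullet> hopf_embed d) b"
      using assms ab by (simp add: hopf_times_base base_times lin cong: sweedler_cong)
    also have "hopf_embed (antipode Q a) \<bullet> actP p \<dots>
        = sweedler Q (\<lambda>c d. hopf_embed (antipode Q a) \<bullet>
            actP p (base_embed (act c x) \<bullet> hopf_embed d)) b"
      using assms ab
      by (intro sweedler_apply[where C = "carrier R" and r = False and
            g = "\<lambda>t. hopf_embed (antipode Q a) \<bullet> actP p t"]) (simp_all add: lin)
    also have "\<dots> = sweedler Q (\<lambda>c d.
        hopf_embed (antipode Q a) \<bullet> base_embed (act c x) \<bullet> actP p (hopf_embed d)) b"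
      using assms ab by (intro sweedler_cong) (simp_all add: act_base_times crossed.m_assoc lin)
    finally show "hopf_embed (antipode Q a) \<bullet> actP p (hopf_embed b) \<bullet> base_embed x = \<dots>" .
  qed
  also have "\<dots> = sweedler Q (\<lambda>a b. sweedler Q (\<lambda>c d.
      hopf_embed (antipode Q c) \<bullet> base_embed (act d x) \<bullet> actP p (hopf_embed b)) a) h"
    using assms by (intro sweedler_coassoc[symmetric]) (simp_all add: lin)
  also have "\<dots> = sweedler Q (\<lambda>a b. sweedler Q (\<lambda>c d.
      hopf_embed (antipode Q c) \<bullet> base_embed (act d x)) a \<bullet> actP p (hopf_embed b)) h"
    using assms
    by (intro sweedler_cong sweedler_apply[symmetric, where C = "carrier R" and r = False and
          g = "\<lambda>t. t \<bullet> actP p _"]) (simp_all add: lin)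
  also have "\<dots> = sweedler Q (\<lambda>a b.
      base_embed x \<bullet> (hopf_embed (antipode Q a) \<bullet> actP p (hopf_embed b))) h"
    using assms by (intro sweedler_cong)
      (simp_all add: antipode_times_base lin crossed.m_assoc[symmetric] base_times)
  also have "\<dots> = base_embed x \<bullet> scalar_part p h"
    unfolding scalar_part_def using assms
    by (intro sweedler_apply[symmetric, where C = "carrier R" and r = False]) (simp_all add: lin)
  finally show ?thesis .
qed

lemma scalar_part_scalar:
  assumes "p \<in> carrier P" "h \<in> carrier Q"
  shows "\<exists>c. scalar_part p h = c *\<^sub>C \<one>\<^bsub>R\<^esub>"
proof -
  have "scalar_part p h \<in> commutant_in (crossed_base A Q) R"
    using assms scalar_part_commutes by (auto simp: commutant_in_def crossed_base_def lin)
  then show ?thesis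
    using outer by (auto simp: outer_action_def)
qed

text \<open>
  \<open>h\<^sub>1 S(h\<^sub>2)(p \<cdot> h\<^sub>3) = p \<cdot> h\<close>.
\<close>

lemma act_from_scalar_part:
  assumes p: "p \<in> carrier P" and h: "h \<in> carrier Q"
  shows "actP p (hopf_embed h) = sweedler Q (\<lambda>a b. hopf_embed a \<bullet> scalar_part p b) h"
proof -
  have "sweedler Q (\<lambda>a b. hopf_embed a \<bullet> scalar_part p b) h
      = sweedler Q (\<lambda>a b. sweedler Q (\<lambda>c d.
          hopf_embed a \<bullet> (hopf_embed (antipode Q c) \<bullet> actP p (hopf_embed d))) b) h"
    unfolding scalar_part_def using assms
    by (intro sweedler_cong sweedler_apply[where C = "carrier R" and r = False]) (simp_all add: lin)
  also have "\<dots> = sweedler Q (\<lambda>a b. sweedler Q (\<lambda>c d.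
          hopf_embed (a \<otimes> antipode Q c) \<bullet> actP p (hopf_embed d)) b) h"
    using assms by (intro sweedler_cong) (simp_all add: lin times_hopf[symmetric] crossed.m_assoc)
  also have "\<dots> = sweedler Q (\<lambda>a b. sweedler Q (\<lambda>c d.
          hopf_embed (c \<otimes> antipode Q d) \<bullet> actP p (hopf_embed b)) a) h"
    using assms by (intro sweedler_coassoc[symmetric]) (simp_all add: lin)
  also have "\<dots> = sweedler Q (\<lambda>a b.
          hopf_embed (sweedler Q (\<lambda>c d. c \<otimes> antipode Q d) a) \<bullet> actP p (hopf_embed b)) h"
    using assms
    by (intro sweedler_cong sweedler_apply[symmetric, where C = "carrier Q" and r = False and
          g = "\<lambda>k. hopf_embed k \<bullet> actP p _"]) (simp_all add: lin)
  also have "\<dots> = sweedler Q (\<lambda>a b. counit Q a *\<^sub>C actP p (hopf_embed b)) h"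
    using assms by (intro sweedler_cong)
      (simp_all add: antipode_right scaleC_pure_right lin crossed.mult_scaleC one_crossed[symmetric])
  also have "\<dots> = actP p (hopf_embed h)"
    using assms by (intro sweedler_counit_left) (simp_all add: lin)
  finally show ?thesis ..
qed

definition test_functional :: "('a, 'q) tensor \<Rightarrow> complex" where
  "test_functional = (SOME \<Omega>. semilin False (carrier R) \<Omega> \<and>
     (\<forall>h\<in>carrier Q. \<Omega> (hopf_embed h) = counit Q h))"

lemma test_functional_facts:
  shows semilin_test_functional_carrier: "semilin False (carrier R) test_functional"
    and test_functional_hopf: "\<And>h. h \<in> carrier Q \<Longrightarrow> test_functional (hopf_embed h) = counit Q h"
proof -
  have "semilin False (carrier R) test_functional \<and>
      (\<forall>h\<in>carrier Q. test_functional (hopf_embed h) = counit Q h)"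
    unfolding test_functional_def by (rule someI_ex[OF exists_hopf_functional])
  then show "semilin False (carrier R) test_functional"
    and "\<And>h. h \<in> carrier Q \<Longrightarrow> test_functional (hopf_embed h) = counit Q h"
    by blast+
qed

lemma semilin_test_functional [lin]:
  "semilin s E f \<Longrightarrow> (\<And>x. x \<in> E \<Longrightarrow> f x \<in> carrier R) \<Longrightarrow> semilin s E (\<lambda>x. test_functional (f x))"
  by (rule semilin_compose'[OF semilin_test_functional_carrier])

text \<open>
  The functional \<open>u\<^sub>p\<close> through which \<open>p\<close> acts. Applying \<open>test_functional\<close>, which is 1 at the unit, reads
  off the scalar and keeps it visibly linear in \<open>p\<close> and \<open>h\<close>.
\<close>

definition classify :: "'p \<Rightarrow> 'q \<Rightarrow> complex" where
  "classify p = restrict_zero (carrier Q) (\<lambda>h. test_functional (scalar_part p h))"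

lemma classify_closed [lin]: "p \<in> carrier P \<Longrightarrow> classify p \<in> carrier D"
  unfolding classify_def by (rule restrict_zero_dual) (simp add: lin)

lemma scalar_part_classify:
  assumes "p \<in> carrier P" "h \<in> carrier Q"
  shows "scalar_part p h = pairing (classify p) h *\<^sub>C \<one>\<^bsub>R\<^esub>"
proof -
  obtain c where c: "scalar_part p h = c *\<^sub>C \<one>\<^bsub>R\<^esub>"
    using scalar_part_scalar[OF assms] by blast
  have "test_functional (c *\<^sub>C \<one>\<^bsub>R\<^esub>) = c"
    using semilin_scale[OF semilin_test_functional_carrier crossed.one_closed]
    by (simp add: one_crossed test_functional_hopf counit_one scaleC_complex_def)
  then show ?thesis
    using c assms by (simp add: classify_def pairing_def restrict_zero_def)
qed

text \<open>
  With \<open>u = classify p\<close>: \<open>p \<cdot> (x h) = x (p \<cdot> h) = x h\<^sub>1 u(h\<^sub>2)\<close>.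
\<close>

lemma act_as_dual_action:
  assumes p: "p \<in> carrier P" and t: "t \<in> carrier R"
  shows "actP p t = dual_act (classify p) t"
proof (rule crossed_eqI[OF _ _ _ t, where s = False])
  fix x h assume x: "x \<in> carrier A" and h: "h \<in> carrier Q"
  have "actP p (hopf_embed h)
      = sweedler Q (\<lambda>a b. hopf_embed a \<bullet> (pairing (classify p) b *\<^sub>C \<one>\<^bsub>R\<^esub>)) h"
    using p h by (simp add: act_from_scalar_part scalar_part_classify cong: sweedler_cong)
  also have "\<dots> = sweedler Q (\<lambda>a b. hopf_embed (pairing (classify p) b *\<^sub>C a)) h"
    using p h by (intro sweedler_cong) (simp_all add: crossed.mult_scaleC lin scaleC_pure_right)
  also have "\<dots> = hopf_embed (shift (classify p) h)"
    unfolding shift_def using p h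
    by (intro sweedler_apply[symmetric, where C = "carrier Q" and r = False]) (simp_all add: lin)
  finally have "actP p (hopf_embed h) = hopf_embed (shift (classify p) h)" .
  then have "base_embed x \<bullet> actP p (hopf_embed h) = x \<boxtimes> shift (classify p) h"
    using p x h by (simp add: base_times lin)
  then have "actP p (base_embed x \<bullet> hopf_embed h) = x \<boxtimes> shift (classify p) h"
    using p x h by (subst act_base_times) (simp_all add: lin)
  then show "actP p (x \<boxtimes> h) = dual_act (classify p) (x \<boxtimes> h)"
    using p x h by (simp add: base_times dual_action_pure lin)
qed (use p in \<open>simp_all add: lin\<close>)

lemma pairing_classify:
  assumes "p \<in> carrier P" "h \<in> carrier Q"
  shows "pairing (classify p) h = test_functional (actP p (hopf_embed h))"
  using assms by (simp add: act_as_dual_action dual_action_pure lin test_functional_hopf counit_shift)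

lemma semilin_classify_carrier: "semilin False (carrier P) classify"
proof (rule semilin_dualI)
  fix h assume h: "h \<in> carrier Q"
  show "semilin False (carrier P) (\<lambda>p. pairing (classify p) h)"
    by (subst semilin_cong[where g = "\<lambda>p. test_functional (actP p (hopf_embed h))"])
      (use h in \<open>simp_all add: pairing_classify lin\<close>)
qed (simp_all add: lin)

lemma semilin_classify [lin]:
  "semilin s E f \<Longrightarrow> (\<And>x. x \<in> E \<Longrightarrow> f x \<in> carrier P) \<Longrightarrow> semilin s E (\<lambda>x. classify (f x))"
  by (rule semilin_compose'[OF semilin_classify_carrier])

lemma classify_mult:
  assumes "p \<in> carrier P" "q \<in> carrier P"
  shows "classify (p \<otimes>\<^bsub>P\<^esub> q) = classify p \<star> classify q"
proof (rule dual_action_faithful)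
  interpret dual_mod: module_star_algebra D R dual_act by (rule module_star_algebra_dual_action)
  fix t assume "t \<in> carrier R"
  then show "dual_act (classify (p \<otimes>\<^bsub>P\<^esub> q)) t = dual_act (classify p \<star> classify q) t"
    using assms by (simp add: dual_mod.act_mult sym.act_mult lin flip: act_as_dual_action)
qed (use assms in \<open>simp_all add: lin\<close>)

lemma classify_one: "classify \<one>\<^bsub>P\<^esub> = \<one>\<^bsub>D\<^esub>"
proof (rule dual_action_faithful)
  interpret dual_mod: module_star_algebra D R dual_act by (rule module_star_algebra_dual_action)
  fix t assume "t \<in> carrier R"
  then show "dual_act (classify \<one>\<^bsub>P\<^esub>) t = dual_act \<one>\<^bsub>D\<^esub> t"
    by (simp add: dual_mod.act_unit sym.act_unit lin flip: act_as_dual_action)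
qed (simp_all add: lin)

lemma classify_counit:
  assumes "p \<in> carrier P"
  shows "counit D (classify p) = counit P p"
  using assms semilin_scale[OF semilin_test_functional_carrier crossed.one_closed]
  by (simp add: counit_dual pairing_classify sym.act_on_one test_functional_hopf counit_one
      scaleC_complex_def flip: one_crossed) (simp add: one_crossed test_functional_hopf counit_one)

text \<open>
  Evaluated at \<open>(h, g)\<close>, both sides are obtained from \<open>p \<cdot> (h g) = (p\<^sub>1 \<cdot> h)(p\<^sub>2 \<cdot> g)\<close> by applying \<open>\<omega> \<otimes> \<epsilon>\<close>.
\<close>

lemma classify_comult:
  assumes p: "p \<in> carrier P"
  shows "comult D (classify p) = sweedler P (\<lambda>a b. classify a \<boxtimes> classify b) p"
proof (rule tensor_eval_eqI)
  fix h g assume hg: "h \<in> carrier Q" "g \<in> carrier Q"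
  have "tensor_eval h g (comult D (classify p))
      = test_functional (actP p (hopf_embed h \<bullet> hopf_embed g))"
    using p hg by (simp add: tensor_eval_comult lin pairing_classify times_hopf)
  also have "\<dots> = test_functional (sweedler P (\<lambda>a b.
      actP a (hopf_embed h) \<bullet> actP b (hopf_embed g)) p)"
    using p hg by (simp add: sym.act_on_mult lin)
  also have "\<dots> = sweedler P (\<lambda>a b. test_functional (
      actP a (hopf_embed h) \<bullet> actP b (hopf_embed g))) p"
    using p hg by (intro sym.sweedler_apply[OF _ _ _ _ semilin_test_functional_carrier]) (simp_all add: lin)
  also have "\<dots> = sweedler P (\<lambda>a b. tensor_eval h g (classify a \<boxtimes> classify b)) p"
    using p hg
    by (intro sym.sweedler_cong)
      (simp_all add: act_as_dual_action dual_action_pure lin times_hopf test_functional_hopf counit_mult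
        counit_shift tensor_eval_pure)
  also have "\<dots> = tensor_eval h g (sweedler P (\<lambda>a b. classify a \<boxtimes> classify b) p)"
    using p hg by (intro sym.sweedler_apply[symmetric, OF _ _ _ _ semilin_tensor_eval_carrier])
      (simp_all add: lin)
  finally show "tensor_eval h g (comult D (classify p))
    = tensor_eval h g (sweedler P (\<lambda>a b. classify a \<boxtimes> classify b) p)" .
qed (use p in \<open>simp_all add: lin\<close>)

lemma sweedler_classify:
  assumes f: "bisemilin False (carrier D) (carrier D) f" and p: "p \<in> carrier P"
  shows "sweedler D f (classify p) = sweedler P (\<lambda>a b. f (classify a) (classify b)) p"
proof -
  let ?L = "tensor_lift (carrier D) (carrier D) f"
  have "sweedler D f (classify p) = ?L (sweedler P (\<lambda>a b. classify a \<boxtimes> classify b) p)"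
    using p by (simp add: sweedler_def[of D] classify_comult)
  also have "\<dots> = sweedler P (\<lambda>a b. ?L (classify a \<boxtimes> classify b)) p"
    using p by (intro sym.sweedler_apply[OF _ _ _ _ semilin_tensor_lift[OF _ _ f]])
      (simp_all add: lin)
  also have "\<dots> = sweedler P (\<lambda>a b. f (classify a) (classify b)) p"
    using p by (intro sym.sweedler_cong tensor_lift_pure_semilin[OF _ _ f]) (simp_all add: lin)
  finally show ?thesis .
qed

text \<open>
  Morphisms of bialgebras preserve antipodes: both \<open>S \<circ> classify\<close> and \<open>classify \<circ> S\<close> are convolution
  inverses of \<open>classify\<close>.
\<close>

lemma classify_antipode:
  assumes p: "p \<in> carrier P"
  shows "antipode D (classify p) = classify (antipode P p)"
proof -
  have "sweedler P (\<lambda>c d. classify c \<star> antipode D (classify d)) p = counit P p *\<^sub>C \<one>\<^bsub>D\<^esub>"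
    if p: "p \<in> carrier P" for p
  proof -
    have "sweedler P (\<lambda>c d. classify c \<star> antipode D (classify d)) p
        = sweedler D (\<lambda>c d. c \<star> antipode D d) (classify p)"
      using p by (intro sweedler_classify[symmetric]) (simp_all add: lin)
    then show ?thesis
      using p by (simp add: dual.antipode_right lin classify_counit)
  qed
  then have "antipode D (classify p) = classify (antipode P p) \<star> \<one>\<^bsub>D\<^esub>"
    using p
    by (intro sym.antipode_unique[where V = "carrier D" and m = "\<lambda>p v. classify p \<star> v"
          and F = "\<lambda>p. antipode D (classify p)"])
      (simp_all add: lin classify_mult classify_one dual.m_assoc)
  then show ?thesis
    using p by (simp add: lin)
qed

text \<open>
  The compatibility of actions with involutions determines \<open>u\<^sub>q\<close> for \<open>q = S(p)\<^sup>*\<close>. As the map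
  \<open>p \<mapsto> S(p)\<^sup>*\<close> is an involution, these are all elements.
\<close>

lemma classify_star:
  assumes p: "p \<in> carrier P"
  shows "classify (star P p) = star D (classify p)"
proof -
  interpret dual_mod: module_star_algebra D R dual_act by (rule module_star_algebra_dual_action)
  have *: "classify (star P (antipode P p)) = star D (antipode D (classify p))"
    if p: "p \<in> carrier P" for p
  proof (rule dual_action_faithful)
    fix t assume t: "t \<in> carrier R"
    have "dual_act (classify (star P (antipode P p))) t = actP (star P (antipode P p)) (star R (star R t))"
      using p t by (simp add: act_as_dual_action lin crossed.star_star)
    also have "\<dots> = star R (dual_act (classify p) (star R t))"
      using p t by (simp add: sym.act_star lin flip: act_as_dual_action)
    also have "\<dots> = dual_act (star D (antipode D (classify p))) t"
      using p t by (simp add: dual_mod.act_star lin crossed.star_star)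
    finally show "dual_act (classify (star P (antipode P p))) t
      = dual_act (star D (antipode D (classify p))) t" .
  qed (use p in \<open>simp_all add: lin\<close>)
  \<comment> \<open>The element with \<open>S(q) = p\<close>.\<close>
  define q where "q = star P (antipode P (star P p))"
  have q: "q \<in> carrier P" "antipode P q = p"
    using p by (simp_all add: q_def lin sym.antipode_star_antipode sym.star_star)
  show ?thesis
    using *[OF q(1)] q by (simp add: classify_antipode)
qed

theorem exists_unique_inclusion_hom:
  "\<exists>!\<phi>. \<phi> \<in> inclusion_hom R P actP D dual_act"
proof (rule ex1I)
  have ext: "restrict classify (carrier P) q = classify q" if "q \<in> carrier P" for q
    using that by simp
  have "restrict classify (carrier P) \<in> star_hom P D"
    by (auto simp: star_hom_def clinear_on_semilin lin classify_mult classify_one classify_star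
        semilin_cong[OF ext sym.subspace_carrier] semilin_classify_carrier)
  then show "restrict classify (carrier P) \<in> inclusion_hom R P actP D dual_act"
    by (auto simp: inclusion_hom_def hopf_star_hom_def classify_comult classify_counit
        classify_antipode act_as_dual_action lin intro!: sym.sweedler_cong)
next
  fix \<phi> assume \<phi>: "\<phi> \<in> inclusion_hom R P actP D dual_act"
  show "\<phi> = restrict classify (carrier P)"
  proof (rule extensionalityI)
    show "\<phi> \<in> extensional (carrier P)"
      using \<phi> by (simp add: inclusion_hom_def hopf_star_hom_def)
    fix p assume p: "p \<in> carrier P"
    have "\<phi> p = classify p"
    proof (rule dual_action_faithful)
      show "\<phi> p \<in> carrier D"
        using \<phi> p by (auto simp: inclusion_hom_def hopf_star_hom_def star_hom_def)
      show "dual_act (\<phi> p) t = dual_act (classify p) t" if "t \<in> carrier R" for t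
        using \<phi> p that by (simp add: inclusion_hom_def flip: act_as_dual_action)
    qed (use p in \<open>simp add: lin\<close>)
    then show "\<phi> p = restrict classify (carrier P) p"
      using p by simp
  qed simp
qed

end

theorem theorem4p1p7:
  fixes M :: "('v::complex_hilbert_space \<Rightarrow> 'v) set"
    and H :: "'h::complex_vector hopf_alg"
    and act :: "'h \<Rightarrow> ('v \<Rightarrow> 'v) \<Rightarrow> ('v \<Rightarrow> 'v)"
  assumes "finite_factor M"
    and "finite_dim_hopf_cstar_algebra H"
    and "module_star_algebra H (operator_algebra M) act"
    and "outer_action (operator_algebra M) H act"
  shows "is_QGal TYPE('q::complex_vector)
           (crossed_base (operator_algebra M) H)
           (crossed_product (operator_algebra M) H act)
           (dual_hopf H)
           (dual_action (operator_algebra M) H)"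
proof -
  interpret module_star_algebra H "operator_algebra M" act by fact
  interpret outer_fin_dim_action H "operator_algebra M" act
  proof
    show "\<exists>B. finite B \<and> complex_vector.span B = carrier H"
      using assms(2) by (simp add: finite_dim_hopf_cstar_algebra_def)
    show "\<one>\<^bsub>operator_algebra M\<^esub> \<noteq> 0"
      using assms(1) by (simp add: operator_algebra_def finite_factor_def factor_def)
    show "outer_action (operator_algebra M) H act" by fact
  qed
  show ?thesis
    unfolding is_QGal_def
  proof (intro conjI allI impI)
    fix Q :: "'q hopf_alg" and actQ
    assume "inclusion_object (crossed_base (operator_algebra M) H) R Q actQ"
    then interpret crossed_product_symmetry H "operator_algebra M" act Q actQ
      by (auto simp: inclusion_object_def crossed_product_symmetry_def
          crossed_product_symmetry_axioms_def outer_fin_dim_action_axioms)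
    show "\<exists>!\<phi>. \<phi> \<in> inclusion_hom R Q actQ (dual_hopf H) (dual_action (operator_algebra M) H)"
      by (rule exists_unique_inclusion_hom)
  qed (rule unital_star_subalgebra_crossed_base inclusion_object_dual)+
qed

end
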